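(* Let $\{p_k/q_k\}\subset(0,1)$ be a sequence of even rational parameters converging to an irrational number. For each $k$ let $B_k$ be a block associated to $p_k/q_k$. Let $N$ be any fixed integer. Then for all sufficiently large $k$, both the number of distinct plaid polygons (for the parameter $p_k/q_k$) contained in $B_k$ and the maximum diameter of a plaid polygon contained in $B_k$ exceed $N$.
   Context: An even rational parameter is a rational $p/q\in(0,1)$, $p,q$ positive coprime integers, $pq$ even. Put $\omega=p+q$, $P=2p/\omega$, $Q=2q/\omega$. Line families: $\mathcal H$ = lines $y=n$, $\mathcal V$ = lines $x=n$ ($n\in\mathbb Z$), $\mathcal P$ = lines of slope $-P$ with integer $y$-intercept, $\mathcal Q$ = lines of slope $-Q$ with integer $y$-intercept. Functions mod $2\mathbb Z$, values represented in $(-1,1]$: $F_H=2Py$, $F_V=2Px$, $F_P=Py+P^2x+1$, $F_Q=Py+PQx+1$. A unit segment is an edge of a unit square of the integer grid; horizontal ones lie on $\mathcal H$-lines (set $A=H$), vertical ones on $\mathcal V$-lines (set $A=V$). A point $z$ of a unit segment $s$ is a light point of $s$ if for some $B\in\{P,Q\}$, $z$ lies on a line of $\mathcal B$, $F_A(z)F_B(z)>0$ and $|F_B(z)|<|F_A(z)|$. The light count of $s$ is the number of distinct light points of $s$, a light point that is the midpoint of a horizontal $s$ counted twice; $s$ is good if its light count is $1$. In each unit square draw the segments joining its center to the midpoints of its good edges; the plaid polygons are the connected components of the union of all these segments. Blocks: a block is a square $[0,\omega]^2+\ell$ with $\ell$ in the lattice generated by $(\omega^2,0)$ and $(0,\omega)$.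 *)

theory Defs
  imports "HOL-Analysis.Analysis"
begin

definition even_rational_param :: "nat \<Rightarrow> nat \<Rightarrow> bool" where
  "even_rational_param p q \<longleftrightarrow> 0 < p \<and> 0 < q \<and> p < q \<and> coprime p q \<and> even (p * q)"

definition om :: "nat \<Rightarrow> nat \<Rightarrow> real" where "om p q = real (p + q)"
definition PP :: "nat \<Rightarrow> nat \<Rightarrow> real" where "PP p q = 2 * real p / om p q"
definition QQ :: "nat \<Rightarrow> nat \<Rightarrow> real" where "QQ p q = 2 * real q / om p q"

text \<open>Representative of t mod 2Z in (-1,1].\<close>
definition red :: "real \<Rightarrow> real" where
  "red t = t - 2 * of_int (ceiling ((t - 1) / 2))"

definition FH :: "nat \<Rightarrow> nat \<Rightarrow> real \<times> real \<Rightarrow> real" where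
  "FH p q z = red (2 * PP p q * snd z)"
definition FV :: "nat \<Rightarrow> nat \<Rightarrow> real \<times> real \<Rightarrow> real" where
  "FV p q z = red (2 * PP p q * fst z)"
definition FP :: "nat \<Rightarrow> nat \<Rightarrow> real \<times> real \<Rightarrow> real" where
  "FP p q z = red (PP p q * snd z + (PP p q)^2 * fst z + 1)"
definition FQ :: "nat \<Rightarrow> nat \<Rightarrow> real \<times> real \<Rightarrow> real" where
  "FQ p q z = red (PP p q * snd z + PP p q * QQ p q * fst z + 1)"

definition onP :: "nat \<Rightarrow> nat \<Rightarrow> real \<times> real \<Rightarrow> bool" where
  "onP p q z \<longleftrightarrow> snd z + PP p q * fst z \<in> \<int>"
definition onQ :: "nat \<Rightarrow> nat \<Rightarrow> real \<times> real \<Rightarrow> bool" where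
  "onQ p q z \<longleftrightarrow> snd z + QQ p q * fst z \<in> \<int>"

definition light :: "nat \<Rightarrow> nat \<Rightarrow> (real \<times> real \<Rightarrow> real) \<Rightarrow> real \<times> real \<Rightarrow> bool" where
  "light p q FA z \<longleftrightarrow>
     (onP p q z \<and> FA z * FP p q z > 0 \<and> \<bar>FP p q z\<bar> < \<bar>FA z\<bar>) \<or>
     (onQ p q z \<and> FA z * FQ p q z > 0 \<and> \<bar>FQ p q z\<bar> < \<bar>FA z\<bar>)"

definition hseg :: "int \<Rightarrow> int \<Rightarrow> (real \<times> real) set" where
  "hseg m n = closed_segment (of_int m, of_int n) (of_int m + 1, of_int n)"
definition vseg :: "int \<Rightarrow> int \<Rightarrow> (real \<times> real) set" where
  "vseg m n = closed_segment (of_int m, of_int n) (of_int m, of_int n + 1)"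

definition hmid :: "int \<Rightarrow> int \<Rightarrow> real \<times> real" where
  "hmid m n = (of_int m + 1/2, of_int n)"
definition vmid :: "int \<Rightarrow> int \<Rightarrow> real \<times> real" where
  "vmid m n = (of_int m, of_int n + 1/2)"

definition light_count_h :: "nat \<Rightarrow> nat \<Rightarrow> int \<Rightarrow> int \<Rightarrow> nat" where
  "light_count_h p q m n =
     card {z \<in> hseg m n. light p q (FH p q) z}
     + (if light p q (FH p q) (hmid m n) then 1 else 0)"
definition light_count_v :: "nat \<Rightarrow> nat \<Rightarrow> int \<Rightarrow> int \<Rightarrow> nat" where
  "light_count_v p q m n = card {z \<in> vseg m n. light p q (FV p q) z}"

definition good_h :: "nat \<Rightarrow> nat \<Rightarrow> int \<Rightarrow> int \<Rightarrow> bool" where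
  "good_h p q m n \<longleftrightarrow> light_count_h p q m n = 1"
definition good_v :: "nat \<Rightarrow> nat \<Rightarrow> int \<Rightarrow> int \<Rightarrow> bool" where
  "good_v p q m n \<longleftrightarrow> light_count_v p q m n = 1"

definition center :: "int \<Rightarrow> int \<Rightarrow> real \<times> real" where
  "center m n = (of_int m + 1/2, of_int n + 1/2)"

definition plaid_union :: "nat \<Rightarrow> nat \<Rightarrow> (real \<times> real) set" where
  "plaid_union p q =
     \<Union>{closed_segment (center m n) (hmid m n) | m n. good_h p q m n} \<union>
     \<Union>{closed_segment (center m n) (hmid m (n + 1)) | m n. good_h p q m (n + 1)} \<union>
     \<Union>{closed_segment (center m n) (vmid m n) | m n. good_v p q m n} \<union>
     \<Union>{closed_segment (center m n) (vmid (m + 1) n) | m n. good_v p q (m + 1) n}"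

definition plaid_polygons :: "nat \<Rightarrow> nat \<Rightarrow> (real \<times> real) set set" where
  "plaid_polygons p q = {connected_component_set (plaid_union p q) z | z. z \<in> plaid_union p q}"

definition block :: "nat \<Rightarrow> nat \<Rightarrow> int \<Rightarrow> int \<Rightarrow> (real \<times> real) set" where
  "block p q a b = {(x, y).
      of_int a * (om p q)^2 \<le> x \<and> x \<le> of_int a * (om p q)^2 + om p q \<and>
      of_int b * om p q \<le> y \<and> y \<le> of_int b * om p q + om p q}"

end

theory Submission
  imports Defs
begin

text \<open>
  Write \<open>P = 2p/\<omega>\<close>, \<open>\<omega> = p + q\<close>. On a line of capacity \<open>c\<close> the light points are the crossings with
  slanting lines \<open>j\<close> whose signed mass lies between \<open>0\<close> and \<open>c\<close>, and every unit edge meets exactly two slanting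
  lines, so an edge is good iff exactly one of them is light there. Modulo 2, being light is a sum of floors,
  and goodness becomes the parity of a sum of four values of \<open>E i = \<lfloor>(P i + 1) / 2\<rfloor>\<close>; around a unit square these
  sums cancel, so every square has an even number of good edges.

  Large diameter: on the line \<open>y = n\<close> with \<open>2pn \<equiv> 1 (mod \<omega>)\<close> the leftmost edge of the block is good, and every
  other good edge of the block is at distance about \<open>\<omega>/2\<close>. Since a polygon crosses the line an even
  number of times, the polygon through the leftmost edge reaches that far.

  Many polygons: goodness of an edge amounts to a strict comparison of distances to \<open>2\<int>\<close> of multiples of \<open>P\<close>
  and of \<open>P n\<close>, hence makes sense for irrational \<open>P\<close> and a real phase \<open>u\<close> in place of \<open>P n\<close>, and it is stable
  under perturbation. For each irrational \<open>P\<close> some rectangle of unit squares has no good edge on its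
  boundary but a good edge inside. For parameters close to \<open>P\<close> it reappears at every
  height \<open>n\<close> with \<open>P n\<close> close to \<open>u\<close> modulo 2, and there are arbitrarily many of these in a block.
\<close>

section \<open>Light points and parities\<close>

text \<open>Two points of the definitions carry the parity argument. Since \<open>p * q\<close> is
  even, \<open>W\<close> is odd, so \<open>P * i\<close> is never an odd integer, and modulo 2 no
  mass is \<open>0\<close> or equal to a capacity. The double count at the midpoint of a horizontal
  edge covers the case where the two slanting lines of an edge meet on it: then both are light or
  neither is, and the count is \<open>2\<close> or \<open>0\<close>. The lattice of blocks comes
  from \<open>P * W = 2 * p\<close>. Goodness survives a vertical translation by \<open>W\<close>; a
  horizontal one by \<open>W\<close> moves \<lfloor>P * m\<rfloor> by \<open>2 * p\<close>, and the
  translation by \<open>W * W\<close> moves it by a multiple of \<open>W\<close>. The obstacle to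
  finding many polygons is that small ones must be trapped explicitly for every irrational
  \<open>P\<close>. As only one limit matters at a time, the rectangle may depend on
  \<open>P\<close>, provided that all its inequalities are strict. For \<open>P\<close> near 0 or
  near 1 its columns move off like \<open>1 / (2 * P)\<close> and \<open>1 / (2 * (1 - P))\<close>,
  where \<open>P * m\<close>, respectively \<open>(1 - P) * m\<close>, is about \<open>1/2\<close>;
  the middle range is left to finitely many boxes with fixed columns.\<close>

definition lit :: "real \<Rightarrow> real \<Rightarrow> bool" where
  "lit c t \<longleftrightarrow> red c * red t > 0 \<and> \<bar>red t\<bar> < \<bar>red c\<bar>"

lemma red_bounds: "-1 < red t" "red t \<le> 1"
proof -
  obtain k where k: "k = \<lceil>(t - 1) / 2\<rceil>" by simp
  have "of_int k - 1 < (t - 1) / 2" "(t - 1) / 2 \<le> of_int k"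
    unfolding k using ceiling_correct[of "(t - 1) / 2"] by blast+
  thus "-1 < red t" "red t \<le> 1" unfolding red_def k[symmetric] by (simp_all add: field_simps)
qed

text \<open>Light means that the representative \<open>t0\<close> lies strictly between
  \<open>0\<close> and \<open>c0\<close>, that is, exactly one of \<open>t0 < 0\<close> and
  \<open>t0 < c0\<close> holds. These two truth values are the corrections in the two floors; the
  ceiling cancels the remaining \<open>k\<close>. The hypotheses exclude the boundary
  values.\<close>

lemma lit_iff_odd:
  fixes c t :: real
  assumes t: "\<And>k. t \<noteq> 2 * of_int k" and tc: "\<And>k. t - c \<noteq> 2 * of_int k"
    and c: "\<And>k. c - 1 \<noteq> 2 * of_int k"
  shows "lit c t \<longleftrightarrow> odd (\<lfloor>t / 2\<rfloor> + \<lfloor>(t - c) / 2\<rfloor> + \<lceil>(c - 1) / 2\<rceil>)"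
proof -
  define k where "k = \<lceil>(c - 1) / 2\<rceil>"
  define l where "l = \<lceil>(t - 1) / 2\<rceil>"
  define c0 where "c0 = red c"
  define t0 where "t0 = red t"
  have ck: "c = c0 + 2 * k" and tl: "t = t0 + 2 * l"
    by (simp_all add: c0_def t0_def k_def l_def red_def)
  have c0: "-1 < c0" "c0 \<le> 1" and t0: "-1 < t0" "t0 \<le> 1"
    unfolding c0_def t0_def by (rule red_bounds)+
  have c0': "c0 \<noteq> 1" and t0': "t0 \<noteq> 0" and ne: "t0 \<noteq> c0"
    using c[of k] t[of l] tc[of "l - k"] unfolding ck tl by simp_all
  have f1: "\<lfloor>t / 2\<rfloor> = l + (if t0 < 0 then -1 else 0)"
    unfolding tl using t0 t0' by (auto simp: floor_eq_iff)
  have f2: "\<lfloor>(t - c) / 2\<rfloor> = l - k + (if t0 < c0 then -1 else 0)"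
    unfolding tl ck using t0 c0 ne by (auto simp: floor_eq_iff)
  have "lit c t \<longleftrightarrow> (t0 < 0) \<noteq> (t0 < c0)"
    unfolding lit_def c0_def[symmetric] t0_def[symmetric] using t0 c0 t0' c0' ne
    by (auto simp: zero_less_mult_iff)
  also have "\<dots> \<longleftrightarrow> odd (\<lfloor>t / 2\<rfloor> + \<lfloor>(t - c) / 2\<rfloor> + k)"
    unfolding f1 f2 by auto
  finally show ?thesis by (simp add: k_def)
qed

lemma red_plus_even: "red (t + 2 * of_int k) = red t"
proof -
  have "(t + 2 * of_int k - 1) / 2 = (t - 1) / 2 + of_int k" by (simp add: field_simps)
  hence "\<lceil>(t + 2 * of_int k - 1) / 2\<rceil> = \<lceil>(t - 1) / 2\<rceil> + k" by (simp only: ceiling_add_of_int)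
  thus ?thesis by (simp add: red_def)
qed

lemma red_0 [simp]: "red 0 = 0"
  by (simp add: red_def ceiling_eq_iff)

lemma Ints_iff_of_int: "x \<in> \<int> \<longleftrightarrow> (\<exists>k. x = of_int k)"
  by (auto elim: Ints_cases)

text \<open>\<open>R\<close> stands for lying on an edge, \<open>U j\<close> and \<open>V j\<close>
  for lying on line \<open>j\<close> of either slanting family. On the edge each family offers a
  single line, \<open>i1\<close> or \<open>i2\<close>, and a single point, singled out by
  \<open>T1\<close> or \<open>T2\<close>.\<close>

lemma two_witnesses:
  assumes "\<And>j. R \<and> U j \<longleftrightarrow> j = i1 \<and> T1" "\<And>j. R \<and> V j \<longleftrightarrow> j = i2 \<and> T2"
  shows "R \<and> (\<exists>j. (U j \<or> V j) \<and> L j) \<longleftrightarrow> T1 \<and> L i1 \<or> T2 \<and> L i2"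
  using assms by metis

section \<open>Arithmetic of a single parameter\<close>

locale plaid =
  fixes p q :: nat
  assumes param: "even_rational_param p q"
begin

abbreviation P :: real where "P \<equiv> PP p q"
abbreviation Q :: real where "Q \<equiv> QQ p q"
definition W :: int where "W = int p + int q"
text \<open>Half of the mass \<open>P * i + 1\<close> of the slanting line with intercept
  \<open>i\<close>, rounded down; equivalently \<open>P * i / 2\<close> rounded to the nearest
  integer.\<close>

definition E :: "int \<Rightarrow> int" where "E i = \<lfloor>(P * of_int i + 1) / 2\<rfloor>"

lemma pq: "0 < p" "p < q" "coprime p q"
  using param by (auto simp: even_rational_param_def)

lemma W_pos: "0 < W" using pq by (simp add: W_def)

lemma odd_W: "odd W"
proof -
  have "even p \<or> even q" using param by (simp add: even_rational_param_def)
  moreover have "\<not> (even p \<and> even q)" using pq(3)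
    by (meson coprime_common_divisor dvd_def odd_one)
  ultimately show ?thesis by (auto simp: W_def)
qed

lemma om_W: "om p q = of_int W"
  by (simp add: om_def W_def)

lemma P_W: "P * of_int W = 2 * of_nat p"
  using W_pos by (simp add: PP_def om_W)

lemma P_bounds: "0 < P" "P < 1"
  using pq by (auto simp: PP_def om_def field_simps)

lemma Q_P: "Q = 2 - P"
  using pq by (simp add: PP_def QQ_def om_def field_simps)

lemma coprime_p_W: "coprime (int p) W"
  using pq(3) by (simp add: W_def coprime_iff_gcd_eq_1)

lemma P_eq_ratio_iff: "P * of_int i = of_int k / of_int n \<longleftrightarrow> 2 * int p * i * n = k * W" if "n \<noteq> 0"
proof -
  have "P * of_int i = of_int k / of_int n \<longleftrightarrow> 2 * real p * of_int i * of_int n = of_int k * of_int W"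
    using that W_pos by (simp add: PP_def om_W field_simps)
  also have "\<dots> \<longleftrightarrow> real_of_int (2 * int p * i * n) = of_int (k * W)" by simp
  finally show ?thesis by (simp only: of_int_eq_iff)
qed

text \<open>\<open>P * i = 2 * p * i / W\<close>, and \<open>2 * p\<close> is prime to the odd
  number \<open>W\<close>.\<close>

lemma P_int_iff: "P * of_int i \<in> \<int> \<longleftrightarrow> W dvd i"
proof
  assume "P * of_int i \<in> \<int>"
  then obtain k where "P * of_int i = of_int k" by (auto elim: Ints_cases)
  hence "W dvd 2 * (int p * i)" using P_eq_ratio_iff[of 1 i k] by (simp add: dvd_def mult_ac)
  moreover have "coprime W (2 * int p)" using odd_W coprime_p_W by (simp add: coprime_commute)
  ultimately show "W dvd i"
    by (metis coprime_dvd_mult_right_iff mult.assoc)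
next
  assume "W dvd i"
  then obtain k where "i = W * k" by auto
  hence "P * of_int i = of_int (2 * int p * k)" using P_W by (simp add: mult.assoc[symmetric])
  thus "P * of_int i \<in> \<int>" by (metis Ints_of_int)
qed

text \<open>Otherwise \<open>2 * p * i\<close> would be a product of two odd numbers. This is how
  the parity of \<open>p * q\<close> excludes ties in the rounding \<open>E\<close>.\<close>

lemma P_odd: "P * of_int i + 1 \<noteq> 2 * of_int k"
proof
  assume "P * of_int i + 1 = 2 * of_int k"
  hence "P * of_int i = of_int (2 * k - 1) / of_int 1" by simp
  hence "2 * int p * i = (2 * k - 1) * W" using P_eq_ratio_iff[of 1 i "2 * k - 1"] by simp
  hence "even ((2 * k - 1) * W)" by (metis dvd_triv_left mult.assoc)
  thus False using odd_W by simp
qed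

text \<open>Subtracting the capacity \<open>2 * P * n\<close> from the mass of line \<open>j\<close>
  gives the mass of line \<open>j - 2 * n\<close>, so both floors of \<open>lit_iff_odd\<close> are
  values of \<open>E\<close>. The ceiling depends on the row only and drops out when two lines of a
  row are compared.\<close>

lemma lit_E:
  "lit (2 * P * of_int n) (P * of_int j + 1) \<longleftrightarrow> odd (E j + E (j - 2 * n) + \<lceil>(2 * P * of_int n - 1) / 2\<rceil>)"
proof -
  have 1: "P * of_int j + 1 - 2 * P * of_int n = P * of_int (j - 2 * n) + 1" by (simp add: algebra_simps)
  have 2: "2 * P * of_int n - 1 \<noteq> 2 * of_int k" for k
    using P_odd[of "2 * n" "k + 1"] by (simp add: algebra_simps)
  have 3: "P * of_int j + 1 - 2 * P * of_int n \<noteq> 2 * of_int k" for k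
    unfolding 1 by (rule P_odd)
  show ?thesis
    unfolding lit_iff_odd[OF P_odd 3 2] unfolding 1 E_def by simp
qed

lemma lit_neq_iff:
  "lit (2 * P * of_int n) (P * of_int i + 1) \<noteq> lit (2 * P * of_int n) (P * of_int j + 1)
    \<longleftrightarrow> odd (E i + E (i - 2 * n) + (E j + E (j - 2 * n)))"
  unfolding lit_E by auto

lemma E_shift: "E (i + W * k) = E i + int p * k"
proof -
  have "P * of_int (i + W * k) = P * of_int i + P * of_int W * of_int k" by (simp add: distrib_left)
  hence "(P * of_int (i + W * k) + 1) / 2 = (P * of_int i + 1) / 2 + of_int (int p * k)"
    unfolding P_W by (simp add: field_simps)
  thus ?thesis unfolding E_def by (metis floor_add_int)
qed

text \<open>Rounding to the nearest integer is an odd function away from ties, and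
  \<open>P_odd\<close> excludes ties.\<close>

lemma E_minus: "E (- i) = - E i"
proof -
  have "\<lfloor>(1 - x) / 2\<rfloor> = - \<lfloor>(x + 1) / 2\<rfloor>" if "\<And>k. x + 1 \<noteq> 2 * of_int k" for x :: real
  proof -
    define l where "l = \<lfloor>(x + 1) / 2\<rfloor>"
    have "of_int l \<le> (x + 1) / 2" "(x + 1) / 2 < of_int l + 1" unfolding l_def by linarith+
    moreover have "x + 1 \<noteq> 2 * of_int l" by (rule that)
    ultimately have "\<lfloor>(1 - x) / 2\<rfloor> = - l" by (simp add: floor_eq_iff field_simps)
    thus ?thesis by (simp add: l_def)
  qed
  from this[of "P * of_int i"] P_odd show ?thesis by (simp add: E_def)
qed

section \<open>Crossings of a unit edge with the slanting lines\<close>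

text \<open>\<open>FP\<close> and \<open>FQ\<close> are \<open>P\<close> times the intercept of the
  line of slope \<open>-P\<close> or \<open>-Q\<close> through the point, plus 1. Hence lightness
  depends on the integral intercept \<open>j\<close> alone, not on the family of the line.\<close>

lemma light_h_iff:
  "light p q (FH p q) (x, of_int n) \<longleftrightarrow>
     (\<exists>j::int. (of_int n + P * x = of_int j \<or> of_int n + Q * x = of_int j) \<and> lit (2 * P * of_int n) (P * of_int j + 1))"
proof -
  have 1: "FP p q (x, of_int n) = red (P * (of_int n + P * x) + 1)"
    and 2: "FQ p q (x, of_int n) = red (P * (of_int n + Q * x) + 1)"
    by (simp_all add: FP_def FQ_def algebra_simps power2_eq_square)
  have "light p q (FH p q) (x, of_int n) \<longleftrightarrow>
      (of_int n + P * x \<in> \<int> \<and> lit (2 * P * of_int n) (P * (of_int n + P * x) + 1)) \<or>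
      (of_int n + Q * x \<in> \<int> \<and> lit (2 * P * of_int n) (P * (of_int n + Q * x) + 1))"
    unfolding light_def 1 2 by (simp add: onP_def onQ_def lit_def FH_def)
  thus ?thesis unfolding Ints_iff_of_int by auto
qed

lemma light_v_iff:
  "light p q (FV p q) (of_int m, y) \<longleftrightarrow>
     (\<exists>j::int. (y + P * of_int m = of_int j \<or> y + Q * of_int m = of_int j) \<and> lit (2 * P * of_int m) (P * of_int j + 1))"
proof -
  have 1: "FP p q (of_int m, y) = red (P * (y + P * of_int m) + 1)"
    and 2: "FQ p q (of_int m, y) = red (P * (y + Q * of_int m) + 1)"
    by (simp_all add: FP_def FQ_def algebra_simps power2_eq_square)
  have "light p q (FV p q) (of_int m, y) \<longleftrightarrow>
      (y + P * of_int m \<in> \<int> \<and> lit (2 * P * of_int m) (P * (y + P * of_int m) + 1)) \<or>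
      (y + Q * of_int m \<in> \<int> \<and> lit (2 * P * of_int m) (P * (y + Q * of_int m) + 1))"
    unfolding light_def 1 2 by (simp add: onP_def onQ_def lit_def FV_def)
  thus ?thesis unfolding Ints_iff_of_int by auto
qed

lemma vseg_iff: "(x, y) \<in> vseg m n \<longleftrightarrow> x = of_int m \<and> of_int n \<le> y \<and> y \<le> of_int n + 1"
proof
  assume "(x, y) \<in> vseg m n"
  then obtain u where "0 \<le> u" "u \<le> 1" "(x, y) = (1 - u) *\<^sub>R (of_int m, of_int n) + u *\<^sub>R (of_int m, of_int n + 1)"
    unfolding vseg_def closed_segment_def by blast
  thus "x = of_int m \<and> of_int n \<le> y \<and> y \<le> of_int n + 1" by (auto simp: algebra_simps)
next
  assume *: "x = of_int m \<and> of_int n \<le> y \<and> y \<le> of_int n + 1"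
  show "(x, y) \<in> vseg m n" unfolding vseg_def closed_segment_def
    by (rule CollectI, rule exI[of _ "y - of_int n"]) (use * in \<open>auto simp: algebra_simps\<close>)
qed

lemma hseg_iff: "(x, y) \<in> hseg m n \<longleftrightarrow> y = of_int n \<and> of_int m \<le> x \<and> x \<le> of_int m + 1"
proof
  assume "(x, y) \<in> hseg m n"
  then obtain u where "0 \<le> u" "u \<le> 1" "(x, y) = (1 - u) *\<^sub>R (of_int m, of_int n) + u *\<^sub>R (of_int m + 1, of_int n)"
    unfolding hseg_def closed_segment_def by blast
  thus "y = of_int n \<and> of_int m \<le> x \<and> x \<le> of_int m + 1" by (auto simp: algebra_simps)
next
  assume *: "y = of_int n \<and> of_int m \<le> x \<and> x \<le> of_int m + 1"
  show "(x, y) \<in> hseg m n" unfolding hseg_def closed_segment_def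
    by (rule CollectI, rule exI[of _ "x - of_int m"]) (use * in \<open>auto simp: algebra_simps\<close>)
qed

lemma card_two:
  assumes "x \<noteq> y"
  shows "card {z. z = x \<and> A \<or> z = y \<and> B} = 1 \<longleftrightarrow> A \<noteq> B"
proof -
  have "{z. z = x \<and> A \<or> z = y \<and> B} = (if A then {x} else {}) \<union> (if B then {y} else {})" by auto
  thus ?thesis using assms by auto
qed

lemma P_floor_W: "P * of_int (W * k) = of_int (2 * int p * k)"
  using P_W by (simp add: mult.assoc[symmetric])

lemma good_v_iff:
  assumes a: "a = \<lfloor>P * of_int m\<rfloor>"
  shows "good_v p q m n \<longleftrightarrow> odd (E (n + a + 1) + E (n + a + 1 - 2 * m) + (E (n + 2 * m - a) + E (n - a)))"
proof (cases "W dvd m")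
  case True
  \<comment> \<open>On such a line the capacity vanishes modulo 2, so nothing is light, and it
    remains to see that the sum on the right is even.\<close>
  then obtain k where k: "m = W * k" by auto
  have a2: "a = 2 * int p * k" using a unfolding k P_floor_W floor_of_int .
  have aa: "P * of_int m = of_int a" unfolding a2 k by (rule P_floor_W)
  have z: "2 * P * of_int m = 0 + 2 * of_int a" using aa(1) by simp
  have "red (2 * P * of_int m) = 0" unfolding z red_plus_even by simp
  hence "\<not> light p q (FV p q) z" if "z \<in> vseg m n" for z
    using that by (cases z) (auto simp: vseg_iff light_v_iff lit_def)
  hence z: "{z \<in> vseg m n. light p q (FV p q) z} = {}" by blast
  have "\<not> good_v p q m n" unfolding good_v_def light_count_v_def z by simp
  moreover have "E (n + a + 1 - 2 * m) = E (n + a + 1) - 2 * int p * k"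
    using E_shift[of "n + a + 1" "- 2 * k"] by (simp add: k algebra_simps)
  moreover have "E (n + 2 * m - a) = E (n - a) + 2 * int p * k"
    using E_shift[of "n - a" "2 * k"] by (simp add: k algebra_simps)
  ultimately show ?thesis by simp
next
  case False
  have Pm: "of_int a < P * of_int m" "P * of_int m < of_int a + 1"
    using False P_int_iff[of m] a by (metis Ints_of_int floor_correct order_le_less) (use a in linarith)
  define y1 y2 where "y1 = of_int (n + a + 1) - P * of_int m" and "y2 = of_int (n - a) + P * of_int m"
  let ?L = "\<lambda>j. lit (2 * P * of_int m) (P * of_int j + 1)"
  \<comment> \<open>The two points are symmetric about the midpoint of the edge. If they coincided
    there, \<open>2 * P * m\<close> would be an odd integer; so a vertical edge never has a double
    point.\<close>
  have ne: "y1 \<noteq> y2"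
  proof
    assume "y1 = y2"
    hence "P * of_int (2 * m) + 1 = 2 * of_int (a + 1)" by (simp add: y1_def y2_def algebra_simps)
    thus False using P_odd by blast
  qed
  have y1: "of_int n \<le> y1 \<and> y1 \<le> of_int n + 1 \<and> y1 + P * of_int m = of_int (n + a + 1)"
    unfolding y1_def using Pm by simp
  have y2: "of_int n \<le> y2 \<and> y2 \<le> of_int n + 1 \<and> y2 + Q * of_int m = of_int (n + 2 * m - a)"
    unfolding y2_def Q_P using Pm by (simp add: algebra_simps)
  have lv: "(of_int n \<le> y \<and> y \<le> of_int n + 1) \<and> light p q (FV p q) (of_int m, y) \<longleftrightarrow>
      (y = y1 \<and> ?L (n + a + 1)) \<or> (y = y2 \<and> ?L (n + 2 * m - a))" for y
  proof -
    have 1: "(of_int n \<le> y \<and> y \<le> of_int n + 1) \<and> y + P * of_int m = of_int j \<longleftrightarrow> j = n + a + 1 \<and> y = y1" for j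
    proof -
      have "j = n + a + 1 \<and> y = y1" if "of_int n \<le> y" "y \<le> of_int n + 1" "y + P * of_int m = of_int j"
      proof -
        have "real_of_int (n + a) < of_int j" "real_of_int j < of_int (n + a + 2)" using that Pm by simp_all
        hence "j = n + a + 1" by linarith
        thus ?thesis unfolding y1_def using that(3) by simp
      qed
      thus ?thesis using y1 by blast
    qed
    have 2: "(of_int n \<le> y \<and> y \<le> of_int n + 1) \<and> y + Q * of_int m = of_int j \<longleftrightarrow> j = n + 2 * m - a \<and> y = y2" for j
    proof -
      have "j = n + 2 * m - a \<and> y = y2" if "of_int n \<le> y" "y \<le> of_int n + 1" "y + Q * of_int m = of_int j"
      proof -
        have "real_of_int (n + 2 * m - a - 1) < of_int j" "real_of_int j < of_int (n + 2 * m - a + 1)" using that Pm by (simp_all add: Q_P algebra_simps)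
        hence "j = n + 2 * m - a" by linarith
        thus ?thesis unfolding y2_def using that(3) by (simp add: Q_P algebra_simps)
      qed
      thus ?thesis using y2 by blast
    qed
    show ?thesis unfolding light_v_iff by (rule two_witnesses[OF 1 2])
  qed
  have S: "{z \<in> vseg m n. light p q (FV p q) z} =
      {z. z = (of_int m, y1) \<and> ?L (n + a + 1) \<or> z = (of_int m, y2) \<and> ?L (n + 2 * m - a)}"
  proof (rule set_eqI)
    fix z :: "real \<times> real"
    obtain x y where z: "z = (x, y)" by (cases z)
    show "z \<in> {z \<in> vseg m n. light p q (FV p q) z} \<longleftrightarrow>
        z \<in> {z. z = (of_int m, y1) \<and> ?L (n + a + 1) \<or> z = (of_int m, y2) \<and> ?L (n + 2 * m - a)}"
      unfolding z mem_Collect_eq vseg_iff prod.inject using lv[of y] by blast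
  qed
  have "good_v p q m n \<longleftrightarrow> ?L (n + a + 1) \<noteq> ?L (n + 2 * m - a)"
    unfolding good_v_def light_count_v_def S by (rule card_two) (use ne in simp)
  also have "\<dots> \<longleftrightarrow> odd (E (n + a + 1) + E (n + a + 1 - 2 * m) + (E (n + 2 * m - a) + E (n - a)))"
    unfolding lit_neq_iff by (simp add: algebra_simps)
  finally show ?thesis .
qed

text \<open>If the two lines meet on row \<open>n\<close> above \<open>x\<close>, then
  \<open>2 * x\<close> and \<open>P * (2 * x)\<close> are integers, whence
  \<open>2 * x = W * k\<close>, \<open>i = n + p * k\<close> and
  \<open>j = n - p * k + W * k\<close>. Thus \<open>j\<close> is \<open>- (i - 2 * n)\<close> and
  \<open>j - 2 * n\<close> is \<open>- i\<close>, both up to \<open>W * k\<close>, and the two sums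
  of \<open>E\<close> in \<open>lit_E\<close> agree modulo 2.\<close>

lemma light_h_sym:
  assumes "of_int n + P * x = of_int i" "of_int n + Q * x = of_int j"
  shows "lit (2 * P * of_int n) (P * of_int i + 1) \<longleftrightarrow> lit (2 * P * of_int n) (P * of_int j + 1)"
proof -
  have "2 * x = of_int (i + j - 2 * n)" using assms by (simp add: Q_P algebra_simps)
  then obtain c where c: "2 * x = of_int c" by blast
  have "P * x = of_int (i - n)" using assms(1) by simp
  hence "P * (2 * x) = of_int (2 * (i - n))" by simp
  hence Pc: "P * of_int c = of_int (2 * (i - n))" unfolding c .
  have "W dvd c" using Pc by (metis Ints_of_int P_int_iff)
  then obtain k where k: "c = W * k" by auto
  have "2 * (i - n) = 2 * int p * k"
    using Pc unfolding k P_floor_W by (simp only: of_int_eq_iff)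
  hence i: "i = n + int p * k" by simp
  have j: "j = n - int p * k + W * k"
  proof -
    have "of_int n + (of_int c - P * x) = real_of_int j" using assms(2) c by (simp add: Q_P algebra_simps)
    hence "real_of_int (n + c - (i - n)) = of_int j" using assms(1) by simp
    hence "n + c - (i - n) = j" by (simp only: of_int_eq_iff)
    thus ?thesis using i k by simp
  qed
  have "E (j - 2 * n) = - E i + int p * k"
    using E_shift[of "- i" k] E_minus[of i] unfolding i j by (simp add: algebra_simps)
  moreover have "E j = - E (i - 2 * n) + int p * k"
    using E_shift[of "- (i - 2 * n)" k] E_minus[of "i - 2 * n"] unfolding i j by (simp add: algebra_simps)
  ultimately show ?thesis unfolding lit_E by simp
qed

text \<open>Along the edge the intercept of the \<open>P\<close>-line grows by \<open>P < 1\<close>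
  and that of the \<open>Q\<close>-line by \<open>2 - P\<close>, and the two add up to
  \<open>2 * n + 2 * x\<close>. If \<open>P * x\<close> passes an integer before the right end, the
  edge meets one line of each family, otherwise two \<open>Q\<close>-lines.\<close>

lemma horizontal_points:
  fixes x :: real
  assumes a: "a = \<lfloor>P * of_int m\<rfloor>"
    and b: "b = (if P * of_int (m + 1) \<le> of_int (a + 1) then 2 * m - a + 1 else a + 1)"
    and x1: "Q * x1 = of_int (2 * m - a)"
    and x2: "(if P * of_int (m + 1) \<le> of_int (a + 1) then Q else P) * x2 = of_int b"
  shows "(of_int m \<le> x \<and> x \<le> of_int m + 1) \<and> light p q (FH p q) (x, of_int n) \<longleftrightarrow>
      x = x1 \<and> lit (2 * P * of_int n) (P * of_int (n + (2 * m - a)) + 1) \<or>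
      x = x2 \<and> lit (2 * P * of_int n) (P * of_int (n + b) + 1)"
proof -
  have Pm: "of_int a \<le> P * of_int m" "P * of_int m < of_int a + 1" using a by linarith+
  have m1: "P * of_int (m + 1) = P * of_int m + P" by (simp add: algebra_simps)
  have P01: "0 < P" "P < 1" using P_bounds by auto
  have Qm: "Q * of_int m = 2 * of_int m - P * of_int m" by (simp add: Q_P algebra_simps)
  have Q0: "0 < Q" using P01 by (simp add: Q_P)
  have Qx: "Q * y = 2 * y - P * y" for y by (simp add: Q_P algebra_simps)
  have Q_le: "Q * y \<le> Q * z \<longleftrightarrow> y \<le> z" and P_le: "P * y \<le> P * z \<longleftrightarrow> y \<le> z" for y z
    using Q0 P01 by simp_all
  have Q_inj: "Q * y = Q * z \<longleftrightarrow> y = z" and P_inj: "P * y = P * z \<longleftrightarrow> y = z" for y z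
    using Q0 P01 by simp_all
  have Qm1: "Q * (of_int m + 1) = 2 * of_int m + 2 - P * of_int m - P" by (simp add: Q_P algebra_simps)
  have Pm1: "P * (of_int m + 1) = P * of_int m + P" by (simp add: algebra_simps)
  let ?L = "\<lambda>j. lit (2 * P * of_int n) (P * of_int j + 1)"
  have range: "Q * of_int m \<le> Q * x" "Q * x \<le> Q * (of_int m + 1)" "P * of_int m \<le> P * x" "P * x \<le> P * (of_int m + 1)"
    if "of_int m \<le> x" "x \<le> of_int m + 1"
    unfolding Q_le P_le using that by auto
  show ?thesis
  proof (cases "P * of_int (m + 1) \<le> of_int (a + 1)")
    case True
    hence le: "P * of_int m + P \<le> of_int a + 1" and b: "b = 2 * m - a + 1" and x2: "Q * x2 = of_int (2 * m - a + 1)"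
      using True b x2 unfolding m1 by simp_all
    have seg1: "of_int m \<le> x1" "x1 \<le> of_int m + 1"
    proof -
      show "of_int m \<le> x1" by (rule Q_le[THEN iffD1]) (unfold x1 Qm, use Pm in simp)
      show "x1 \<le> of_int m + 1" by (rule Q_le[THEN iffD1]) (unfold x1 Qm1, use Pm P01 le in simp)
    qed
    have seg2: "of_int m \<le> x2" "x2 \<le> of_int m + 1"
    proof -
      show "of_int m \<le> x2" by (rule Q_le[THEN iffD1]) (unfold x2 Qm, use Pm in simp)
      show "x2 \<le> of_int m + 1" by (rule Q_le[THEN iffD1]) (unfold x2 Qm1, use Pm P01 le in simp)
    qed
    show ?thesis
    proof
      assume *: "(of_int m \<le> x \<and> x \<le> of_int m + 1) \<and> light p q (FH p q) (x, of_int n)"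
      then obtain j where j: "of_int n + P * x = of_int j \<or> of_int n + Q * x = of_int j" and L: "?L j"
        unfolding light_h_iff by blast
      \<comment> \<open>In this branch a \<open>P\<close>-line can touch the edge only at an end
        point. There \<open>Q * x = 2 * x - P * x\<close> is integral too, and
        \<open>light_h_sym\<close> replaces the \<open>P\<close>-line by the \<open>Q\<close>-line
        through the same point.\<close>
      have "\<exists>i. of_int n + Q * x = of_int i \<and> ?L i"
      proof (cases "of_int n + Q * x = of_int j")
        case False
        hence Pj: "of_int n + P * x = of_int j" using j by blast
        have "real_of_int (n + a) \<le> of_int j" "real_of_int j \<le> of_int (n + a + 1)"
          using range[OF *[THEN conjunct1, THEN conjunct1] *[THEN conjunct1, THEN conjunct2]] *[THEN conjunct2] Pm le Pj Pm1 by linarith+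
        hence "j = n + a \<or> j = n + a + 1" by linarith
        moreover have "x = of_int m" if "j = n + a"
        proof -
          have "P * x \<le> P * of_int m" using that Pj Pm by simp
          thus ?thesis unfolding P_le using * by simp
        qed
        moreover have "x = of_int (m + 1)" if "j = n + a + 1"
        proof -
          have "P * (of_int m + 1) \<le> P * x" using that Pj le Pm1 by simp
          thus ?thesis unfolding P_le using * by simp
        qed
        ultimately obtain k where "x = of_int k" by blast
        hence "of_int n + Q * x = of_int (2 * n + 2 * k - j)" using Pj Qx[of x] by simp
        moreover from this have "?L (2 * n + 2 * k - j)" using light_h_sym[OF Pj] L by blast
        ultimately show ?thesis by blast
      qed (use L in blast)
      then obtain i where i: "of_int n + Q * x = of_int i" and L: "?L i" by blast
      have "real_of_int (n + 2 * m - a - 1) < of_int i" "real_of_int i < of_int (n + 2 * m - a + 2)"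
        using range[OF *[THEN conjunct1, THEN conjunct1] *[THEN conjunct1, THEN conjunct2]] *[THEN conjunct2] Pm P01 i Qm Qm1 by linarith+
      hence "i = n + (2 * m - a) \<or> i = n + (2 * m - a + 1)" by linarith
      thus "x = x1 \<and> ?L (n + (2 * m - a)) \<or> x = x2 \<and> ?L (n + b)"
      proof
        assume ii: "i = n + (2 * m - a)"
        hence "Q * x = Q * x1" using i x1 by simp
        thus ?thesis unfolding Q_inj using L ii by simp
      next
        assume ii: "i = n + (2 * m - a + 1)"
        hence "Q * x = Q * x2" using i x2 by simp
        thus ?thesis unfolding Q_inj using L ii b by simp
      qed
    next
      assume "x = x1 \<and> ?L (n + (2 * m - a)) \<or> x = x2 \<and> ?L (n + b)"
      thus "(of_int m \<le> x \<and> x \<le> of_int m + 1) \<and> light p q (FH p q) (x, of_int n)"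
      proof
        assume *: "x = x1 \<and> ?L (n + (2 * m - a))"
        moreover have "of_int n + Q * x1 = of_int (n + (2 * m - a))" unfolding x1 by simp
        ultimately show ?thesis using seg1 unfolding light_h_iff by blast
      next
        assume *: "x = x2 \<and> ?L (n + b)"
        moreover have "of_int n + Q * x2 = of_int (n + b)" unfolding x2 b by simp
        ultimately show ?thesis using seg2 unfolding light_h_iff by blast
      qed
    qed
  next
    case False
    hence gt: "of_int a + 1 < P * of_int m + P" and b: "b = a + 1" and x2: "P * x2 = of_int (a + 1)"
      using False b x2 unfolding m1 by simp_all
    have 1: "(of_int m \<le> x \<and> x \<le> of_int m + 1) \<and> of_int n + P * x = of_int j \<longleftrightarrow> j = n + b \<and> x = x2" for j
    proof
      assume *: "(of_int m \<le> x \<and> x \<le> of_int m + 1) \<and> of_int n + P * x = of_int j"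
      have "real_of_int (n + a) < of_int j" "real_of_int j < of_int (n + a + 2)"
        using range[OF *[THEN conjunct1, THEN conjunct1] *[THEN conjunct1, THEN conjunct2]] *[THEN conjunct2] Pm gt P01 Pm1 by linarith+
      hence j: "j = n + b" unfolding b by linarith
      hence "P * x = P * x2" using * x2 b by simp
      thus "j = n + b \<and> x = x2" unfolding P_inj using j by simp
    next
      assume *: "j = n + b \<and> x = x2"
      have "of_int m \<le> x2" by (rule P_le[THEN iffD1]) (unfold x2, use Pm in simp)
      moreover have "x2 \<le> of_int m + 1" by (rule P_le[THEN iffD1]) (unfold x2 Pm1, use gt in simp)
      ultimately show "(of_int m \<le> x \<and> x \<le> of_int m + 1) \<and> of_int n + P * x = of_int j"
        using * x2 b by simp
    qed
    have 2: "(of_int m \<le> x \<and> x \<le> of_int m + 1) \<and> of_int n + Q * x = of_int j \<longleftrightarrow> j = n + (2 * m - a) \<and> x = x1" for j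
    proof
      assume *: "(of_int m \<le> x \<and> x \<le> of_int m + 1) \<and> of_int n + Q * x = of_int j"
      have "real_of_int (n + 2 * m - a - 1) < of_int j" "real_of_int j < of_int (n + 2 * m - a + 1)"
        using range[OF *[THEN conjunct1, THEN conjunct1] *[THEN conjunct1, THEN conjunct2]] *[THEN conjunct2] Pm gt P01 Qm1 Qm by linarith+
      hence j: "j = n + (2 * m - a)" by linarith
      hence "Q * x = Q * x1" using * x1 by simp
      thus "j = n + (2 * m - a) \<and> x = x1" unfolding Q_inj using j by simp
    next
      assume *: "j = n + (2 * m - a) \<and> x = x1"
      have "of_int m \<le> x1" by (rule Q_le[THEN iffD1]) (unfold x1 Qm, use Pm in simp)
      moreover have "x1 \<le> of_int m + 1" by (rule Q_le[THEN iffD1]) (unfold x1 Qm1, use Pm P01 in simp)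
      ultimately show "(of_int m \<le> x \<and> x \<le> of_int m + 1) \<and> of_int n + Q * x = of_int j"
        using * x1 by simp
    qed
    show ?thesis unfolding light_h_iff by (rule trans[OF two_witnesses[OF 1 2] disj_commute])
  qed
qed

lemma good_h_iff:
  assumes a: "a = \<lfloor>P * of_int m\<rfloor>"
    and b: "b = (if P * of_int (m + 1) \<le> of_int (a + 1) then 2 * m - a + 1 else a + 1)"
  shows "good_h p q m n \<longleftrightarrow> odd (E (n + (2 * m - a)) + E (2 * m - a - n) + (E (n + b) + E (b - n)))"
proof -
  have Pm: "of_int a \<le> P * of_int m" using a by linarith
  have P01: "0 < P" "P < 1" using P_bounds by auto
  have Qx: "Q * y = 2 * y - P * y" for y by (simp add: Q_P algebra_simps)
  let ?L = "\<lambda>j. lit (2 * P * of_int n) (P * of_int j + 1)"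
  let ?A = "if P * of_int (m + 1) \<le> of_int (a + 1) then Q else P"
  define x1 where "x1 = real_of_int (2 * m - a) / Q"
  define x2 where "x2 = of_int b / ?A"
  have x1: "Q * x1 = of_int (2 * m - a)" and x2: "?A * x2 = of_int b"
    using P01 by (simp_all add: x1_def x2_def Q_P)
  note lh = horizontal_points[OF a b x1 x2, of _ n]
  have S: "{z \<in> hseg m n. light p q (FH p q) z} =
      {z. z = (x1, of_int n) \<and> ?L (n + (2 * m - a)) \<or> z = (x2, of_int n) \<and> ?L (n + b)}"
  proof (rule set_eqI)
    fix z :: "real \<times> real"
    obtain x y where z: "z = (x, y)" by (cases z)
    show "z \<in> {z \<in> hseg m n. light p q (FH p q) z} \<longleftrightarrow>
        z \<in> {z. z = (x1, of_int n) \<and> ?L (n + (2 * m - a)) \<or> z = (x2, of_int n) \<and> ?L (n + b)}"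
      unfolding z mem_Collect_eq hseg_iff prod.inject using lh[of x] by blast
  qed
  have mid: "light p q (FH p q) (hmid m n) \<longleftrightarrow>
      of_int m + 1 / 2 = x1 \<and> ?L (n + (2 * m - a)) \<or> of_int m + 1 / 2 = x2 \<and> ?L (n + b)"
    using lh[of "of_int m + 1 / 2"] by (simp add: hmid_def)
  have Pmid: "P * (of_int m + 1 / 2) = P * of_int m + P / 2"
    "Q * (of_int m + 1 / 2) = 2 * of_int m + 1 - P * of_int m - P / 2"
    by (simp_all add: Q_P algebra_simps)
  have m1: "P * of_int (m + 1) = P * of_int m + P" by (simp add: algebra_simps)
  \<comment> \<open>At the midpoint \<open>P * x + Q * x\<close> is the integer
    \<open>2 * m + 1\<close>, so a \<open>P\<close>-line passes through it iff a
    \<open>Q\<close>-line does. In the branch with two \<open>Q\<close>-lines both statements are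
    vacuous: neither line meets the midpoint, and the two points differ.\<close>
  have iff: "of_int m + 1 / 2 = x1 \<longleftrightarrow> x1 = x2" "of_int m + 1 / 2 = x2 \<longleftrightarrow> x1 = x2"
  proof -
    have Q0: "0 < Q" using P01 by (simp add: Q_P)
    have inj: "y = z \<longleftrightarrow> Q * y = Q * z" "y = z \<longleftrightarrow> P * y = P * z" for y z
      using Q0 P01 by simp_all
    have "(of_int m + 1 / 2 = x1 \<longleftrightarrow> x1 = x2) \<and> (of_int m + 1 / 2 = x2 \<longleftrightarrow> x1 = x2)"
    proof (cases "P * of_int (m + 1) \<le> of_int (a + 1)")
      case True
      hence x2': "Q * x2 = of_int (2 * m - a + 1)" and le: "P * of_int m + P \<le> of_int a + 1"
        using True x2 b unfolding m1 by simp_all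
      show ?thesis
        unfolding inj(1)[of "of_int m + 1 / 2" x1] inj(1)[of "of_int m + 1 / 2" x2] inj(1)[of x1 x2] x1 x2' Pmid
        using le Pm P01 by auto
    next
      case False
      hence x2': "P * x2 = of_int (a + 1)" using x2 b by (simp del: of_int_add)
      have 1: "of_int m + 1 / 2 = x1 \<longleftrightarrow> P * of_int m + P / 2 = of_int (a + 1)"
        unfolding inj(1)[of "of_int m + 1 / 2" x1] x1 Pmid by auto
      have 2: "of_int m + 1 / 2 = x2 \<longleftrightarrow> P * of_int m + P / 2 = of_int (a + 1)"
        unfolding inj(2)[of "of_int m + 1 / 2" x2] x2' Pmid by auto
      have "x1 = x2 \<Longrightarrow> of_int m + 1 / 2 = x1"
        using x1 x2' Qx[of x1] by simp
      thus ?thesis using 1 2 by blast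
    qed
    thus "of_int m + 1 / 2 = x1 \<longleftrightarrow> x1 = x2" "of_int m + 1 / 2 = x2 \<longleftrightarrow> x1 = x2" by blast+
  qed
  have "good_h p q m n \<longleftrightarrow> ?L (n + (2 * m - a)) \<noteq> ?L (n + b)"
  proof (cases "x1 = x2")
    case True
    have "\<not> P * of_int (m + 1) \<le> of_int (a + 1)"
      using x1 x2 b True by (auto split: if_splits)
    hence "of_int n + P * x2 = of_int (n + b)" "of_int n + Q * x2 = of_int (n + (2 * m - a))"
      using x1 x2 True by simp_all
    \<comment> \<open>Both lines are light or neither is, so the double count yields
      \<open>2\<close> or \<open>0\<close>: the edge is not good, in accordance with the exclusive
      disjunction.\<close>
    hence L: "?L (n + (2 * m - a)) = ?L (n + b)" using light_h_sym by blast
    have "{z. z = (x1, real_of_int n) \<and> ?L (n + b) \<or> z = (x2, real_of_int n) \<and> ?L (n + b)} =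
        (if ?L (n + b) then {(x1, real_of_int n)} else {})"
      using True by auto
    thus ?thesis unfolding good_h_def light_count_h_def S mid L iff using True by simp
  next
    case False
    hence "\<not> light p q (FH p q) (hmid m n)" unfolding mid iff by simp
    hence "good_h p q m n \<longleftrightarrow> card {z \<in> hseg m n. light p q (FH p q) z} = 1"
      unfolding good_h_def light_count_h_def by simp
    also have "\<dots> \<longleftrightarrow> ?L (n + (2 * m - a)) \<noteq> ?L (n + b)"
      unfolding S by (rule card_two) (use False in simp)
    finally show ?thesis .
  qed
  also have "\<dots> \<longleftrightarrow> odd (E (n + (2 * m - a)) + E (2 * m - a - n) + (E (n + b) + E (b - n)))"
    unfolding lit_neq_iff by (simp add: algebra_simps)
  finally show ?thesis .
qed

end

section \<open>Even degrees and the capacity two line\<close>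

definition par :: "(nat \<Rightarrow> bool) \<Rightarrow> nat \<Rightarrow> bool" where
  "par A L \<longleftrightarrow> odd (\<Sum>m<L. of_bool (A m) :: nat)"

lemma par_0 [simp]: "\<not> par A 0" and par_Suc [simp]: "par A (Suc L) \<longleftrightarrow> par A L \<noteq> A L"
  by (simp_all add: par_def)

lemma par_cong: "(\<And>m. m < L \<Longrightarrow> A m = B m) \<Longrightarrow> par A L = par B L"
  by (induction L) simp_all

lemma par_xor: "par (\<lambda>m. A m \<noteq> B m) L \<longleftrightarrow> par A L \<noteq> par B L"
  by (induction L) auto

lemma par_telescope:
  fixes G :: "nat \<Rightarrow> bool"
  shows "par (\<lambda>m. G m \<noteq> G (Suc m)) L \<longleftrightarrow> G 0 \<noteq> G L"
proof (induction L)
  case (Suc L)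
  thus ?case unfolding par_Suc by auto
qed simp

text \<open>\<open>V\<close> and \<open>H\<close> stand for the good vertical and horizontal edges, \<open>X\<close> for the squares whose center lies
  on a given polygon. Row by row, the crossings of vertical edges telescope modulo 2.\<close>

lemma even_crossings:
  fixes V H X :: "nat \<Rightarrow> nat \<Rightarrow> bool"
  assumes sq: "\<And>m k. (V m k \<noteq> V (Suc m) k) = (H m k \<noteq> H m (Suc k))"
    and V0: "\<And>k. \<not> V 0 k" and VL: "\<And>k. \<not> V L k" and HK: "\<And>m. \<not> H m K"
    and XV: "\<And>m k. V (Suc m) k \<Longrightarrow> X m k = X (Suc m) k"
    and XH: "\<And>m k. H m (Suc k) \<Longrightarrow> X m k = X m (Suc k)"
  shows "\<not> par (\<lambda>m. H m 0 \<and> X m 0) L"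
proof -
  have step: "par (\<lambda>m. H m k \<and> X m k) L = par (\<lambda>m. H m (Suc k) \<and> X m (Suc k)) L" for k
  proof -
    have "((H m k \<and> X m k) \<noteq> (H m (Suc k) \<and> X m (Suc k))) =
        ((V m k \<and> X m k) \<noteq> (V (Suc m) k \<and> X (Suc m) k))" for m
      using sq[of m k] XV[of m k] XH[of m k] by blast
    hence "par (\<lambda>m. (H m k \<and> X m k) \<noteq> (H m (Suc k) \<and> X m (Suc k))) L =
        par (\<lambda>m. (V m k \<and> X m k) \<noteq> (V (Suc m) k \<and> X (Suc m) k)) L"
      by simp
    also have "\<dots> = False"
      using par_telescope[of "\<lambda>m. V m k \<and> X m k" L] V0 VL by simp
    finally show ?thesis unfolding par_xor by simp
  qed
  have "par (\<lambda>m. H m 0 \<and> X m 0) L = par (\<lambda>m. H m k \<and> X m k) L" for k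
    by (induction k) (use step in auto)
  also have "par (\<lambda>m. H m K \<and> X m K) L = par (\<lambda>_. False) L"
    by (rule par_cong) (use HK in simp)
  finally show ?thesis by (simp add: par_def)
qed

lemma not_par_other:
  assumes "\<not> par A L" "0 < L" "A 0"
  obtains m where "0 < m" "m < L" "A m"
proof -
  have "\<exists>m. 0 < m \<and> m < L \<and> A m"
  proof (rule ccontr)
    assume *: "\<not> ?thesis"
    have "par A L = par (\<lambda>m. m = 0) L"
      by (rule par_cong) (use * \<open>A 0\<close> in auto)
    moreover have "par (\<lambda>m. m = 0) L"
      using \<open>0 < L\<close> by (simp add: par_def of_bool_def sum.delta)
    ultimately show False using assms(1) by simp
  qed
  thus thesis using that by blast
qed

context plaid
begin

text \<open>For \<open>m = W * k\<close> the terms pair off up to \<open>2 * p * k\<close>. Evenness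
  holds for every \<open>a\<close>, which pays off at columns where \<open>P * m\<close> is an
  integer and either adjacent value of the floor may be wanted.\<close>

lemma good_v_multiple: "W dvd m \<Longrightarrow> \<not> good_v p q m n"
  and E_multiple: "W dvd m \<Longrightarrow> even (E (n + a + 1) + E (n + a + 1 - 2 * m) + (E (n + 2 * m - a) + E (n - a)))"
proof -
  have *: "even (E (n + a + 1) + E (n + a + 1 - 2 * m) + (E (n + 2 * m - a) + E (n - a)))" if "W dvd m" for a m
  proof -
    from that obtain k where k: "m = W * k" by auto
    have "E (n + a + 1 - 2 * m) = E (n + a + 1) - 2 * int p * k"
      using E_shift[of "n + a + 1" "- 2 * k"] by (simp add: k algebra_simps)
    moreover have "E (n + 2 * m - a) = E (n - a) + 2 * int p * k"
      using E_shift[of "n - a" "2 * k"] by (simp add: k algebra_simps)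
    ultimately show ?thesis by simp
  qed
  thus "W dvd m \<Longrightarrow> even (E (n + a + 1) + E (n + a + 1 - 2 * m) + (E (n + 2 * m - a) + E (n - a)))" .
  show "W dvd m \<Longrightarrow> \<not> good_v p q m n" using * good_v_iff[OF refl] by blast
qed

lemma good_h_iff':
  assumes a: "a = \<lfloor>P * of_int m\<rfloor>"
    and b: "b = (if P * of_int (m + 1) \<le> of_int (a + 1) then 2 * m - a + 1 else a + 1)"
  shows "good_h p q m n \<longleftrightarrow> odd (E (n + (2 * m - a)) + E (n - (2 * m - a)) + (E (n + b) + E (n - b)))"
  unfolding good_h_iff[OF a b] using E_minus[of "n - (2 * m - a)"] E_minus[of "n - b"] by auto

text \<open>If the floor of \<open>P * m\<close> rises from column \<open>m\<close> to
  \<open>m + 1\<close>, the eight \<open>E\<close>-terms of the vertical sides are, up to sign, the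
  eight terms of the horizontal ones. If it does not rise, two terms cancel on either side and the
  remaining ones agree.\<close>

lemma good_square: "(good_v p q m n \<noteq> good_v p q (m + 1) n) = (good_h p q m n \<noteq> good_h p q m (n + 1))"
proof -
  define a where "a = \<lfloor>P * of_int m\<rfloor>"
  have Pm: "of_int a \<le> P * of_int m" "P * of_int m < of_int a + 1" unfolding a_def by linarith+
  have m1: "P * of_int (m + 1) = P * of_int m + P" by (simp add: algebra_simps)
  show ?thesis
  proof (cases "P * of_int (m + 1) \<le> of_int (a + 1)")
    case True
    have "good_v p q (m + 1) n \<longleftrightarrow>
        odd (E (n + a + 1) + E (n + a + 1 - 2 * (m + 1)) + (E (n + 2 * (m + 1) - a) + E (n - a)))"
    proof (cases "P * of_int (m + 1) = of_int (a + 1)")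
      case True
      \<comment> \<open>The true floor in this column is \<open>a + 1\<close>, but the formula with
        \<open>a\<close> is even as well, and so describes the edge, which is not good.\<close>
      hence "W dvd m + 1" by (metis Ints_of_int P_int_iff)
      thus ?thesis using good_v_multiple E_multiple by blast
    next
      case False
      hence "\<lfloor>P * of_int (m + 1)\<rfloor> = a"
        using \<open>P * of_int (m + 1) \<le> of_int (a + 1)\<close> Pm P_bounds unfolding m1 floor_eq_iff by simp
      from good_v_iff[OF this[symmetric]] show ?thesis .
    qed
    moreover note good_v_iff[OF a_def, of n]
    moreover have "2 * m - a + 1 = (if P * of_int (m + 1) \<le> of_int (a + 1) then 2 * m - a + 1 else a + 1)"
      using True by simp
    note good_h_iff'[OF a_def this]
    ultimately show ?thesis by (simp add: algebra_simps) blast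
  next
    case False
    hence "\<lfloor>P * of_int (m + 1)\<rfloor> = a + 1" using Pm P_bounds unfolding m1 floor_eq_iff by simp
    note good_v_iff[OF this[symmetric], of n]
    moreover note good_v_iff[OF a_def, of n]
    moreover have "a + 1 = (if P * of_int (m + 1) \<le> of_int (a + 1) then 2 * m - a + 1 else a + 1)"
      using False by simp
    note good_h_iff'[OF a_def this]
    ultimately show ?thesis by (simp add: algebra_simps) blast
  qed
qed

text \<open>A row with \<open>n = W * k\<close> has capacity 0; in the formula,
  \<open>E (n + i) + E (n - i)\<close> equals \<open>2 * p * k\<close>.\<close>

lemma good_h_multiple:
  assumes "W dvd n"
  shows "\<not> good_h p q m n"
proof -
  from assms obtain k where k: "n = W * k" by auto
  have "even (E (n + i) + E (n - i))" for i
  proof -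
    have "E (n + i) = E i + int p * k" using E_shift[of i k] by (simp add: k add.commute)
    moreover have "E (n - i) = - E i + int p * k" using E_shift[of "- i" k] E_minus[of i] by (simp add: k)
    ultimately show ?thesis by simp
  qed
  thus ?thesis unfolding good_h_iff'[OF refl refl] by (meson dvd_add)
qed

section \<open>Translations that carry blocks to blocks\<close>

lemma floor_P_shift: "\<lfloor>P * of_int (m + W * k)\<rfloor> = \<lfloor>P * of_int m\<rfloor> + 2 * int p * k"
proof -
  have "P * of_int (m + W * k) = P * of_int m + of_int (2 * int p * k)"
    unfolding P_floor_W[symmetric] by (simp add: distrib_left)
  thus ?thesis by (simp only: floor_add_int)
qed

lemma E_shift_pair: "even (E (i + W * k) + E (j + W * l)) \<longleftrightarrow> even (E i + E j)" if "even (k + l)"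
proof -
  have "E (i + W * k) + E (j + W * l) = E i + E j + int p * (k + l)"
    unfolding E_shift by (simp add: distrib_left)
  thus ?thesis using that by simp
qed

text \<open>The factor \<open>W * W\<close> moves \<open>a\<close> by
  \<open>2 * p * (W * A)\<close>, a multiple of \<open>W\<close>. So all four indices move by
  multiples of \<open>W\<close>, and the four corrections to \<open>E\<close> have an even
  sum.\<close>

lemma good_v_shift: "good_v p q (m + W * (W * A)) (n + W * B) = good_v p q m n"
proof -
  define a where "a = \<lfloor>P * of_int m\<rfloor>"
  define a' where "a' = a + 2 * int p * (W * A)"
  have a': "a' = \<lfloor>P * of_int (m + W * (W * A))\<rfloor>" unfolding floor_P_shift a'_def a_def ..
  define k where "k = 2 * int p * A"
  define l where "l = 2 * W * A"
  have "E (n + W * B + a' + 1) = E (n + a + 1) + int p * (B + k)"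
    using E_shift[of "n + a + 1" "B + k"] by (simp add: a'_def k_def algebra_simps)
  moreover have "E (n + W * B + a' + 1 - 2 * (m + W * (W * A))) = E (n + a + 1 - 2 * m) + int p * (B + k - l)"
    using E_shift[of "n + a + 1 - 2 * m" "B + k - l"] by (simp add: a'_def k_def l_def algebra_simps)
  moreover have "E (n + W * B + 2 * (m + W * (W * A)) - a') = E (n + 2 * m - a) + int p * (B + l - k)"
    using E_shift[of "n + 2 * m - a" "B + l - k"] by (simp add: a'_def k_def l_def algebra_simps)
  moreover have "E (n + W * B - a') = E (n - a) + int p * (B - k)"
    using E_shift[of "n - a" "B - k"] by (simp add: a'_def k_def algebra_simps)
  ultimately have "E (n + W * B + a' + 1) + E (n + W * B + a' + 1 - 2 * (m + W * (W * A)))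
      + (E (n + W * B + 2 * (m + W * (W * A)) - a') + E (n + W * B - a'))
    = E (n + a + 1) + E (n + a + 1 - 2 * m) + (E (n + 2 * m - a) + E (n - a)) + 2 * (2 * int p * B)"
    by (simp only: distrib_left right_diff_distrib)
  thus ?thesis unfolding good_v_iff[OF a'] good_v_iff[OF a_def] by simp
qed

lemma good_h_shift: "good_h p q (m + W * (W * A)) (n + W * B) = good_h p q m n"
proof -
  define a where "a = \<lfloor>P * of_int m\<rfloor>"
  define a' where "a' = a + 2 * int p * (W * A)"
  have a': "a' = \<lfloor>P * of_int (m + W * (W * A))\<rfloor>" unfolding floor_P_shift a'_def a_def ..
  define b where "b = (if P * of_int (m + 1) \<le> of_int (a + 1) then 2 * m - a + 1 else a + 1)"
  define b' where "b' = (if P * of_int (m + W * (W * A) + 1) \<le> of_int (a' + 1) then 2 * (m + W * (W * A)) - a' + 1 else a' + 1)"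
  have "P * of_int (m + W * (W * A) + 1) = P * of_int (m + 1) + of_int (a' - a)"
    using P_floor_W[of "W * A"] by (simp add: a'_def algebra_simps)
  hence cond: "P * of_int (m + W * (W * A) + 1) \<le> of_int (a' + 1) \<longleftrightarrow> P * of_int (m + 1) \<le> of_int (a + 1)"
    by (simp add: diff_le_eq add.commute)
  have *: "odd (E (n + W * B + (i + W * k)) + E (n + W * B - (i + W * k))) \<longleftrightarrow> odd (E (n + i) + E (n - i))" for i k
    using E_shift_pair[of "B + k" "B - k" "n + i" "n - i"] by (simp add: algebra_simps)
  have 1: "2 * (m + W * (W * A)) - a' = 2 * m - a + W * (2 * W * A - 2 * int p * A)"
    by (simp add: a'_def algebra_simps)
  have 2: "\<exists>k. b' = b + W * k"
  proof (cases "P * of_int (m + 1) \<le> of_int (a + 1)")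
    case True
    hence "b' = b + W * (2 * W * A - 2 * int p * A)" unfolding b'_def b_def cond using 1 by simp
    thus ?thesis by blast
  next
    case False
    hence "b' = b + W * (2 * int p * A)" unfolding b'_def b_def cond by (simp add: a'_def algebra_simps)
    thus ?thesis by blast
  qed
  then obtain k where k: "b' = b + W * k" by blast
  have "good_h p q (m + W * (W * A)) (n + W * B) \<longleftrightarrow>
    odd (E (n + W * B + (2 * (m + W * (W * A)) - a')) + E (n + W * B - (2 * (m + W * (W * A)) - a')))
     \<noteq> odd (E (n + W * B + b') + E (n + W * B - b'))"
    unfolding good_h_iff'[OF a' b'_def] by (simp only: odd_add)
  also have "\<dots> \<longleftrightarrow> odd (E (n + (2 * m - a)) + E (n - (2 * m - a))) \<noteq> odd (E (n + b) + E (n - b))"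
    unfolding 1 k * ..
  also have "\<dots> \<longleftrightarrow> good_h p q m n"
    unfolding good_h_iff'[OF a_def b_def] by (simp only: odd_add)
  finally show ?thesis .
qed

text \<open>\<open>P * n\<close> exceeds the odd integer \<open>t\<close> by \<open>1 / W\<close>,
  so the capacity \<open>2 * P * n\<close> is \<open>2 / W\<close> modulo 2, the smallest nonzero
  one. With \<open>r\<close> the residue of \<open>p * i\<close>, the two roundings concern
  \<open>r + 1/2\<close> and \<open>r - 1/2\<close> in units of \<open>1 / W\<close>; they fall on
  different sides of an integer only for \<open>r = 0\<close>.\<close>

lemma capacity_two_parity:
  assumes n: "2 * int p * n = 1 + t * W"
  shows "odd (E (n + i) + E (n - i)) \<longleftrightarrow> \<not> W dvd i"
proof -
  have "odd t" using n odd_W by (metis dvd_triv_left even_mult_iff mult.assoc odd_add odd_one even_add)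
  then obtain s where s: "t = 2 * s + 1" by (auto elim: oddE)
  define c where "c = int p * i div W"
  define r where "r = int p * i mod W"
  have r: "0 \<le> r" "r < W" using W_pos by (simp_all add: r_def)
  have pi: "int p * i = c * W + r" by (simp only: c_def r_def div_mult_mod_eq)
  have Wr: "0 < real_of_int W" using W_pos by simp
  have PW: "P = 2 * real p / of_int W" using P_W Wr by (simp add: field_simps)
  have Pn: "P * of_int n = of_int t + 1 / of_int W"
  proof -
    have "2 * real p * of_int n = 1 + of_int t * of_int W"
      using arg_cong[OF n, of real_of_int] by simp
    thus ?thesis unfolding PW using Wr by (simp add: field_simps)
  qed
  have Pi: "P * of_int i = 2 * of_int c + 2 * of_int r / of_int W"
  proof -
    have "real p * of_int i = of_int c * of_int W + of_int r"
      using arg_cong[OF pi, of real_of_int] by simp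
    thus ?thesis unfolding PW using Wr by (simp add: field_simps)
  qed
  have 1: "(P * of_int (n + i) + 1) / 2 = of_int (s + 1 + c) + (2 * of_int r + 1) / (2 * of_int W)"
    unfolding of_int_add distrib_left Pn Pi s using Wr by (simp add: field_simps)
  have 2: "(P * of_int (i - n) + 1) / 2 = of_int (c - s) + (2 * of_int r - 1) / (2 * of_int W)"
    unfolding of_int_diff right_diff_distrib Pn Pi s using Wr by (simp add: field_simps)
  have rW: "2 * real_of_int r + 1 < 2 * of_int W" using r by linarith
  have f1: "E (n + i) = s + 1 + c"
    unfolding E_def 1 using r rW Wr by (simp add: floor_eq_iff)
  have "\<lfloor>(2 * real_of_int r - 1) / (2 * of_int W)\<rfloor> = - (if r = 0 then 1 else 0)"
  proof (cases "r = 0")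
    case True
    have "1 \<le> real_of_int W" using W_pos by linarith
    thus ?thesis using True by (simp add: floor_eq_iff field_simps)
  next
    case False
    hence "1 \<le> real_of_int r" using r by linarith
    thus ?thesis using False rW Wr by (simp add: floor_eq_iff)
  qed
  hence f2: "E (i - n) = c - s - (if r = 0 then 1 else 0)"
    unfolding E_def 2 by (subst add.commute, subst floor_add_int[symmetric]) simp
  have "E (n - i) = - E (i - n)" using E_minus[of "i - n"] by simp
  hence "odd (E (n + i) + E (n - i)) \<longleftrightarrow> r \<noteq> 0"
    unfolding f1 f2 by auto
  also have "r = 0 \<longleftrightarrow> W dvd i"
    unfolding r_def using coprime_p_W
    by (metis coprime_commute coprime_dvd_mult_right_iff mod_0_imp_dvd dvd_imp_mod_0)
  finally show ?thesis by simp
qed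

text \<open>An edge is good iff exactly one of its two line numbers relative to \<open>n\<close> is
  divisible by \<open>W\<close>. In the columns \<open>0 \<le> m < W\<close> these are
  \<open>2 * m - a\<close> together with \<open>2 * m - a + 1\<close> or \<open>a + 1\<close>, where
  \<open>0 \<le> a \<le> m\<close>. The value 0 occurs only for \<open>m = 0\<close>; in the branch
  where \<open>a + 1\<close> counts it stays below \<open>2 * p < W\<close>; and reaching
  \<open>W\<close> forces \<open>W \<le> 2 * m + 1\<close>.\<close>

lemma capacity_two_row:
  assumes n: "2 * int p * n = 1 + t * W" and m: "0 \<le> m" "m < W"
  shows "good_h p q 0 n" and "good_h p q m n \<Longrightarrow> m = 0 \<or> W \<le> 2 * m + 1"
proof -
  have iff: "good_h p q m n \<longleftrightarrow> (W dvd (2 * m - a)) \<noteq> (W dvd b)"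
    if "a = \<lfloor>P * of_int m\<rfloor>" "b = (if P * of_int (m + 1) \<le> of_int (a + 1) then 2 * m - a + 1 else a + 1)" for a b m
    unfolding good_h_iff'[OF that] using capacity_two_parity[OF n, of "2 * m - a"] capacity_two_parity[OF n, of b]
    by auto
  have "1 < W" using pq by (simp add: W_def)
  hence W1: "\<not> W dvd 1" by (metis zdvd_not_zless zero_less_one)
  show "good_h p q 0 n" using iff[of 0 0 1] P_bounds W1 by simp
  assume good: "good_h p q m n"
  define a where "a = \<lfloor>P * of_int m\<rfloor>"
  define b where "b = (if P * of_int (m + 1) \<le> of_int (a + 1) then 2 * m - a + 1 else a + 1)"
  have a0: "0 \<le> a" using m P_bounds by (simp add: a_def)
  have "P * of_int m \<le> 1 * of_int m" using m P_bounds by (intro mult_right_mono) auto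
  hence am: "a \<le> m" unfolding a_def by linarith
  have "\<not> W dvd a + 1" if "\<not> P * of_int (m + 1) \<le> of_int (a + 1)"
  proof -
    have "P * of_int (m + 1) \<le> P * of_int W" using m P_bounds by (intro mult_left_mono) auto
    hence "of_int (a + 1) < 2 * real p" using that P_W by simp
    hence "a + 1 < W" using pq(2) unfolding W_def by linarith
    thus ?thesis using a0 by (auto dest: zdvd_imp_le)
  qed
  hence "W dvd 2 * m - a \<or> W dvd 2 * m - a + 1"
    using good iff[OF a_def b_def] by (auto simp: b_def split: if_splits)
  thus "m = 0 \<or> W \<le> 2 * m + 1"
    using am a0 m by (auto dest!: zdvd_imp_le)
qed

end

section \<open>Polygons confined to rectangles\<close>

lemma closed_segment_pair:
  fixes x y :: real
  assumes "(x, y) \<in> closed_segment (x1, y1) (x2, y2)"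
  obtains u where "0 \<le> u" "u \<le> 1" "x = x1 + u * (x2 - x1)" "y = y1 + u * (y2 - y1)"
proof -
  obtain u where "0 \<le> u" "u \<le> 1" "(x, y) = (1 - u) *\<^sub>R (x1, y1) + u *\<^sub>R (x2, y2)"
    using assms unfolding closed_segment_def by blast
  thus thesis by (intro that[of u]) (auto simp: algebra_simps)
qed

lemma half_neq_int: "real_of_int m + 1 / 2 \<noteq> of_int n"
proof
  assume "real_of_int m + 1 / 2 = of_int n"
  hence "real_of_int (2 * m + 1) = of_int (2 * n)" by simp
  hence "2 * m + 1 = 2 * n" by (simp only: of_int_eq_iff)
  thus False by presburger
qed

lemma plaid_union_cases:
  assumes "z \<in> plaid_union p q"
  obtains m n where "z \<in> closed_segment (center m n) (hmid m n)" "good_h p q m n"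
  | m n where "z \<in> closed_segment (center m n) (hmid m (n + 1))" "good_h p q m (n + 1)"
  | m n where "z \<in> closed_segment (center m n) (vmid m n)" "good_v p q m n"
  | m n where "z \<in> closed_segment (center m n) (vmid (m + 1) n)" "good_v p q (m + 1) n"
  using assms unfolding plaid_union_def by blast

text \<open>A segment towards a horizontal edge stays at a half-integral abscissa, and one towards a
  vertical edge has an integral abscissa only at its end.\<close>

lemma plaid_union_vertical_line:
  assumes "(of_int x, y) \<in> plaid_union p q"
  shows "\<exists>n. y = of_int n + 1 / 2 \<and> good_v p q x n"
  using assms
proof (cases rule: plaid_union_cases)
  case (1 m n)
  then obtain u where "real_of_int x = of_int m + 1 / 2"
    unfolding center_def hmid_def by (elim closed_segment_pair) auto
  thus ?thesis using half_neq_int by metis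
next
  case (2 m n)
  then obtain u where "real_of_int x = of_int m + 1 / 2"
    unfolding center_def hmid_def by (elim closed_segment_pair) auto
  thus ?thesis using half_neq_int by metis
next
  case (3 m n)
  from 3(1) obtain u where u: "0 \<le> u" "u \<le> 1" "real_of_int x = of_int m + 1 / 2 + u * (of_int m - (of_int m + 1 / 2))"
    "y = of_int n + 1 / 2 + u * (of_int n + 1 / 2 - (of_int n + 1 / 2))"
    unfolding center_def vmid_def by (rule closed_segment_pair)
  hence "real_of_int x = of_int m + (1 - u) / 2" by (simp add: field_simps)
  hence "real_of_int m \<le> of_int x" "real_of_int x < of_int m + 1" using u(1,2) by simp_all
  hence "x = m" by linarith
  thus ?thesis using u(4) 3(2) by (intro exI[of _ n]) simp
next
  case (4 m n)
  from 4(1) obtain u where u: "0 \<le> u" "u \<le> 1" "real_of_int x = of_int m + 1 / 2 + u * (of_int (m + 1) - (of_int m + 1 / 2))"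
    "y = of_int n + 1 / 2 + u * (of_int n + 1 / 2 - (of_int n + 1 / 2))"
    unfolding center_def vmid_def by (rule closed_segment_pair)
  hence "real_of_int x = of_int m + (1 + u) / 2" by (simp add: algebra_simps)
  hence "real_of_int m < of_int x" "real_of_int x \<le> of_int m + 1" using u(1,2) by simp_all
  hence "x = m + 1" by linarith
  thus ?thesis using u(4) 4(2) by (intro exI[of _ n]) simp
qed

lemma plaid_union_horizontal_line:
  assumes "(x, of_int y) \<in> plaid_union p q"
  shows "\<exists>m. x = of_int m + 1 / 2 \<and> good_h p q m y"
  using assms
proof (cases rule: plaid_union_cases)
  case (3 m n)
  then obtain u where "real_of_int y = of_int n + 1 / 2"
    unfolding center_def vmid_def by (elim closed_segment_pair) auto
  thus ?thesis using half_neq_int by metis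
next
  case (4 m n)
  then obtain u where "real_of_int y = of_int n + 1 / 2"
    unfolding center_def vmid_def by (elim closed_segment_pair) auto
  thus ?thesis using half_neq_int by metis
next
  case (1 m n)
  from 1(1) obtain u where u: "0 \<le> u" "u \<le> 1" "x = of_int m + 1 / 2 + u * (of_int m + 1 / 2 - (of_int m + 1 / 2))"
    "real_of_int y = of_int n + 1 / 2 + u * (of_int n - (of_int n + 1 / 2))"
    unfolding center_def hmid_def by (rule closed_segment_pair)
  hence "real_of_int y = of_int n + (1 - u) / 2" by (simp add: field_simps)
  hence "real_of_int n \<le> of_int y" "real_of_int y < of_int n + 1" using u(1,2) by simp_all
  hence "y = n" by linarith
  thus ?thesis using u(3) 1(2) by (intro exI[of _ m]) simp
next
  case (2 m n)
  from 2(1) obtain u where u: "0 \<le> u" "u \<le> 1" "x = of_int m + 1 / 2 + u * (of_int m + 1 / 2 - (of_int m + 1 / 2))"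
    "real_of_int y = of_int n + 1 / 2 + u * (of_int (n + 1) - (of_int n + 1 / 2))"
    unfolding center_def hmid_def by (rule closed_segment_pair)
  hence "real_of_int y = of_int n + (1 + u) / 2" by (simp add: algebra_simps)
  hence "real_of_int n < of_int y" "real_of_int y \<le> of_int n + 1" using u(1,2) by simp_all
  hence "y = n + 1" by linarith
  thus ?thesis using u(3) 2(2) by (intro exI[of _ m]) simp
qed

abbreviation polygon_at :: "nat \<Rightarrow> nat \<Rightarrow> int \<Rightarrow> int \<Rightarrow> (real \<times> real) set" where
  "polygon_at p q m n \<equiv> connected_component_set (plaid_union p q) (center m n)"

lemma good_v_segments:
  assumes "good_v p q (m + 1) n"
  shows "closed_segment (center m n) (vmid (m + 1) n) \<subseteq> plaid_union p q"
    and "closed_segment (center (m + 1) n) (vmid (m + 1) n) \<subseteq> plaid_union p q"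
  unfolding plaid_union_def
   apply (rule le_supI2, rule Union_upper, rule CollectI, intro exI conjI, rule refl, rule assms)
  apply (rule le_supI1, rule le_supI2, rule Union_upper, rule CollectI, intro exI conjI, rule refl, rule assms)
  done

lemma good_h_segments:
  assumes "good_h p q m (n + 1)"
  shows "closed_segment (center m n) (hmid m (n + 1)) \<subseteq> plaid_union p q"
    and "closed_segment (center m (n + 1)) (hmid m (n + 1)) \<subseteq> plaid_union p q"
  unfolding plaid_union_def
   apply (rule le_supI1, rule le_supI1, rule le_supI2, rule Union_upper, rule CollectI, intro exI conjI, rule refl, rule assms)
  apply (rule le_supI1, rule le_supI1, rule le_supI1, rule Union_upper, rule CollectI, intro exI conjI, rule refl, rule assms)
  done

lemma connected_component_segments:
  fixes a b c :: "'a::real_normed_vector"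
  assumes "closed_segment a c \<subseteq> U" "closed_segment b c \<subseteq> U"
  shows "connected_component U a b"
proof (rule connected_component_trans)
  show "connected_component U a c" unfolding connected_component_def
    by (rule exI[of _ "closed_segment a c"]) (use assms connected_segment[of a c] in simp)
  show "connected_component U c b" unfolding connected_component_def
    by (rule exI[of _ "closed_segment b c"]) (use assms connected_segment[of b c] in simp)
qed

lemma polygon_at_eq_v: "good_v p q (m + 1) n \<Longrightarrow> polygon_at p q m n = polygon_at p q (m + 1) n"
  using connected_component_segments[OF good_v_segments] by (intro connected_component_eq[symmetric]) simp

lemma polygon_at_eq_h: "good_h p q m (n + 1) \<Longrightarrow> polygon_at p q m n = polygon_at p q m (n + 1)"
  using connected_component_segments[OF good_h_segments] by (intro connected_component_eq[symmetric]) simp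

lemma center_in_union_v: "good_v p q m n \<Longrightarrow> center m n \<in> plaid_union p q"
  using good_v_segments(2)[of p q "m - 1" n] by auto

lemma center_in_union_h: "good_h p q m n \<Longrightarrow> center m n \<in> plaid_union p q"
  using good_h_segments(2)[of p q m "n - 1"] by auto

definition box_rect :: "int \<Rightarrow> int \<Rightarrow> int \<Rightarrow> int \<Rightarrow> (real \<times> real) set" where
  "box_rect x0 x1 y0 y1 = {of_int x0..of_int x1} \<times> {of_int y0..of_int y1}"

text \<open>A connected set that meets the rectangle and leaves it meets its frontier, and there the
  union consists of midpoints of good boundary edges only.\<close>

lemma polygon_in_rect:
  assumes v: "\<And>n. y0 \<le> n \<Longrightarrow> n < y1 \<Longrightarrow> \<not> good_v p q x0 n \<and> \<not> good_v p q x1 n"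
    and h: "\<And>m. x0 \<le> m \<Longrightarrow> m < x1 \<Longrightarrow> \<not> good_h p q m y0 \<and> \<not> good_h p q m y1"
    and z: "z \<in> plaid_union p q" "z \<in> box_rect x0 x1 y0 y1"
  shows "connected_component_set (plaid_union p q) z \<subseteq> box_rect x0 x1 y0 y1"
proof (rule ccontr)
  let ?S = "connected_component_set (plaid_union p q) z"
  let ?T = "box_rect x0 x1 y0 y1"
  assume "\<not> ?S \<subseteq> ?T"
  moreover have "z \<in> ?S" using z(1) by simp
  ultimately have "?S \<inter> frontier ?T \<noteq> {}"
    using z(2) by (intro connected_Int_frontier connected_connected_component) blast+
  then obtain x y where xy: "(x, y) \<in> ?S" "(x, y) \<in> frontier ?T" by auto
  have U: "(x, y) \<in> plaid_union p q" using xy(1) connected_component_subset by blast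
  have "frontier ?T = ?T - {of_int x0<..<of_int x1} \<times> {of_int y0<..<of_int y1}"
  proof -
    have "closed ?T" unfolding box_rect_def by (intro closed_Times) auto
    moreover have "interior ?T = {of_int x0<..<of_int x1} \<times> {of_int y0<..<of_int y1}"
      unfolding box_rect_def interior_Times by simp
    ultimately show ?thesis by (simp add: frontier_def)
  qed
  hence T: "of_int x0 \<le> x" "x \<le> of_int x1" "of_int y0 \<le> y" "y \<le> of_int y1"
    and "x = of_int x0 \<or> x = of_int x1 \<or> y = of_int y0 \<or> y = of_int y1"
    using xy(2) by (auto simp: box_rect_def)
  then consider x' where "x = of_int x'" "x' = x0 \<or> x' = x1" | y' where "y = of_int y'" "y' = y0 \<or> y' = y1" by blast
  thus False
  proof cases
    case 1
    then obtain n where n: "y = of_int n + 1 / 2" "good_v p q x' n"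
      using plaid_union_vertical_line U by blast
    hence "y0 \<le> n" "n < y1" using T by linarith+
    thus False using v n(2) 1(2) by blast
  next
    case 2
    then obtain m where m: "x = of_int m + 1 / 2" "good_h p q m y'"
      using plaid_union_horizontal_line U by blast
    hence "x0 \<le> m" "m < x1" using T by linarith+
    thus False using h m(2) 2(2) by blast
  qed
qed

lemma polygon_at_in_polygons:
  "center m n \<in> plaid_union p q \<Longrightarrow> polygon_at p q m n \<in> plaid_polygons p q"
  unfolding plaid_polygons_def by blast

text \<open>Every drawn segment starts at a center, so polygons can be labelled by unit
  squares.\<close>

lemma polygon_contains_center:
  assumes "C \<in> plaid_polygons p q"
  shows "\<exists>m n. center m n \<in> C \<and> C = polygon_at p q m n"
proof -
  obtain z where z: "z \<in> plaid_union p q" and C: "C = connected_component_set (plaid_union p q) z"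
    using assms unfolding plaid_polygons_def by blast
  obtain m n e where "z \<in> closed_segment (center m n) e" "closed_segment (center m n) e \<subseteq> plaid_union p q"
    using z
  proof (cases rule: plaid_union_cases)
    case (1 m n)
    thus thesis using that good_h_segments(2)[of p q m "n - 1"] by simp
  next
    case (2 m n)
    thus thesis using that good_h_segments(1) by blast
  next
    case (3 m n)
    thus thesis using that good_v_segments(2)[of p q "m - 1" n] by simp
  next
    case (4 m n)
    thus thesis using that good_v_segments(1) by blast
  qed
  hence "connected_component (plaid_union p q) z (center m n)"
    by (meson connected_component_def connected_segment ends_in_segment(1))
  thus ?thesis unfolding C by (metis connected_component_eq mem_Collect_eq)
qed

section \<open>Phases and distances to the even integers\<close>

definition nrm :: "real \<Rightarrow> real" where
  "nrm x = \<bar>x - 2 * of_int (round (x / 2))\<bar>"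

lemma nrm_le: "nrm x \<le> \<bar>x - 2 * of_int k\<bar>"
  using round_diff_minimal[of "x / 2" k] unfolding nrm_def by linarith

lemma nrm_witness: obtains k where "nrm x = \<bar>x - 2 * of_int k\<bar>" "\<bar>x - 2 * of_int k\<bar> \<le> 1"
proof (rule that)
  show "nrm x = \<bar>x - 2 * of_int (round (x / 2))\<bar>" by (rule nrm_def)
  show "\<bar>x - 2 * of_int (round (x / 2))\<bar> \<le> 1" using of_int_round_abs_le[of "x / 2"] by linarith
qed

lemma nrm_eq:
  assumes "\<bar>x - 2 * of_int k\<bar> \<le> 1"
  shows "nrm x = \<bar>x - 2 * of_int k\<bar>"
proof -
  obtain j where j: "nrm x = \<bar>x - 2 * of_int j\<bar>" by (rule nrm_witness)
  have "\<bar>x - 2 * of_int k\<bar> \<le> \<bar>x - 2 * of_int j\<bar>"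
  proof (cases "j = k")
    case False
    hence "1 \<le> \<bar>real_of_int j - of_int k\<bar>" by linarith
    thus ?thesis using assms by linarith
  qed simp
  thus ?thesis using nrm_le[of x k] j by linarith
qed

lemma nrm_shift: "nrm (x + 2 * of_int k) = nrm x"
proof -
  obtain j where "nrm x = \<bar>x - 2 * of_int j\<bar>" "\<bar>x - 2 * of_int j\<bar> \<le> 1" by (rule nrm_witness)
  moreover from this have "nrm (x + 2 * of_int k) = \<bar>x + 2 * of_int k - 2 * of_int (j + k)\<bar>"
    by (intro nrm_eq) simp
  ultimately show ?thesis by simp
qed

lemma nrm_lipschitz: "nrm x \<le> nrm y + \<bar>x - y\<bar>"
proof -
  obtain j where "nrm y = \<bar>y - 2 * of_int j\<bar>" by (rule nrm_witness)
  thus ?thesis using nrm_le[of x j] by linarith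
qed

lemma tendsto_nrm [tendsto_intros]:
  assumes "(f \<longlongrightarrow> l) F"
  shows "((\<lambda>x. nrm (f x)) \<longlongrightarrow> nrm l) F"
proof (rule Lim_null_comparison[THEN LIM_zero_cancel])
  show "\<forall>\<^sub>F x in F. norm (nrm (f x) - nrm l) \<le> \<bar>f x - l\<bar>"
  proof (rule always_eventually, rule allI)
    fix x
    show "norm (nrm (f x) - nrm l) \<le> \<bar>f x - l\<bar>"
      using nrm_lipschitz[of "f x" l] nrm_lipschitz[of l "f x"] unfolding real_norm_def by linarith
  qed
  show "((\<lambda>x. \<bar>f x - l\<bar>) \<longlongrightarrow> 0) F"
    using LIM_zero[OF assms] by (rule tendsto_rabs_zero)
qed

lemma nrm_pos: "x \<notin> \<int> \<Longrightarrow> 0 < nrm x"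
proof -
  assume "x \<notin> \<int>"
  obtain j where j: "nrm x = \<bar>x - 2 * of_int j\<bar>" by (rule nrm_witness)
  have "x \<noteq> of_int (2 * j)" using \<open>x \<notin> \<int>\<close> Ints_of_int by metis
  thus ?thesis using j by simp
qed

text \<open>For representatives \<open>x0\<close>, \<open>y0\<close> in \<open>[-1, 1]\<close> the
  floors record whether \<open>x0 + y0\<close> and \<open>x0 - y0\<close> leave the range between -1
  and 1. The larger of their absolute values is \<open>\<bar>x0\<bar> + \<bar>y0\<bar>\<close>, and
  at most one of them leaves the range.\<close>

lemma odd_floors_iff:
  assumes "nrm x + nrm y \<noteq> 1"
  shows "odd (\<lfloor>(x + y + 1) / 2\<rfloor> + \<lfloor>(x - y + 1) / 2\<rfloor>) \<longleftrightarrow> 1 < nrm x + nrm y"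
proof -
  obtain k where k: "nrm x = \<bar>x - 2 * of_int k\<bar>" "\<bar>x - 2 * of_int k\<bar> \<le> 1" by (rule nrm_witness)
  obtain l where l: "nrm y = \<bar>y - 2 * of_int l\<bar>" "\<bar>y - 2 * of_int l\<bar> \<le> 1" by (rule nrm_witness)
  define x0 where "x0 = x - 2 * of_int k"
  define y0 where "y0 = y - 2 * of_int l"
  have fl: "\<lfloor>(s + 1) / 2\<rfloor> = (if s < -1 then -1 else if 1 \<le> s then 1 else 0)" if "\<bar>s\<bar> \<le> 2" for s :: real
    using that by (auto simp: floor_eq_iff)
  have 1: "(x + y + 1) / 2 = of_int (k + l) + (x0 + y0 + 1) / 2"
    and 2: "(x - y + 1) / 2 = of_int (k - l) + (x0 - y0 + 1) / 2"
    by (simp_all add: x0_def y0_def field_simps)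
  have b: "\<bar>x0\<bar> \<le> 1" "\<bar>y0\<bar> \<le> 1" using k(2) l(2) by (simp_all add: x0_def y0_def)
  have f1: "\<lfloor>(x + y + 1) / 2\<rfloor> = k + l + (if x0 + y0 < -1 then -1 else if 1 \<le> x0 + y0 then 1 else 0)"
    unfolding 1 floor_add_int[symmetric, of _ "k + l", unfolded add.commute[of _ "k + l"]]
    using fl[of "x0 + y0"] b by (simp add: add.commute)
  have f2: "\<lfloor>(x - y + 1) / 2\<rfloor> = k - l + (if x0 - y0 < -1 then -1 else if 1 \<le> x0 - y0 then 1 else 0)"
    using fl[of "x0 - y0"] b unfolding 2 by (simp add: add.commute)
  have n: "nrm x = \<bar>x0\<bar>" "nrm y = \<bar>y0\<bar>" using k l by (simp_all add: x0_def y0_def)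
  show ?thesis using assms b unfolding f1 f2 n by (auto split: if_splits)
qed

text \<open>For \<open>u = P * n\<close> and \<open>x = P * i\<close> the sign gives the parity of
  \<open>E (n + i) + E (i - n)\<close>, hence, up to a switch common to the row, whether line
  \<open>n + i\<close> is light. The value 0 is a tie.\<close>

definition tgap :: "real \<Rightarrow> real \<Rightarrow> real" where
  "tgap u x = nrm x + nrm u - 1"

text \<open>The sign of \<open>hcross P m (P * n)\<close> (of \<open>vcross P m (P * (n + 1/2))\<close>) tells whether the horizontal
  (vertical) unit edge with lower left end \<open>(m, n)\<close> is good: it is good iff the sign is negative.\<close>

definition hcross :: "real \<Rightarrow> int \<Rightarrow> real \<Rightarrow> real" where
  "hcross P m u = (let a = \<lfloor>P * of_int m\<rfloor> in tgap u (P * of_int (2 * m - a)) *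
     tgap u (P * of_int (if P * of_int (m + 1) \<le> of_int (a + 1) then 2 * m - a + 1 else a + 1)))"

definition vcross :: "real \<Rightarrow> int \<Rightarrow> real \<Rightarrow> real" where
  "vcross P m u = (let a = \<lfloor>P * of_int m\<rfloor> in tgap u (P * (of_int a + 1 / 2)) *
     tgap u (P * (of_int (2 * m - a) - 1 / 2)))"

lemma tgap_shift: "tgap (u + 2 * of_int k) x = tgap u x"
  by (simp add: tgap_def nrm_shift)

lemma hcross_shift: "hcross P m (u + 2 * of_int k) = hcross P m u"
  and vcross_shift: "vcross P m (u + 2 * of_int k) = vcross P m u"
  unfolding hcross_def vcross_def tgap_shift by simp_all

lemma tendsto_tgap [tendsto_intros]:
  "(f \<longlongrightarrow> l) F \<Longrightarrow> (g \<longlongrightarrow> k) F \<Longrightarrow> ((\<lambda>x. tgap (f x) (g x)) \<longlongrightarrow> tgap l k) F"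
  unfolding tgap_def by (intro tendsto_intros)

context plaid
begin

lemma E_pair_tgap:
  assumes "tgap y x \<noteq> 0" "P * of_int i = x + y" "P * of_int j = x - y"
  shows "odd (E i + E j) \<longleftrightarrow> 0 < tgap y x"
  using odd_floors_iff[of x y] assms(1) unfolding E_def assms(2,3) tgap_def by simp

lemma hcross_good:
  assumes "hcross P m (P * of_int n) \<noteq> 0"
  shows "good_h p q m n \<longleftrightarrow> hcross P m (P * of_int n) < 0"
proof -
  define a where "a = \<lfloor>P * of_int m\<rfloor>"
  define b where "b = (if P * of_int (m + 1) \<le> of_int (a + 1) then 2 * m - a + 1 else a + 1)"
  let ?t = "\<lambda>i. tgap (P * of_int n) (P * of_int i)"
  have h: "hcross P m (P * of_int n) = ?t (2 * m - a) * ?t b"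
    unfolding hcross_def Let_def a_def[symmetric] b_def[symmetric] ..
  have *: "odd (E (n + i) + E (i - n)) \<longleftrightarrow> 0 < ?t i" if "?t i \<noteq> 0" for i
    by (rule E_pair_tgap[OF that]) (simp_all add: algebra_simps)
  have "good_h p q m n \<longleftrightarrow> odd (E (n + (2 * m - a)) + E (2 * m - a - n)) \<noteq> odd (E (n + b) + E (b - n))"
    unfolding good_h_iff[OF a_def b_def] by (simp only: odd_add)
  also have "\<dots> \<longleftrightarrow> (0 < ?t (2 * m - a)) \<noteq> (0 < ?t b)"
    using * assms unfolding h by simp
  finally show ?thesis using assms unfolding h mult_less_0_iff by auto
qed

text \<open>The four indices of \<open>good_v_iff\<close> form two pairs which, up to signs, lie
  symmetrically about \<open>n + 1/2\<close>; hence the half-integral heights and positions in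
  \<open>vcross\<close>.\<close>

lemma vcross_good:
  assumes "vcross P m (P * (of_int n + 1 / 2)) \<noteq> 0"
  shows "good_v p q m n \<longleftrightarrow> vcross P m (P * (of_int n + 1 / 2)) < 0"
proof -
  define a where "a = \<lfloor>P * of_int m\<rfloor>"
  let ?t = "tgap (P * (of_int n + 1 / 2))"
  let ?x = "P * (of_int a + 1 / 2)" and ?y = "P * (of_int (2 * m - a) - 1 / 2)"
  have v: "vcross P m (P * (of_int n + 1 / 2)) = ?t ?x * ?t ?y"
    unfolding vcross_def Let_def a_def[symmetric] ..
  have ne: "?t ?x \<noteq> 0" "?t ?y \<noteq> 0" using assms unfolding v by auto
  have 1: "odd (E (n + a + 1) + E (a - n)) \<longleftrightarrow> 0 < ?t ?x"
    by (rule E_pair_tgap[OF ne(1)]) (simp_all add: algebra_simps)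
  have 2: "odd (E (n + 2 * m - a) + E (2 * m - a - 1 - n)) \<longleftrightarrow> 0 < ?t ?y"
    by (rule E_pair_tgap[OF ne(2)]) (simp_all add: algebra_simps)
  have "E (n - a) = - E (a - n)" "E (n + a + 1 - 2 * m) = - E (2 * m - a - 1 - n)"
    using E_minus[of "a - n"] E_minus[of "2 * m - a - 1 - n"] by (simp_all add: algebra_simps)
  hence "good_v p q m n \<longleftrightarrow> odd (E (n + a + 1) + E (a - n)) \<noteq> odd (E (n + 2 * m - a) + E (2 * m - a - 1 - n))"
    unfolding good_v_iff[OF a_def] by auto
  also have "\<dots> \<longleftrightarrow> (0 < ?t ?x) \<noteq> (0 < ?t ?y)" unfolding 1 2 ..
  finally show ?thesis using ne unfolding v mult_less_0_iff by auto
qed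

end

text \<open>A rectangle over the columns from \<open>x\<close> to \<open>x + w\<close>, of height
  \<open>h\<close>, whose bottom row \<open>n\<close> enters only through the phase
  \<open>u = P * n\<close>; the vertical edge at column \<open>i\<close> in row \<open>j\<close> of
  the rectangle is to be the good one inside. Strict signs make the property open in
  \<open>P\<close> and \<open>u\<close> and free of ties.\<close>

definition isolating_box :: "real \<Rightarrow> int \<Rightarrow> int \<Rightarrow> int \<Rightarrow> int \<Rightarrow> int \<Rightarrow> real \<Rightarrow> bool" where
  "isolating_box P x w h i j u \<longleftrightarrow>
     (\<forall>m\<in>{x..<x + w}. 0 < hcross P m u \<and> 0 < hcross P m (u + P * of_int h)) \<and>
     (\<forall>k\<in>{0..<h}. 0 < vcross P x (u + P * (of_int k + 1 / 2)) \<and> 0 < vcross P (x + w) (u + P * (of_int k + 1 / 2))) \<and>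
     vcross P i (u + P * (of_int j + 1 / 2)) < 0"

lemma isolating_box_shift: "isolating_box P x w h i j (u + 2 * of_int l) = isolating_box P x w h i j u"
proof -
  have "u + 2 * of_int l + v = u + v + 2 * of_int l" for v by simp
  thus ?thesis unfolding isolating_box_def hcross_shift vcross_shift by (simp only: hcross_shift vcross_shift)
qed

section \<open>Stability of isolating boxes under perturbation\<close>

lemma eventually_floor_mult:
  fixes P :: real
  assumes "P \<notin> \<rat>"
  shows "\<forall>\<^sub>F P' in nhds P. \<lfloor>P' * of_int m\<rfloor> = \<lfloor>P * of_int m\<rfloor>"
proof (cases "m = 0")
  case False
  have ne: "P * of_int m \<noteq> of_int k" for k
  proof
    assume "P * of_int m = of_int k"
    hence "P = of_int k / of_int m" using False by (simp add: field_simps)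
    thus False using assms by simp
  qed
  have t: "((\<lambda>P'. P' * of_int m) \<longlongrightarrow> P * of_int m) (nhds P)"
    by (intro tendsto_intros filterlim_ident)
  define a where "a = \<lfloor>P * of_int m\<rfloor>"
  have "of_int a < P * of_int m" "P * of_int m < of_int (a + 1)"
    using ne[of a] unfolding a_def by linarith+
  from order_tendstoD(1)[OF t this(1)] order_tendstoD(2)[OF t this(2)]
  show ?thesis by eventually_elim (simp add: a_def[symmetric] floor_eq_iff)
qed simp

lemma eventually_le_mult:
  fixes P :: real
  assumes "P \<notin> \<rat>" "m \<noteq> 0"
  shows "\<forall>\<^sub>F P' in nhds P. (P' * of_int m \<le> of_int k) = (P * of_int m \<le> of_int k)"
proof -
  have ne: "P * of_int m \<noteq> of_int k"
  proof
    assume "P * of_int m = of_int k"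
    hence "P = of_int k / of_int m" using assms(2) by (simp add: field_simps)
    thus False using assms by simp
  qed
  have t: "((\<lambda>P'. P' * of_int m) \<longlongrightarrow> P * of_int m) (nhds P)"
    by (intro tendsto_intros filterlim_ident)
  show ?thesis
  proof (cases "P * of_int m < of_int k")
    case True
    from order_tendstoD(2)[OF t this] show ?thesis by eventually_elim (use True in auto)
  next
    case False
    hence *: "of_int k < P * of_int m" using ne by simp
    from order_tendstoD(1)[OF t this] show ?thesis by eventually_elim (use * in auto)
  qed
qed

text \<open>The floor and the case distinction jump only at rational \<open>P\<close>, so they are
  constant near an irrational one; what is left is continuous.\<close>

lemma tendsto_hcross:
  fixes P :: real
  assumes P: "P \<notin> \<rat>" and m: "0 \<le> m"
    and f: "(f \<longlongrightarrow> P) F" and g: "(g \<longlongrightarrow> u) F"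
  shows "((\<lambda>x. hcross (f x) m (g x)) \<longlongrightarrow> hcross P m u) F"
proof -
  define a where "a = \<lfloor>P * of_int m\<rfloor>"
  define b where "b = (if P * of_int (m + 1) \<le> of_int (a + 1) then 2 * m - a + 1 else a + 1)"
  have "((\<lambda>x. tgap (g x) (f x * of_int (2 * m - a)) * tgap (g x) (f x * of_int b)) \<longlongrightarrow>
      tgap u (P * of_int (2 * m - a)) * tgap u (P * of_int b)) F"
    by (intro tendsto_intros f g)
  moreover have "\<forall>\<^sub>F x in F. tgap (g x) (f x * of_int (2 * m - a)) * tgap (g x) (f x * of_int b) = hcross (f x) m (g x)"
  proof -
    have "m + 1 \<noteq> 0" using m by simp
    note eventually_compose_filterlim[OF eventually_floor_mult[OF P, of m] f]
      eventually_compose_filterlim[OF eventually_le_mult[OF P this, of "a + 1"] f]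
    thus ?thesis by eventually_elim (simp add: hcross_def Let_def a_def b_def)
  qed
  ultimately have "((\<lambda>x. hcross (f x) m (g x)) \<longlongrightarrow> tgap u (P * of_int (2 * m - a)) * tgap u (P * of_int b)) F"
    by (rule Lim_transform_eventually)
  moreover have "hcross P m u = tgap u (P * of_int (2 * m - a)) * tgap u (P * of_int b)"
    unfolding hcross_def Let_def a_def[symmetric] b_def[symmetric] ..
  ultimately show ?thesis by simp
qed

lemma tendsto_vcross:
  fixes P :: real
  assumes P: "P \<notin> \<rat>" and f: "(f \<longlongrightarrow> P) F" and g: "(g \<longlongrightarrow> u) F"
  shows "((\<lambda>x. vcross (f x) m (g x)) \<longlongrightarrow> vcross P m u) F"
proof -
  define a where "a = \<lfloor>P * of_int m\<rfloor>"
  have "((\<lambda>x. tgap (g x) (f x * (of_int a + 1 / 2)) * tgap (g x) (f x * (of_int (2 * m - a) - 1 / 2))) \<longlongrightarrow>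
      tgap u (P * (of_int a + 1 / 2)) * tgap u (P * (of_int (2 * m - a) - 1 / 2))) F"
    by (intro tendsto_intros f g)
  moreover have "\<forall>\<^sub>F x in F. tgap (g x) (f x * (of_int a + 1 / 2)) * tgap (g x) (f x * (of_int (2 * m - a) - 1 / 2))
      = vcross (f x) m (g x)"
    using eventually_compose_filterlim[OF eventually_floor_mult[OF P, of m] f]
    by eventually_elim (simp add: vcross_def Let_def a_def)
  ultimately have "((\<lambda>x. vcross (f x) m (g x)) \<longlongrightarrow>
      tgap u (P * (of_int a + 1 / 2)) * tgap u (P * (of_int (2 * m - a) - 1 / 2))) F"
    by (rule Lim_transform_eventually)
  thus ?thesis by (simp add: vcross_def Let_def a_def)
qed

lemma eventually_isolating_box:
  fixes P :: real
  assumes P: "P \<notin> \<rat>" and x: "0 \<le> x" and box: "isolating_box P x w h i j u"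
  shows "\<forall>\<^sub>F (P', u') in nhds P \<times>\<^sub>F nhds u. isolating_box P' x w h i j u'"
proof -
  let ?F = "nhds P \<times>\<^sub>F nhds u"
  have f: "(fst \<longlongrightarrow> P) ?F" and g: "(snd \<longlongrightarrow> u) ?F"
    by (auto intro: filterlim_fst filterlim_snd)
  have gs: "((\<lambda>z. snd z + fst z * c) \<longlongrightarrow> u + P * c) ?F" for c
    by (intro tendsto_intros f g)
  have 1: "\<forall>\<^sub>F z in ?F. \<forall>m\<in>{x..<x + w}. 0 < hcross (fst z) m (snd z) \<and> 0 < hcross (fst z) m (snd z + fst z * of_int h)"
  proof (intro eventually_ball_finite ballI eventually_conj)
    fix m assume m: "m \<in> {x..<x + w}"
    hence m0: "0 \<le> m" using x by simp
    show "\<forall>\<^sub>F z in ?F. 0 < hcross (fst z) m (snd z)"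
      by (rule order_tendstoD(1)[OF tendsto_hcross[OF P m0 f g]]) (use box m in \<open>simp add: isolating_box_def\<close>)
    show "\<forall>\<^sub>F z in ?F. 0 < hcross (fst z) m (snd z + fst z * of_int h)"
      by (rule order_tendstoD(1)[OF tendsto_hcross[OF P m0 f gs]]) (use box m in \<open>simp add: isolating_box_def\<close>)
  qed simp
  have 2: "\<forall>\<^sub>F z in ?F. \<forall>k\<in>{0..<h}. 0 < vcross (fst z) x (snd z + fst z * (of_int k + 1 / 2)) \<and>
      0 < vcross (fst z) (x + w) (snd z + fst z * (of_int k + 1 / 2))"
  proof (intro eventually_ball_finite ballI eventually_conj)
    fix k assume k: "k \<in> {0..<h}"
    show "\<forall>\<^sub>F z in ?F. 0 < vcross (fst z) x (snd z + fst z * (of_int k + 1 / 2))"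
      by (rule order_tendstoD(1)[OF tendsto_vcross[OF P f gs]]) (use box k in \<open>simp add: isolating_box_def\<close>)
    show "\<forall>\<^sub>F z in ?F. 0 < vcross (fst z) (x + w) (snd z + fst z * (of_int k + 1 / 2))"
      by (rule order_tendstoD(1)[OF tendsto_vcross[OF P f gs]]) (use box k in \<open>simp add: isolating_box_def\<close>)
  qed simp
  have 3: "\<forall>\<^sub>F z in ?F. vcross (fst z) i (snd z + fst z * (of_int j + 1 / 2)) < 0"
    by (rule order_tendstoD(2)[OF tendsto_vcross[OF P f gs]]) (use box in \<open>simp add: isolating_box_def\<close>)
  from 1 2 3 show ?thesis
    by eventually_elim (simp add: isolating_box_def case_prod_beta)
qed

section \<open>Isolating boxes\<close>

text \<open>Naming nearest even integers \<open>2 * k\<close> and \<open>2 * j\<close> turns a claim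
  about distances into linear inequalities, so that each concrete box is settled by linear
  arithmetic.\<close>

lemma tgap_pos:
  assumes "\<bar>x - 2 * of_int k\<bar> \<le> 1" "\<bar>u - 2 * of_int j\<bar> \<le> 1" "1 < \<bar>x - 2 * of_int k\<bar> + \<bar>u - 2 * of_int j\<bar>"
  shows "0 < tgap u x"
  using assms by (simp add: tgap_def nrm_eq)

lemma tgap_neg:
  assumes "\<bar>x - 2 * of_int k\<bar> \<le> 1" "\<bar>u - 2 * of_int j\<bar> \<le> 1" "\<bar>x - 2 * of_int k\<bar> + \<bar>u - 2 * of_int j\<bar> < 1"
  shows "tgap u x < 0"
  using assms by (simp add: tgap_def nrm_eq)

lemma hcross_left:
  assumes "of_int a \<le> P * of_int m" "P * of_int m < of_int a + 1" "P * of_int (m + 1) \<le> of_int (a + 1)"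
  shows "hcross P m u = tgap u (P * of_int (2 * m - a)) * tgap u (P * of_int (2 * m - a + 1))"
proof -
  have "\<lfloor>P * of_int m\<rfloor> = a" using assms by (simp add: floor_eq_iff)
  thus ?thesis using assms by (simp add: hcross_def)
qed

lemma hcross_right:
  assumes "of_int a \<le> P * of_int m" "P * of_int m < of_int a + 1" "of_int (a + 1) < P * of_int (m + 1)"
  shows "hcross P m u = tgap u (P * of_int (2 * m - a)) * tgap u (P * of_int (a + 1))"
proof -
  have "\<lfloor>P * of_int m\<rfloor> = a" using assms by (simp add: floor_eq_iff)
  thus ?thesis using assms by (simp add: hcross_def)
qed

lemma vcross_eq:
  assumes "of_int a \<le> P * of_int m" "P * of_int m < of_int a + 1"
  shows "vcross P m u = tgap u (P * (of_int a + 1 / 2)) * tgap u (P * (of_int (2 * m - a) - 1 / 2))"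
proof -
  have "\<lfloor>P * of_int m\<rfloor> = a" using assms by (simp add: floor_eq_iff)
  thus ?thesis by (simp add: vcross_def)
qed

lemma hcross_hi_left:
  assumes "of_int a \<le> P * of_int m" "P * of_int m < of_int a + 1" "P * of_int (m + 1) \<le> of_int (a + 1)"
    and "\<bar>P * of_int (2 * m - a) - 2 * of_int k\<bar> \<le> 1" "\<bar>P * of_int (2 * m - a + 1) - 2 * of_int l\<bar> \<le> 1" "\<bar>u - 2 * of_int j\<bar> \<le> 1"
    and "1 < \<bar>P * of_int (2 * m - a) - 2 * of_int k\<bar> + \<bar>u - 2 * of_int j\<bar>"
    and "1 < \<bar>P * of_int (2 * m - a + 1) - 2 * of_int l\<bar> + \<bar>u - 2 * of_int j\<bar>"
  shows "0 < hcross P m u"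
  unfolding hcross_left[OF assms(1-3)]
  by (rule mult_pos_pos[OF tgap_pos[OF assms(4,6,7)] tgap_pos[OF assms(5,6,8)]])

lemma hcross_hi_right:
  assumes "of_int a \<le> P * of_int m" "P * of_int m < of_int a + 1" "of_int (a + 1) < P * of_int (m + 1)"
    and "\<bar>P * of_int (2 * m - a) - 2 * of_int k\<bar> \<le> 1" "\<bar>P * of_int (a + 1) - 2 * of_int l\<bar> \<le> 1" "\<bar>u - 2 * of_int j\<bar> \<le> 1"
    and "1 < \<bar>P * of_int (2 * m - a) - 2 * of_int k\<bar> + \<bar>u - 2 * of_int j\<bar>"
    and "1 < \<bar>P * of_int (a + 1) - 2 * of_int l\<bar> + \<bar>u - 2 * of_int j\<bar>"
  shows "0 < hcross P m u"
  unfolding hcross_right[OF assms(1-3)]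
  by (rule mult_pos_pos[OF tgap_pos[OF assms(4,6,7)] tgap_pos[OF assms(5,6,8)]])

lemma vcross_hi:
  assumes "of_int a \<le> P * of_int m" "P * of_int m < of_int a + 1"
    and "\<bar>P * (of_int a + 1 / 2) - 2 * of_int k\<bar> \<le> 1" "\<bar>P * (of_int (2 * m - a) - 1 / 2) - 2 * of_int l\<bar> \<le> 1" "\<bar>u - 2 * of_int j\<bar> \<le> 1"
    and "1 < \<bar>P * (of_int a + 1 / 2) - 2 * of_int k\<bar> + \<bar>u - 2 * of_int j\<bar>"
    and "1 < \<bar>P * (of_int (2 * m - a) - 1 / 2) - 2 * of_int l\<bar> + \<bar>u - 2 * of_int j\<bar>"
  shows "0 < vcross P m u"
  unfolding vcross_eq[OF assms(1-2)]
  by (rule mult_pos_pos[OF tgap_pos[OF assms(3,5,6)] tgap_pos[OF assms(4,5,7)]])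

lemma hcross_lo_left:
  assumes "of_int a \<le> P * of_int m" "P * of_int m < of_int a + 1" "P * of_int (m + 1) \<le> of_int (a + 1)"
    and "\<bar>P * of_int (2 * m - a) - 2 * of_int k\<bar> \<le> 1" "\<bar>P * of_int (2 * m - a + 1) - 2 * of_int l\<bar> \<le> 1" "\<bar>u - 2 * of_int j\<bar> \<le> 1"
    and "\<bar>P * of_int (2 * m - a) - 2 * of_int k\<bar> + \<bar>u - 2 * of_int j\<bar> < 1"
    and "\<bar>P * of_int (2 * m - a + 1) - 2 * of_int l\<bar> + \<bar>u - 2 * of_int j\<bar> < 1"
  shows "0 < hcross P m u"
  unfolding hcross_left[OF assms(1-3)]
  by (rule mult_neg_neg[OF tgap_neg[OF assms(4,6,7)] tgap_neg[OF assms(5,6,8)]])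

lemma hcross_lo_right:
  assumes "of_int a \<le> P * of_int m" "P * of_int m < of_int a + 1" "of_int (a + 1) < P * of_int (m + 1)"
    and "\<bar>P * of_int (2 * m - a) - 2 * of_int k\<bar> \<le> 1" "\<bar>P * of_int (a + 1) - 2 * of_int l\<bar> \<le> 1" "\<bar>u - 2 * of_int j\<bar> \<le> 1"
    and "\<bar>P * of_int (2 * m - a) - 2 * of_int k\<bar> + \<bar>u - 2 * of_int j\<bar> < 1"
    and "\<bar>P * of_int (a + 1) - 2 * of_int l\<bar> + \<bar>u - 2 * of_int j\<bar> < 1"
  shows "0 < hcross P m u"
  unfolding hcross_right[OF assms(1-3)]
  by (rule mult_neg_neg[OF tgap_neg[OF assms(4,6,7)] tgap_neg[OF assms(5,6,8)]])

lemma vcross_lo: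
  assumes "of_int a \<le> P * of_int m" "P * of_int m < of_int a + 1"
    and "\<bar>P * (of_int a + 1 / 2) - 2 * of_int k\<bar> \<le> 1" "\<bar>P * (of_int (2 * m - a) - 1 / 2) - 2 * of_int l\<bar> \<le> 1" "\<bar>u - 2 * of_int j\<bar> \<le> 1"
    and "\<bar>P * (of_int a + 1 / 2) - 2 * of_int k\<bar> + \<bar>u - 2 * of_int j\<bar> < 1"
    and "\<bar>P * (of_int (2 * m - a) - 1 / 2) - 2 * of_int l\<bar> + \<bar>u - 2 * of_int j\<bar> < 1"
  shows "0 < vcross P m u"
  unfolding vcross_eq[OF assms(1-2)]
  by (rule mult_neg_neg[OF tgap_neg[OF assms(3,5,6)] tgap_neg[OF assms(4,5,7)]])

lemma vcross_hi_lo: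
  assumes "of_int a \<le> P * of_int m" "P * of_int m < of_int a + 1"
    and "\<bar>P * (of_int a + 1 / 2) - 2 * of_int k\<bar> \<le> 1" "\<bar>P * (of_int (2 * m - a) - 1 / 2) - 2 * of_int l\<bar> \<le> 1" "\<bar>u - 2 * of_int j\<bar> \<le> 1"
    and "1 < \<bar>P * (of_int a + 1 / 2) - 2 * of_int k\<bar> + \<bar>u - 2 * of_int j\<bar>"
    and "\<bar>P * (of_int (2 * m - a) - 1 / 2) - 2 * of_int l\<bar> + \<bar>u - 2 * of_int j\<bar> < 1"
  shows "vcross P m u < 0"
  unfolding vcross_eq[OF assms(1-2)]
  by (rule mult_pos_neg[OF tgap_pos[OF assms(3,5,6)] tgap_neg[OF assms(4,5,7)]])

lemma vcross_lo_hi: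
  assumes "of_int a \<le> P * of_int m" "P * of_int m < of_int a + 1"
    and "\<bar>P * (of_int a + 1 / 2) - 2 * of_int k\<bar> \<le> 1" "\<bar>P * (of_int (2 * m - a) - 1 / 2) - 2 * of_int l\<bar> \<le> 1" "\<bar>u - 2 * of_int j\<bar> \<le> 1"
    and "\<bar>P * (of_int a + 1 / 2) - 2 * of_int k\<bar> + \<bar>u - 2 * of_int j\<bar> < 1"
    and "1 < \<bar>P * (of_int (2 * m - a) - 1 / 2) - 2 * of_int l\<bar> + \<bar>u - 2 * of_int j\<bar>"
  shows "vcross P m u < 0"
  unfolding vcross_eq[OF assms(1-2)]
  by (rule mult_neg_pos[OF tgap_neg[OF assms(3,5,6)] tgap_pos[OF assms(4,5,7)]])

lemma isolating_box_2x2I: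
  assumes "0 < hcross P (x) u"
    and "0 < hcross P (x) (u + P * 2)"
    and "0 < hcross P (x + 1) u"
    and "0 < hcross P (x + 1) (u + P * 2)"
    and "0 < vcross P x (u + P * (0 + 1 / 2))"
    and "0 < vcross P (x + 2) (u + P * (0 + 1 / 2))"
    and "0 < vcross P x (u + P * (1 + 1 / 2))"
    and "0 < vcross P (x + 2) (u + P * (1 + 1 / 2))"
    and "vcross P i (u + P * (of_int j + 1 / 2)) < 0"
  shows "isolating_box P x 2 2 i j u"
proof -
  have "{x..<x + 2} = {x, x + 1}" "{0..<2::int} = {0, 1}" by auto
  thus ?thesis using assms unfolding isolating_box_def by simp
qed

lemma isolating_box_3x2I:
  assumes "0 < hcross P (x) u"
    and "0 < hcross P (x) (u + P * 2)"
    and "0 < hcross P (x + 1) u"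
    and "0 < hcross P (x + 1) (u + P * 2)"
    and "0 < hcross P (x + 2) u"
    and "0 < hcross P (x + 2) (u + P * 2)"
    and "0 < vcross P x (u + P * (0 + 1 / 2))"
    and "0 < vcross P (x + 3) (u + P * (0 + 1 / 2))"
    and "0 < vcross P x (u + P * (1 + 1 / 2))"
    and "0 < vcross P (x + 3) (u + P * (1 + 1 / 2))"
    and "vcross P i (u + P * (of_int j + 1 / 2)) < 0"
  shows "isolating_box P x 3 2 i j u"
proof -
  have "{x..<x + 3} = {x, x + 1, x + 2}" "{0..<2::int} = {0, 1}" by auto
  thus ?thesis using assms unfolding isolating_box_def by simp
qed

lemma isolating_box_3x3I:
  assumes "0 < hcross P (x) u"
    and "0 < hcross P (x) (u + P * 3)"
    and "0 < hcross P (x + 1) u"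
    and "0 < hcross P (x + 1) (u + P * 3)"
    and "0 < hcross P (x + 2) u"
    and "0 < hcross P (x + 2) (u + P * 3)"
    and "0 < vcross P x (u + P * (0 + 1 / 2))"
    and "0 < vcross P (x + 3) (u + P * (0 + 1 / 2))"
    and "0 < vcross P x (u + P * (1 + 1 / 2))"
    and "0 < vcross P (x + 3) (u + P * (1 + 1 / 2))"
    and "0 < vcross P x (u + P * (2 + 1 / 2))"
    and "0 < vcross P (x + 3) (u + P * (2 + 1 / 2))"
    and "vcross P i (u + P * (of_int j + 1 / 2)) < 0"
  shows "isolating_box P x 3 3 i j u"
proof -
  have "{x..<x + 3} = {x, x + 1, x + 2}" "{0..<3::int} = {0, 1, 2}" by auto
  thus ?thesis using assms unfolding isolating_box_def by simp
qed

text \<open>The boxes and phases of the following ten lemmas were found by a numerical search among the phases that are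
  affine in \<open>P\<close>; together they cover the irrational numbers between \<open>1/3\<close> and \<open>2/3\<close>.\<close>

lemma isolating_box_1:
  assumes "1/3 < P" "P < 4/11"
  shows "isolating_box P 6 2 2 7 0 1"
proof -
  have "0 < hcross P 6 1"
    by (rule hcross_hi_left[where a="2" and k="2" and l="2" and j="1"]; use assms in \<open>simp; linarith\<close>)
  moreover have "0 < hcross P 6 (1 + P * 2)"
    by (rule hcross_lo_left[where a="2" and k="2" and l="2" and j="1"]; use assms in \<open>simp; linarith\<close>)
  moreover have "0 < hcross P 7 1"
    by (rule hcross_hi_left[where a="2" and k="2" and l="2" and j="1"]; use assms in \<open>simp; linarith\<close>)
  moreover have "0 < hcross P 7 (1 + P * 2)"
    by (rule hcross_lo_left[where a="2" and k="2" and l="2" and j="1"]; use assms in \<open>simp; linarith\<close>)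
  moreover have "0 < vcross P 6 (1 + P * (0 + 1 / 2))"
    by (rule vcross_hi[where a="2" and k="0" and l="2" and j="1"]; use assms in \<open>simp; linarith\<close>)
  moreover have "0 < vcross P 8 (1 + P * (0 + 1 / 2))"
    by (rule vcross_hi[where a="2" and k="0" and l="2" and j="1"]; use assms in \<open>simp; linarith\<close>)
  moreover have "0 < vcross P 6 (1 + P * (1 + 1 / 2))"
    by (rule vcross_hi[where a="2" and k="0" and l="2" and j="1"]; use assms in \<open>simp; linarith\<close>)
  moreover have "0 < vcross P 8 (1 + P * (1 + 1 / 2))"
    by (rule vcross_hi[where a="2" and k="0" and l="2" and j="1"]; use assms in \<open>simp; linarith\<close>)
  moreover have "vcross P 7 (1 + P * (0 + 1 / 2)) < 0"
    by (rule vcross_hi_lo[where a="2" and k="0" and l="2" and j="1"]; use assms in \<open>auto simp: abs_if\<close>)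
  ultimately show ?thesis
    by (intro isolating_box_2x2I; simp)
qed

lemma isolating_box_2:
  assumes "4/11 < P" "P < 3/8"
  shows "isolating_box P 9 2 2 10 0 1"
proof -
  have "0 < hcross P 9 1"
    by (rule hcross_hi_left[where a="3" and k="3" and l="3" and j="1"]; use assms in \<open>simp; linarith\<close>)
  moreover have "0 < hcross P 9 (1 + P * 2)"
    by (rule hcross_lo_left[where a="3" and k="3" and l="3" and j="1"]; use assms in \<open>simp; linarith\<close>)
  moreover have "0 < hcross P 10 1"
    by (rule hcross_hi_right[where a="3" and k="3" and l="1" and j="1"]; use assms in \<open>simp; linarith\<close>)
  moreover have "0 < hcross P 10 (1 + P * 2)"
    by (rule hcross_lo_right[where a="3" and k="3" and l="1" and j="1"]; use assms in \<open>simp; linarith\<close>)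
  moreover have "0 < vcross P 9 (1 + P * (0 + 1 / 2))"
    by (rule vcross_hi[where a="3" and k="1" and l="3" and j="1"]; use assms in \<open>simp; linarith\<close>)
  moreover have "0 < vcross P 11 (1 + P * (0 + 1 / 2))"
    by (rule vcross_hi[where a="4" and k="1" and l="3" and j="1"]; use assms in \<open>simp; linarith\<close>)
  moreover have "0 < vcross P 9 (1 + P * (1 + 1 / 2))"
    by (rule vcross_hi[where a="3" and k="1" and l="3" and j="1"]; use assms in \<open>simp; linarith\<close>)
  moreover have "0 < vcross P 11 (1 + P * (1 + 1 / 2))"
    by (rule vcross_lo[where a="4" and k="1" and l="3" and j="1"]; use assms in \<open>simp; linarith\<close>)
  moreover have "vcross P 10 (1 + P * (0 + 1 / 2)) < 0"
    by (rule vcross_hi_lo[where a="3" and k="1" and l="3" and j="1"]; use assms in \<open>simp; linarith\<close>)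
  ultimately show ?thesis
    by (intro isolating_box_2x2I; simp)
qed

lemma isolating_box_3:
  assumes "3/8 < P" "P < 2/5"
  shows "isolating_box P 5 3 2 6 0 (7 * P / 2)"
proof -
  have "0 < hcross P 5 (7 * P / 2)"
    by (rule hcross_hi_right[where a="1" and k="2" and l="0" and j="1"]; use assms in \<open>simp; linarith\<close>)
  moreover have "0 < hcross P 5 (7 * P / 2 + P * 2)"
    by (rule hcross_lo_right[where a="1" and k="2" and l="0" and j="1"]; use assms in \<open>simp; linarith\<close>)
  moreover have "0 < hcross P 6 (7 * P / 2)"
    by (rule hcross_lo_left[where a="2" and k="2" and l="2" and j="1"]; use assms in \<open>simp; linarith\<close>)
  moreover have "0 < hcross P 6 (7 * P / 2 + P * 2)"
    by (rule hcross_lo_left[where a="2" and k="2" and l="2" and j="1"]; use assms in \<open>simp; linarith\<close>)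
  moreover have "0 < hcross P 7 (7 * P / 2)"
    by (rule hcross_hi_right[where a="2" and k="2" and l="1" and j="1"]; use assms in \<open>simp; linarith\<close>)
  moreover have "0 < hcross P 7 (7 * P / 2 + P * 2)"
    by (rule hcross_lo_right[where a="2" and k="2" and l="1" and j="1"]; use assms in \<open>simp; linarith\<close>)
  moreover have "0 < vcross P 5 (7 * P / 2 + P * (0 + 1 / 2))"
    by (rule vcross_hi[where a="1" and k="0" and l="2" and j="1"]; use assms in \<open>simp; linarith\<close>)
  moreover have "0 < vcross P 8 (7 * P / 2 + P * (0 + 1 / 2))"
    by (rule vcross_hi[where a="3" and k="1" and l="2" and j="1"]; use assms in \<open>simp; linarith\<close>)
  moreover have "0 < vcross P 5 (7 * P / 2 + P * (1 + 1 / 2))"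
    by (rule vcross_lo[where a="1" and k="0" and l="2" and j="1"]; use assms in \<open>simp; linarith\<close>)
  moreover have "0 < vcross P 8 (7 * P / 2 + P * (1 + 1 / 2))"
    by (rule vcross_lo[where a="3" and k="1" and l="2" and j="1"]; use assms in \<open>simp; linarith\<close>)
  moreover have "vcross P 6 (7 * P / 2 + P * (0 + 1 / 2)) < 0"
    by (rule vcross_hi_lo[where a="2" and k="0" and l="2" and j="1"]; use assms in \<open>simp; linarith\<close>)
  ultimately show ?thesis
    by (intro isolating_box_3x2I; simp)
qed

lemma isolating_box_4:
  assumes "2/5 < P" "P < 6/13"
  shows "isolating_box P 2 2 2 3 0 (P / 2)"
proof -
  have "0 < hcross P 2 (P / 2)"
    by (rule hcross_lo_right[where a="0" and k="1" and l="0" and j="0"]; use assms in \<open>simp; linarith\<close>)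
  moreover have "0 < hcross P 2 (P / 2 + P * 2)"
    by (rule hcross_hi_right[where a="0" and k="1" and l="0" and j="1"]; use assms in \<open>simp; linarith\<close>)
  moreover have "0 < hcross P 3 (P / 2)"
    by (rule hcross_lo_left[where a="1" and k="1" and l="1" and j="0"]; use assms in \<open>simp; linarith\<close>)
  moreover have "0 < hcross P 3 (P / 2 + P * 2)"
    by (rule hcross_hi_left[where a="1" and k="1" and l="1" and j="1"]; use assms in \<open>simp; linarith\<close>)
  moreover have "0 < vcross P 2 (P / 2 + P * (0 + 1 / 2))"
    by (rule vcross_lo[where a="0" and k="0" and l="1" and j="0"]; use assms in \<open>simp; linarith\<close>)
  moreover have "0 < vcross P 4 (P / 2 + P * (0 + 1 / 2))"
    by (rule vcross_hi[where a="1" and k="0" and l="1" and j="0"]; use assms in \<open>simp; linarith\<close>)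
  moreover have "0 < vcross P 2 (P / 2 + P * (1 + 1 / 2))"
    by (rule vcross_hi[where a="0" and k="0" and l="1" and j="0"]; use assms in \<open>simp; linarith\<close>)
  moreover have "0 < vcross P 4 (P / 2 + P * (1 + 1 / 2))"
    by (rule vcross_hi[where a="1" and k="0" and l="1" and j="0"]; use assms in \<open>simp; linarith\<close>)
  moreover have "vcross P 3 (P / 2 + P * (0 + 1 / 2)) < 0"
    by (rule vcross_hi_lo[where a="1" and k="0" and l="1" and j="0"]; use assms in \<open>simp; linarith\<close>)
  ultimately show ?thesis
    by (intro isolating_box_2x2I; simp)
qed

lemma isolating_box_5:
  assumes "6/13 < P" "P < 1/2"
  shows "isolating_box P 2 2 2 3 0 (3 / 4 + P / 2)"
proof -
  have "0 < hcross P 2 (3 / 4 + P / 2)"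
    by (rule hcross_hi_right[where a="0" and k="1" and l="0" and j="0"]; use assms in \<open>simp; linarith\<close>)
  moreover have "0 < hcross P 2 (3 / 4 + P / 2 + P * 2)"
    by (rule hcross_lo_right[where a="0" and k="1" and l="0" and j="1"]; use assms in \<open>simp; linarith\<close>)
  moreover have "0 < hcross P 3 (3 / 4 + P / 2)"
    by (rule hcross_hi_left[where a="1" and k="1" and l="1" and j="0"]; use assms in \<open>simp; linarith\<close>)
  moreover have "0 < hcross P 3 (3 / 4 + P / 2 + P * 2)"
    by (rule hcross_lo_left[where a="1" and k="1" and l="1" and j="1"]; use assms in \<open>simp; linarith\<close>)
  moreover have "0 < vcross P 2 (3 / 4 + P / 2 + P * (0 + 1 / 2))"
    by (rule vcross_hi[where a="0" and k="0" and l="1" and j="1"]; use assms in \<open>simp; linarith\<close>)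
  moreover have "0 < vcross P 4 (3 / 4 + P / 2 + P * (0 + 1 / 2))"
    by (rule vcross_hi[where a="1" and k="0" and l="2" and j="1"]; use assms in \<open>simp; linarith\<close>)
  moreover have "0 < vcross P 2 (3 / 4 + P / 2 + P * (1 + 1 / 2))"
    by (rule vcross_lo[where a="0" and k="0" and l="1" and j="1"]; use assms in \<open>simp; linarith\<close>)
  moreover have "0 < vcross P 4 (3 / 4 + P / 2 + P * (1 + 1 / 2))"
    by (rule vcross_hi[where a="1" and k="0" and l="2" and j="1"]; use assms in \<open>simp; linarith\<close>)
  moreover have "vcross P 3 (3 / 4 + P / 2 + P * (0 + 1 / 2)) < 0"
    by (rule vcross_hi_lo[where a="1" and k="0" and l="1" and j="1"]; use assms in \<open>simp; linarith\<close>)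
  ultimately show ?thesis
    by (intro isolating_box_2x2I; simp)
qed

lemma isolating_box_6:
  assumes "1/2 < P" "P < 27/50"
  shows "isolating_box P 4 2 2 5 0 (3 / 4 + 5 * P / 2)"
proof -
  have "0 < hcross P 4 (3 / 4 + 5 * P / 2)"
    by (rule hcross_lo_left[where a="2" and k="2" and l="2" and j="1"]; use assms in \<open>simp; linarith\<close>)
  moreover have "0 < hcross P 4 (3 / 4 + 5 * P / 2 + P * 2)"
    by (rule hcross_hi_left[where a="2" and k="2" and l="2" and j="2"]; use assms in \<open>simp; linarith\<close>)
  moreover have "0 < hcross P 5 (3 / 4 + 5 * P / 2)"
    by (rule hcross_lo_right[where a="2" and k="2" and l="1" and j="1"]; use assms in \<open>simp; linarith\<close>)
  moreover have "0 < hcross P 5 (3 / 4 + 5 * P / 2 + P * 2)"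
    by (rule hcross_hi_right[where a="2" and k="2" and l="1" and j="2"]; use assms in \<open>simp; linarith\<close>)
  moreover have "0 < vcross P 4 (3 / 4 + 5 * P / 2 + P * (0 + 1 / 2))"
    by (rule vcross_hi[where a="2" and k="1" and l="1" and j="1"]; use assms in \<open>simp; linarith\<close>)
  moreover have "0 < vcross P 6 (3 / 4 + 5 * P / 2 + P * (0 + 1 / 2))"
    by (rule vcross_lo[where a="3" and k="1" and l="2" and j="1"]; use assms in \<open>simp; linarith\<close>)
  moreover have "0 < vcross P 4 (3 / 4 + 5 * P / 2 + P * (1 + 1 / 2))"
    by (rule vcross_hi[where a="2" and k="1" and l="1" and j="1"]; use assms in \<open>simp; linarith\<close>)
  moreover have "0 < vcross P 6 (3 / 4 + 5 * P / 2 + P * (1 + 1 / 2))"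
    by (rule vcross_hi[where a="3" and k="1" and l="2" and j="1"]; use assms in \<open>simp; linarith\<close>)
  moreover have "vcross P 5 (3 / 4 + 5 * P / 2 + P * (0 + 1 / 2)) < 0"
    by (rule vcross_hi_lo[where a="2" and k="1" and l="2" and j="1"]; use assms in \<open>simp; linarith\<close>)
  ultimately show ?thesis
    by (intro isolating_box_2x2I; simp)
qed

lemma isolating_box_7:
  assumes "8/15 < P" "P < 6/11"
  shows "isolating_box P 4 2 2 5 0 (3 * P / 2)"
proof -
  have "0 < hcross P 4 (3 * P / 2)"
    by (rule hcross_hi_left[where a="2" and k="2" and l="2" and j="0"]; use assms in \<open>simp; linarith\<close>)
  moreover have "0 < hcross P 4 (3 * P / 2 + P * 2)"
    by (rule hcross_lo_left[where a="2" and k="2" and l="2" and j="1"]; use assms in \<open>simp; linarith\<close>)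
  moreover have "0 < hcross P 5 (3 * P / 2)"
    by (rule hcross_hi_right[where a="2" and k="2" and l="1" and j="0"]; use assms in \<open>simp; linarith\<close>)
  moreover have "0 < hcross P 5 (3 * P / 2 + P * 2)"
    by (rule hcross_lo_right[where a="2" and k="2" and l="1" and j="1"]; use assms in \<open>simp; linarith\<close>)
  moreover have "0 < vcross P 4 (3 * P / 2 + P * (0 + 1 / 2))"
    by (rule vcross_hi[where a="2" and k="1" and l="1" and j="1"]; use assms in \<open>simp; linarith\<close>)
  moreover have "0 < vcross P 6 (3 * P / 2 + P * (0 + 1 / 2))"
    by (rule vcross_hi[where a="3" and k="1" and l="2" and j="1"]; use assms in \<open>simp; linarith\<close>)
  moreover have "0 < vcross P 4 (3 * P / 2 + P * (1 + 1 / 2))"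
    by (rule vcross_hi[where a="2" and k="1" and l="1" and j="1"]; use assms in \<open>simp; linarith\<close>)
  moreover have "0 < vcross P 6 (3 * P / 2 + P * (1 + 1 / 2))"
    by (rule vcross_lo[where a="3" and k="1" and l="2" and j="1"]; use assms in \<open>simp; linarith\<close>)
  moreover have "vcross P 5 (3 * P / 2 + P * (0 + 1 / 2)) < 0"
    by (rule vcross_hi_lo[where a="2" and k="1" and l="2" and j="1"]; use assms in \<open>simp; linarith\<close>)
  ultimately show ?thesis
    by (intro isolating_box_2x2I; simp)
qed

lemma isolating_box_8:
  assumes "6/11 < P" "P < 5/9"
  shows "isolating_box P 9 2 2 10 0 1"
proof -
  have "0 < hcross P 9 1"
    by (rule hcross_hi_right[where a="4" and k="4" and l="1" and j="1"]; use assms in \<open>simp; linarith\<close>)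
  moreover have "0 < hcross P 9 (1 + P * 2)"
    by (rule hcross_lo_right[where a="4" and k="4" and l="1" and j="1"]; use assms in \<open>simp; linarith\<close>)
  moreover have "0 < hcross P 10 1"
    by (rule hcross_hi_right[where a="5" and k="4" and l="2" and j="1"]; use assms in \<open>simp; linarith\<close>)
  moreover have "0 < hcross P 10 (1 + P * 2)"
    by (rule hcross_lo_right[where a="5" and k="4" and l="2" and j="1"]; use assms in \<open>simp; linarith\<close>)
  moreover have "0 < vcross P 9 (1 + P * (0 + 1 / 2))"
    by (rule vcross_hi[where a="4" and k="1" and l="4" and j="1"]; use assms in \<open>simp; linarith\<close>)
  moreover have "0 < vcross P 11 (1 + P * (0 + 1 / 2))"
    by (rule vcross_hi[where a="6" and k="2" and l="4" and j="1"]; use assms in \<open>simp; linarith\<close>)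
  moreover have "0 < vcross P 9 (1 + P * (1 + 1 / 2))"
    by (rule vcross_lo[where a="4" and k="1" and l="4" and j="1"]; use assms in \<open>simp; linarith\<close>)
  moreover have "0 < vcross P 11 (1 + P * (1 + 1 / 2))"
    by (rule vcross_lo[where a="6" and k="2" and l="4" and j="1"]; use assms in \<open>simp; linarith\<close>)
  moreover have "vcross P 10 (1 + P * (0 + 1 / 2)) < 0"
    by (rule vcross_hi_lo[where a="5" and k="2" and l="4" and j="1"]; use assms in \<open>auto simp: abs_if\<close>)
  ultimately show ?thesis
    by (intro isolating_box_2x2I; simp)
qed

lemma isolating_box_9:
  assumes "5/9 < P" "P < 4/7"
  shows "isolating_box P 5 2 2 6 0 0"
proof -
  have "0 < hcross P 5 0"
    by (rule hcross_lo_right[where a="2" and k="2" and l="1" and j="0"]; use assms in \<open>simp; linarith\<close>)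
  moreover have "0 < hcross P 5 (0 + P * 2)"
    by (rule hcross_hi_right[where a="2" and k="2" and l="1" and j="1"]; use assms in \<open>simp; linarith\<close>)
  moreover have "0 < hcross P 6 0"
    by (rule hcross_lo_left[where a="3" and k="3" and l="3" and j="0"]; use assms in \<open>simp; linarith\<close>)
  moreover have "0 < hcross P 6 (0 + P * 2)"
    by (rule hcross_hi_left[where a="3" and k="3" and l="3" and j="1"]; use assms in \<open>simp; linarith\<close>)
  moreover have "0 < vcross P 5 (0 + P * (0 + 1 / 2))"
    by (rule vcross_lo[where a="2" and k="1" and l="2" and j="0"]; use assms in \<open>simp; linarith\<close>)
  moreover have "0 < vcross P 7 (0 + P * (0 + 1 / 2))"
    by (rule vcross_lo[where a="3" and k="1" and l="3" and j="0"]; use assms in \<open>simp; linarith\<close>)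
  moreover have "0 < vcross P 5 (0 + P * (1 + 1 / 2))"
    by (rule vcross_hi[where a="2" and k="1" and l="2" and j="0"]; use assms in \<open>simp; linarith\<close>)
  moreover have "0 < vcross P 7 (0 + P * (1 + 1 / 2))"
    by (rule vcross_lo[where a="3" and k="1" and l="3" and j="0"]; use assms in \<open>simp; linarith\<close>)
  moreover have "vcross P 6 (0 + P * (0 + 1 / 2)) < 0"
    by (rule vcross_lo_hi[where a="3" and k="1" and l="2" and j="0"]; use assms in \<open>simp; linarith\<close>)
  ultimately show ?thesis
    by (intro isolating_box_2x2I; simp)
qed

text \<open>This is the box used for \<open>P > 2/3\<close> with \<open>m = 0\<close>, continued to
  smaller \<open>P\<close>: the phase \<open>-1 - 3 * P / 2\<close> gives the middle height the
  phase 1 modulo 2.\<close>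

lemma isolating_box_10:
  assumes "4/7 < P" "P < 2/3"
  shows "isolating_box P 0 3 3 1 0 (-1 - 3 * P / 2)"
proof -
  have "0 < hcross P 0 (-1 - 3 * P / 2)"
    by (rule hcross_lo_left[where a="0" and k="0" and l="0" and j="-1"]; use assms in \<open>simp; linarith\<close>)
  moreover have "0 < hcross P 0 (-1 - 3 * P / 2 + P * 3)"
    by (rule hcross_lo_left[where a="0" and k="0" and l="0" and j="0"]; use assms in \<open>simp; linarith\<close>)
  moreover have "0 < hcross P 1 (-1 - 3 * P / 2)"
    by (rule hcross_lo_right[where a="0" and k="1" and l="0" and j="-1"]; use assms in \<open>simp; linarith\<close>)
  moreover have "0 < hcross P 1 (-1 - 3 * P / 2 + P * 3)"
    by (rule hcross_lo_right[where a="0" and k="1" and l="0" and j="0"]; use assms in \<open>simp; linarith\<close>)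
  moreover have "0 < hcross P 2 (-1 - 3 * P / 2)"
    by (rule hcross_lo_left[where a="1" and k="1" and l="1" and j="-1"]; use assms in \<open>simp; linarith\<close>)
  moreover have "0 < hcross P 2 (-1 - 3 * P / 2 + P * 3)"
    by (rule hcross_lo_left[where a="1" and k="1" and l="1" and j="0"]; use assms in \<open>simp; linarith\<close>)
  moreover have "0 < vcross P 0 (-1 - 3 * P / 2 + P * (0 + 1 / 2))"
    by (rule vcross_lo[where a="0" and k="0" and l="0" and j="-1"]; use assms in \<open>simp; linarith\<close>)
  moreover have "0 < vcross P 3 (-1 - 3 * P / 2 + P * (0 + 1 / 2))"
    by (rule vcross_hi[where a="1" and k="0" and l="1" and j="-1"]; use assms in \<open>simp; linarith\<close>)
  moreover have "0 < vcross P 0 (-1 - 3 * P / 2 + P * (1 + 1 / 2))"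
    by (rule vcross_hi[where a="0" and k="0" and l="0" and j="0"]; use assms in \<open>simp; linarith\<close>)
  moreover have "0 < vcross P 3 (-1 - 3 * P / 2 + P * (1 + 1 / 2))"
    by (rule vcross_hi[where a="1" and k="0" and l="1" and j="0"]; use assms in \<open>simp; linarith\<close>)
  moreover have "0 < vcross P 0 (-1 - 3 * P / 2 + P * (2 + 1 / 2))"
    by (rule vcross_lo[where a="0" and k="0" and l="0" and j="0"]; use assms in \<open>simp; linarith\<close>)
  moreover have "0 < vcross P 3 (-1 - 3 * P / 2 + P * (2 + 1 / 2))"
    by (rule vcross_hi[where a="1" and k="0" and l="1" and j="0"]; use assms in \<open>simp; linarith\<close>)
  moreover have "vcross P 1 (-1 - 3 * P / 2 + P * (0 + 1 / 2)) < 0"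
    by (rule vcross_lo_hi[where a="0" and k="0" and l="0" and j="-1"]; use assms in \<open>simp; linarith\<close>)
  ultimately show ?thesis
    by (intro isolating_box_3x3I; simp)
qed

text \<open>For \<open>P < 1/3\<close> the box is placed around the first column \<open>m\<close> with \<open>P m \<ge> 1/2\<close>.\<close>

lemma isolating_box_shallow_1:
  fixes P g :: real
  assumes "0 < g" "g < P" "P < 1 / 3" "1 \<le> m" and m: "2 * (P * of_int m) = 1 + g"
  shows "isolating_box P (m - 1) 2 2 m 0 0"
proof -
  have m': "P * of_int m = (1 + g) / 2" using m by simp
  note f = assms(1-4) m'
  have "0 < hcross P (m - 1) 0"
    by (rule hcross_lo_left[where a=0 and k=0 and l=0 and j=0]; use f in \<open>simp add: algebra_simps\<close>)
  moreover have "0 < hcross P (m - 1) (0 + P * 2)"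
    by (rule hcross_hi_left[where a=0 and k=0 and l=0 and j=0]; use f in \<open>simp add: algebra_simps\<close>)
  moreover have "0 < hcross P m 0"
    by (rule hcross_lo_left[where a=0 and k=1 and l=1 and j=0]; use f in \<open>simp add: algebra_simps\<close>)
  moreover have "0 < hcross P m (0 + P * 2)"
    by (rule hcross_hi_left[where a=0 and k=1 and l=1 and j=0]; use f in \<open>simp add: algebra_simps\<close>)
  moreover have "0 < vcross P (m - 1) (0 + P * (0 + 1 / 2))"
    by (rule vcross_lo[where a=0 and k=0 and l=0 and j=0]; use f in \<open>simp add: algebra_simps\<close>)
  moreover have "0 < vcross P (m - 1) (0 + P * (1 + 1 / 2))"
    by (rule vcross_lo[where a=0 and k=0 and l=0 and j=0]; use f in \<open>simp add: algebra_simps\<close>)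
  moreover have "0 < vcross P (m + 1) (0 + P * (0 + 1 / 2))"
    by (rule vcross_lo[where a=0 and k=0 and l=1 and j=0]; use f in \<open>simp add: algebra_simps\<close>)
  moreover have "0 < vcross P (m + 1) (0 + P * (1 + 1 / 2))"
    by (rule vcross_lo[where a=0 and k=0 and l=1 and j=0]; use f in \<open>simp add: algebra_simps\<close>)
  \<comment> \<open>The far crossing \<open>P * (2 * m - 1 / 2) = 1 + g - P / 2\<close> has distance
    \<open>1 - \<bar>g - P / 2\<bar>\<close> from the even integers. This exceeds
    \<open>1 - P / 2\<close> exactly for \<open>0 < g < P\<close>, which is where the condition on
    \<open>g\<close> comes from.\<close>
  moreover have "vcross P m (0 + P * (0 + 1 / 2)) < 0"
  proof (cases "g \<le> P / 2")
    case True
    show ?thesis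
      by (rule vcross_lo_hi[where a=0 and k=0 and l=0 and j=0]; use f True in \<open>simp add: algebra_simps\<close>)
  next
    case False
    show ?thesis
      by (rule vcross_lo_hi[where a=0 and k=0 and l=1 and j=0]; use f False in \<open>simp add: algebra_simps\<close>)
  qed
  ultimately show ?thesis
    by (intro isolating_box_2x2I; simp add: algebra_simps)
qed

text \<open>Raising the bottom phase from 0 to \<open>P\<close> raises that of the good edge to
  \<open>3 * P / 2\<close>, so that \<open>1 - (g - P / 2)\<close> passes the threshold as long as
  \<open>g < 2 * P\<close>. The bound \<open>P < 1/4\<close> keeps
  \<open>P * (m + 1) = (1 + g) / 2 + P\<close> below 1, hence the floor 0 in all columns of the
  box.\<close>

lemma isolating_box_shallow_2:
  fixes P g :: real
  assumes "P < g" "g < 2 * P" "0 < P" "P < 1 / 4" "2 \<le> m" and m: "2 * (P * of_int m) = 1 + g"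
  shows "isolating_box P (m - 2) 3 2 m 0 P"
proof -
  have m': "P * of_int m = (1 + g) / 2" using m by simp
  note f = assms(1-5) m'
  have "0 < hcross P (m - 2) P"
    by (rule hcross_lo_left[where a=0 and k=0 and l=0 and j=0]; use f in \<open>simp add: algebra_simps\<close>)
  moreover have "0 < hcross P (m - 2) (P + P * 2)"
    by (rule hcross_hi_left[where a=0 and k=0 and l=0 and j=0]; use f in \<open>simp add: algebra_simps\<close>)
  moreover have "0 < hcross P (m - 1) P"
    by (rule hcross_hi_left[where a=0 and k=0 and l=1 and j=0]; use f in \<open>simp add: algebra_simps\<close>)
  moreover have "0 < hcross P (m - 1) (P + P * 2)"
    by (rule hcross_hi_left[where a=0 and k=0 and l=1 and j=0]; use f in \<open>simp add: algebra_simps\<close>)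
  moreover have "0 < hcross P m P"
    by (rule hcross_lo_left[where a=0 and k=1 and l=1 and j=0]; use f in \<open>simp add: algebra_simps\<close>)
  moreover have "0 < hcross P m (P + P * 2)"
    by (rule hcross_hi_left[where a=0 and k=1 and l=1 and j=0]; use f in \<open>simp add: algebra_simps\<close>)
  moreover have "0 < vcross P (m - 2) (P + P * (0 + 1 / 2))"
    by (rule vcross_lo[where a=0 and k=0 and l=0 and j=0]; use f in \<open>simp add: algebra_simps\<close>)
  moreover have "0 < vcross P (m - 2) (P + P * (1 + 1 / 2))"
    by (rule vcross_lo[where a=0 and k=0 and l=0 and j=0]; use f in \<open>simp add: algebra_simps\<close>)
  moreover have "0 < vcross P (m + 1) (P + P * (0 + 1 / 2))"
    by (rule vcross_lo[where a=0 and k=0 and l=1 and j=0]; use f in \<open>simp add: algebra_simps\<close>)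
  moreover have "0 < vcross P (m + 1) (P + P * (1 + 1 / 2))"
    by (rule vcross_lo[where a=0 and k=0 and l=1 and j=0]; use f in \<open>simp add: algebra_simps\<close>)
  moreover have "vcross P m (P + P * (0 + 1 / 2)) < 0"
    by (rule vcross_lo_hi[where a=0 and k=0 and l=1 and j=0]; use f in \<open>simp add: algebra_simps\<close>)
  ultimately show ?thesis
    by (intro isolating_box_3x2I; simp add: algebra_simps)
qed

section \<open>Parameters close to 1\<close>

text \<open>As long as \<open>(1 - P) * m < 1\<close>, the floor of \<open>P * m\<close> is
  \<open>m - 1\<close> for \<open>m \<ge> 1\<close>, so the edge meets the lines \<open>m\<close>
  and \<open>m + 1\<close> relative to its row. Column 0 has floor 0 and leads to the same
  product.\<close>

lemma hcross_steep:
  assumes "0 < P" "P < 1" "0 \<le> m" "(1 - P) * (of_int m + 1) < 1"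
  shows "hcross P m u = tgap u (P * of_int m) * tgap u (P * (of_int m + 1))"
proof (cases "m = 0")
  case True
  thus ?thesis using hcross_left[of 0 P 0 u] assms(1,2) by (simp add: tgap_def)
next
  case False
  hence "1 \<le> real_of_int m" using assms(3) by linarith
  hence "(1 - P) * 1 \<le> (1 - P) * of_int m" using assms(2) by (intro mult_left_mono) auto
  thus ?thesis using hcross_right[of "m - 1" P m u] assms by (simp add: algebra_simps)
qed

lemma vcross_steep:
  assumes "0 < P" "P < 1" "0 \<le> m" "(1 - P) * of_int m < 1"
  shows "vcross P m u = tgap u (P * (of_int m - 1 / 2)) * tgap u (P * (of_int m + 1 / 2))"
proof (cases "m = 0")
  case True
  thus ?thesis using vcross_eq[of 0 P 0 u] by simp
next
  case False
  hence "1 \<le> real_of_int m" using assms(3) by linarith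
  hence "(1 - P) * 1 \<le> (1 - P) * of_int m" using assms(2) by (intro mult_left_mono) auto
  hence "vcross P m u = tgap u (P * (of_int (m - 1) + 1 / 2)) * tgap u (P * (of_int (2 * m - (m - 1)) - 1 / 2))"
    using assms by (intro vcross_eq) (simp_all add: algebra_simps)
  thus ?thesis by (simp add: add.commute)
qed

lemma nrm_plus: "x = 2 * of_int k + c \<Longrightarrow> 0 \<le> c \<Longrightarrow> c \<le> 1 \<Longrightarrow> nrm x = c"
  using nrm_eq[of x k] by simp

lemma nrm_minus: "x = 2 * of_int k - c \<Longrightarrow> 0 \<le> c \<Longrightarrow> c \<le> 1 \<Longrightarrow> nrm x = c"
  using nrm_eq[of x k] by simp

text \<open>For \<open>P = 1 - R\<close> close to 1 the box is centered at the column where \<open>R x\<close> is closest to \<open>1/2\<close>. Since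
  \<open>P x \<equiv> x - R x\<close>, the parity of \<open>m\<close> replaces all distances \<open>c\<close> to \<open>2\<int>\<close> by \<open>1 - c\<close>; this is the role of \<open>\<sigma>\<close>.\<close>

lemma isolating_box_steep_values:
  fixes P R e :: real and \<sigma> :: "real \<Rightarrow> real"
  assumes P: "P = 1 - R" and R: "0 < R" "R < 1 / 3" and e: "- R / 2 \<le> e" "e \<le> R / 2"
    and m: "0 \<le> m" "R * (of_int m + 3) < 1"
    and \<sigma>: "\<sigma> = id \<or> \<sigma> = (\<lambda>x. 1 - x)"
    and c: "nrm (P * of_int m) = \<sigma> (1 / 2 + e - 3 * R / 2)" "nrm (P * (of_int m + 1)) = \<sigma> (1 / 2 - e + R / 2)"
      "nrm (P * (of_int m + 2)) = \<sigma> (1 / 2 + e + R / 2)" "nrm (P * (of_int m + 3)) = \<sigma> (1 / 2 - e - 3 * R / 2)"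
    and d: "nrm (P * (of_int m - 1 / 2)) = \<sigma> (1 - 2 * R + e)" "nrm (P * (of_int m + 1 / 2)) = \<sigma> (R - e)"
      "nrm (P * (of_int m + 3 / 2)) = \<sigma> (1 - \<bar>e\<bar>)"
      "nrm (P * (of_int m + 5 / 2)) = \<sigma> (R + e)" "nrm (P * (of_int m + 7 / 2)) = \<sigma> (1 - 2 * R - e)"
    and h: "nrm u = \<sigma> (1 / 2 - 3 * R / 2)" "nrm (u + P * 3) = \<sigma> (1 / 2 - 3 * R / 2)"
    and v: "nrm (u + P * (0 + 1 / 2)) = \<sigma> R" "nrm (u + P * (1 + 1 / 2)) = \<sigma> 1" "nrm (u + P * (2 + 1 / 2)) = \<sigma> R"
  shows "isolating_box P m 3 3 (m + 1) 0 u"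
proof -
  have P01: "0 < P" "P < 1" using P R by auto
  have R_mono: "R * x < 1" if "x \<le> of_int m + 3" for x
    using that m(2) R(1) by (smt (verit) mult_left_mono)
  have hs: "hcross P (m + i) w = tgap w (P * (of_int m + of_int i)) * tgap w (P * (of_int m + of_int i + 1))"
    if "0 \<le> i" "i \<le> 2" for i w
    using hcross_steep[of P "m + i" w] P01 m(1) that R_mono[of "of_int m + of_int i + 1"] by (simp add: P)
  have vs: "vcross P (m + i) w = tgap w (P * (of_int m + of_int i - 1 / 2)) * tgap w (P * (of_int m + of_int i + 1 / 2))"
    if "0 \<le> i" "i \<le> 3" for i w
    using vcross_steep[of P "m + i" w] P01 m(1) that R_mono[of "of_int m + of_int i"] by (simp add: P)
  have h0: "hcross P m w = tgap w (P * of_int m) * tgap w (P * (of_int m + 1))" for w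
    using hs[of 0 w] by simp
  have h1: "hcross P (m + 1) w = tgap w (P * (of_int m + 1)) * tgap w (P * (of_int m + 2))" for w
    using hs[of 1 w] by (simp add: add.assoc)
  have h2: "hcross P (m + 2) w = tgap w (P * (of_int m + 2)) * tgap w (P * (of_int m + 3))" for w
    using hs[of 2 w] by (simp add: add.assoc)
  have v0: "vcross P m w = tgap w (P * (of_int m - 1 / 2)) * tgap w (P * (of_int m + 1 / 2))" for w
    using vs[of 0 w] by simp
  have v1: "vcross P (m + 1) w = tgap w (P * (of_int m + 1 / 2)) * tgap w (P * (of_int m + 3 / 2))" for w
  proof -
    have "real_of_int m + 1 - 1 / 2 = of_int m + 1 / 2" "real_of_int m + 1 + 1 / 2 = of_int m + 3 / 2" by simp_all
    thus ?thesis using vs[of 1 w] by (simp add: add.commute)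
  qed
  have v3: "vcross P (m + 3) w = tgap w (P * (of_int m + 5 / 2)) * tgap w (P * (of_int m + 7 / 2))" for w
  proof -
    have "real_of_int m + 3 - 1 / 2 = of_int m + 5 / 2" "real_of_int m + 3 + 1 / 2 = of_int m + 7 / 2" by simp_all
    thus ?thesis using vs[of 3 w] by (simp add: add.commute)
  qed
  from \<sigma> show ?thesis
  proof
    assume s: "\<sigma> = id"
    show ?thesis
      by (rule isolating_box_3x3I; unfold h0 h1 h2 v0 v1 v3 of_int_0 tgap_def c d h v s id_def;
          ((rule mult_pos_pos; use R e in linarith) | (rule mult_neg_neg; use R e in linarith)
            | (rule mult_neg_pos; use R e in linarith)))
  next
    \<comment> \<open>Replacing both distances by their complements to 1 reverses the sign of every
      \<open>tgap\<close>, so all products keep their signs; on the good edge the two signs trade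
      places.\<close>
    assume s: "\<sigma> = (\<lambda>x. 1 - x)"
    show ?thesis
      by (rule isolating_box_3x3I; unfold h0 h1 h2 v0 v1 v3 of_int_0 tgap_def c d h v s;
          ((rule mult_pos_pos; use R e in linarith) | (rule mult_neg_neg; use R e in linarith)
            | (rule mult_pos_neg; use R e in linarith)))
  qed
qed

text \<open>\<open>e\<close> is the offset of the central column:
  \<open>R * (m + 3/2) = 1/2 + e\<close>. The phase \<open>u\<close> is chosen so that the middle
  height \<open>u + 3 * P / 2\<close> is 1 for even \<open>m\<close> and 2 for odd \<open>m\<close>,
  which makes the box symmetric under reflection in its middle height.\<close>

lemma isolating_box_steep:
  fixes P R e :: real
  assumes P: "P = 1 - R" and R: "0 < R" "R < 1 / 3" and e: "- R / 2 \<le> e" "e \<le> R / 2"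
    and m: "0 \<le> m" "R * (of_int m + 3) < 1" and Rm: "R * of_int m = 1 / 2 + e - 3 * R / 2"
  shows "\<exists>u. isolating_box P m 3 3 (m + 1) 0 u"
proof (cases "even m")
  case True
  then obtain s where s: "m = 2 * s" by auto
  hence ms: "real_of_int m = 2 * of_int s" by simp
  have Rm0: "0 \<le> R * of_int m" using R m by simp
  have Pm: "P * (of_int m + x) = of_int m + x - (1 / 2 + e - 3 * R / 2) - R * x" for x
    unfolding P using Rm by (simp add: algebra_simps)
  have m3: "1 / 2 + e + 3 * R / 2 < 1" using m(2) Rm by (simp add: algebra_simps)
  note f = R e Rm0 Rm m3
  have "isolating_box P m 3 3 (m + 1) 0 (- 1 / 2 + 3 * R / 2)"
  proof (rule isolating_box_steep_values[OF P R e m, of id])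
    show "nrm (P * of_int m) = id (1 / 2 + e - 3 * R / 2)"
      using Pm[of 0] f ms by (intro nrm_minus[of _ s]) simp_all
    show "nrm (P * (of_int m + 1)) = id (1 / 2 - e + R / 2)"
      using Pm[of 1] f ms by (intro nrm_plus[of _ s]) simp_all
    show "nrm (P * (of_int m + 2)) = id (1 / 2 + e + R / 2)"
      using Pm[of 2] f ms by (intro nrm_minus[of _ "s + 1"]) simp_all
    show "nrm (P * (of_int m + 3)) = id (1 / 2 - e - 3 * R / 2)"
      using Pm[of 3] f ms by (intro nrm_plus[of _ "s + 1"]) simp_all
    show "nrm (P * (of_int m - 1 / 2)) = id (1 - 2 * R + e)"
      using Pm[of "- 1 / 2"] f ms by (intro nrm_minus[of _ s]) simp_all
    show "nrm (P * (of_int m + 1 / 2)) = id (R - e)"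
      using Pm[of "1 / 2"] f ms by (intro nrm_plus[of _ s]) simp_all
    show "nrm (P * (of_int m + 3 / 2)) = id (1 - \<bar>e\<bar>)"
    proof (cases "0 \<le> e")
      case True
      thus ?thesis using Pm[of "3 / 2"] f ms by (intro nrm_plus[of _ s]) simp_all
    next
      case False
      thus ?thesis using Pm[of "3 / 2"] f ms by (intro nrm_minus[of _ "s + 1"]) simp_all
    qed
    show "nrm (P * (of_int m + 5 / 2)) = id (R + e)"
      using Pm[of "5 / 2"] f ms by (intro nrm_minus[of _ "s + 1"]) simp_all
    show "nrm (P * (of_int m + 7 / 2)) = id (1 - 2 * R - e)"
      using Pm[of "7 / 2"] f ms by (intro nrm_plus[of _ "s + 1"]) simp_all
    show "nrm (- 1 / 2 + 3 * R / 2) = id (1 / 2 - 3 * R / 2)"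
      using f by (intro nrm_minus[of _ 0]) simp_all
    show "nrm (- 1 / 2 + 3 * R / 2 + P * 3) = id (1 / 2 - 3 * R / 2)"
      using f P by (intro nrm_plus[of _ 1]) simp_all
    show "nrm (- 1 / 2 + 3 * R / 2 + P * (0 + 1 / 2)) = id R"
      using f P by (intro nrm_plus[of _ 0]) (simp_all add: field_simps)
    show "nrm (- 1 / 2 + 3 * R / 2 + P * (1 + 1 / 2)) = id 1"
      using f P by (intro nrm_plus[of _ 0]) (simp_all add: field_simps)
    show "nrm (- 1 / 2 + 3 * R / 2 + P * (2 + 1 / 2)) = id R"
      using f P by (intro nrm_minus[of _ 1]) (simp_all add: field_simps)
  qed simp
  thus ?thesis by blast
next
  case False
  then obtain s where s: "m = 2 * s + 1" by (auto elim: oddE)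
  hence ms: "real_of_int m = 2 * of_int s + 1" by simp
  have Rm0: "0 \<le> R * of_int m" using R m by simp
  have Pm: "P * (of_int m + x) = of_int m + x - (1 / 2 + e - 3 * R / 2) - R * x" for x
    unfolding P using Rm by (simp add: algebra_simps)
  have m3: "1 / 2 + e + 3 * R / 2 < 1" using m(2) Rm by (simp add: algebra_simps)
  note f = R e Rm0 Rm m3
  have "isolating_box P m 3 3 (m + 1) 0 (1 / 2 + 3 * R / 2)"
  proof (rule isolating_box_steep_values[OF P R e m, of "\<lambda>x. 1 - x"])
    show "nrm (P * of_int m) = 1 - (1 / 2 + e - 3 * R / 2)"
      using Pm[of 0] f ms by (intro nrm_plus[of _ s]) simp_all
    show "nrm (P * (of_int m + 1)) = 1 - (1 / 2 - e + R / 2)"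
      using Pm[of 1] f ms by (intro nrm_minus[of _ "s + 1"]) simp_all
    show "nrm (P * (of_int m + 2)) = 1 - (1 / 2 + e + R / 2)"
      using Pm[of 2] f ms by (intro nrm_plus[of _ "s + 1"]) simp_all
    show "nrm (P * (of_int m + 3)) = 1 - (1 / 2 - e - 3 * R / 2)"
      using Pm[of 3] f ms by (intro nrm_minus[of _ "s + 2"]) simp_all
    show "nrm (P * (of_int m - 1 / 2)) = 1 - (1 - 2 * R + e)"
      using Pm[of "- 1 / 2"] f ms by (intro nrm_plus[of _ s]) simp_all
    show "nrm (P * (of_int m + 1 / 2)) = 1 - (R - e)"
      using Pm[of "1 / 2"] f ms by (intro nrm_minus[of _ "s + 1"]) simp_all
    show "nrm (P * (of_int m + 3 / 2)) = 1 - (1 - \<bar>e\<bar>)"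
    proof (cases "0 \<le> e")
      case True
      thus ?thesis using Pm[of "3 / 2"] f ms by (intro nrm_minus[of _ "s + 1"]) simp_all
    next
      case False
      thus ?thesis using Pm[of "3 / 2"] f ms by (intro nrm_plus[of _ "s + 1"]) simp_all
    qed
    show "nrm (P * (of_int m + 5 / 2)) = 1 - (R + e)"
      using Pm[of "5 / 2"] f ms by (intro nrm_plus[of _ "s + 1"]) simp_all
    show "nrm (P * (of_int m + 7 / 2)) = 1 - (1 - 2 * R - e)"
      using Pm[of "7 / 2"] f ms by (intro nrm_minus[of _ "s + 2"]) simp_all
    show "nrm (1 / 2 + 3 * R / 2) = 1 - (1 / 2 - 3 * R / 2)"
      using f by (intro nrm_plus[of _ 0]) simp_all
    show "nrm (1 / 2 + 3 * R / 2 + P * 3) = 1 - (1 / 2 - 3 * R / 2)"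
      using f P by (intro nrm_minus[of _ 2]) simp_all
    show "nrm (1 / 2 + 3 * R / 2 + P * (0 + 1 / 2)) = 1 - R"
      using f P by (intro nrm_minus[of _ 1]) (simp_all add: field_simps)
    show "nrm (1 / 2 + 3 * R / 2 + P * (1 + 1 / 2)) = 1 - 1"
      using f P by (intro nrm_plus[of _ 1]) (simp_all add: field_simps)
    show "nrm (1 / 2 + 3 * R / 2 + P * (2 + 1 / 2)) = 1 - R"
      using f P by (intro nrm_plus[of _ 1]) (simp_all add: field_simps)
  qed simp
  thus ?thesis by blast
qed

lemma not_rat: "P \<notin> \<rat> \<Longrightarrow> P * of_int a \<noteq> of_int b" if "a \<noteq> 0" for P :: real
proof
  assume "P \<notin> \<rat>" "P * of_int a = of_int b"
  hence "P = of_int b / of_int a" using that by (simp add: field_simps)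
  thus False using \<open>P \<notin> \<rat>\<close> by simp
qed

section \<open>A box for every irrational parameter\<close>

lemma isolating_box_exists:
  fixes P :: real
  assumes irr: "P \<notin> \<rat>" and P: "0 < P" "P < 1"
  shows "\<exists>x w h i j u. 0 \<le> x \<and> x \<le> i \<and> i < x + w \<and> 0 \<le> j \<and> j < h \<and> isolating_box P x w h i j u"
proof -
  consider "P < 1 / 3" | "1 / 3 < P" "P < 2 / 3" | "2 / 3 < P"
    using not_rat[of 3 P 1] not_rat[of 3 P 2] irr by force
  thus ?thesis
  proof cases
    case 1
    \<comment> \<open>The least \<open>m\<close> with \<open>P * m \<ge> 1/2\<close>, so that
      \<open>0 \<le> g < 2 * P\<close>; irrationality excludes the values \<open>g = 0\<close> and
      \<open>g = P\<close> between the two kinds of boxes.\<close>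
    define m where "m = \<lceil>1 / (2 * P)\<rceil>"
    define g where "g = 2 * (P * of_int m) - 1"
    have "1 / (2 * P) \<le> of_int m" "of_int m < 1 / (2 * P) + 1" unfolding m_def by linarith+
    hence g: "0 \<le> g" "g < 2 * P" using P by (simp_all add: g_def field_simps)
    have "1 < 1 / (2 * P)" using 1 P by (simp add: field_simps)
    hence "1 < m" unfolding m_def by linarith
    have gm: "2 * (P * of_int m) = 1 + g" by (simp add: g_def)
    have "g \<noteq> 0" using not_rat[of "2 * m" P 1] irr \<open>1 < m\<close> by (auto simp: g_def)
    have "g \<noteq> P"
    proof
      assume "g = P"
      hence "P * of_int (2 * m - 1) = of_int 1" by (simp add: g_def algebra_simps)
      moreover have "2 * m - 1 \<noteq> 0" by presburger
      ultimately show False using not_rat irr by blast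
    qed
    then consider "g < P" | "P < g" by linarith
    thus ?thesis
    proof cases
      case a: 1
      have "isolating_box P (m - 1) 2 2 m 0 0"
        using isolating_box_shallow_1[OF _ a 1 _ gm] g \<open>g \<noteq> 0\<close> \<open>1 < m\<close> by simp
      thus ?thesis using \<open>1 < m\<close> by (intro exI[of _ "m - 1"] exI[of _ 2] exI[of _ m] exI[of _ 0] exI[of _ "0::real"]) simp
    next
      case a: 2
      \<comment> \<open>For \<open>1/4 < P < 1/3\<close> the least \<open>m\<close> is 2, so
        \<open>g = 4 * P - 1\<close>, and \<open>g > P\<close> would give
        \<open>P > 1/3\<close>.\<close>
      have "P < 1 / 4"
      proof (rule ccontr)
        assume "\<not> ?thesis"
        hence "P * 4 \<ge> 1" by simp
        moreover have "P * 4 \<noteq> 1" using not_rat[of 4 P 1] irr by simp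
        ultimately have "1 / (2 * P) < 2" using P by (simp add: field_simps)
        hence "m = 2" using \<open>1 < m\<close> unfolding m_def by linarith
        thus False using a 1 by (simp add: g_def)
      qed
      hence "2 < 1 / (2 * P)" using P by (simp add: field_simps)
      hence "2 < m" unfolding m_def by linarith
      have "isolating_box P (m - 2) 3 2 m 0 P"
        using isolating_box_shallow_2[OF a g(2) P(1) \<open>P < 1 / 4\<close> _ gm] \<open>2 < m\<close> by simp
      thus ?thesis using \<open>2 < m\<close> by (intro exI[of _ "m - 2"] exI[of _ 3] exI[of _ 2] exI[of _ m] exI[of _ 0] exI[of _ P]) simp
    qed
  next
    case 2
    have split: "P < of_int b / of_int a \<or> of_int b / of_int a < P" if "0 < a" for a b :: int
      using not_rat[of a P b] irr that by (cases "P < of_int b / of_int a") (auto simp: field_simps not_less le_less)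
    have splits: "P < 4 / 11 \<or> 4 / 11 < P" "P < 3 / 8 \<or> 3 / 8 < P" "P < 2 / 5 \<or> 2 / 5 < P" "P < 6 / 13 \<or> 6 / 13 < P" "P < 1 / 2 \<or> 1 / 2 < P" "P < 27 / 50 \<or> 27 / 50 < P" "P < 6 / 11 \<or> 6 / 11 < P" "P < 5 / 9 \<or> 5 / 9 < P" "P < 4 / 7 \<or> 4 / 7 < P"
      using split[of 11 4] split[of 8 3] split[of 5 2] split[of 13 6] split[of 2 1] split[of 50 27] split[of 11 6] split[of 9 5] split[of 7 4] by simp_all
    consider "P < 4 / 11" | "4 / 11 < P" "P < 3 / 8" | "3 / 8 < P" "P < 2 / 5" | "2 / 5 < P" "P < 6 / 13"
      | "6 / 13 < P" "P < 1 / 2" | "1 / 2 < P" "P < 27 / 50" | "27 / 50 < P" "P < 6 / 11"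
      | "6 / 11 < P" "P < 5 / 9" | "5 / 9 < P" "P < 4 / 7" | "4 / 7 < P"
      using splits by blast
    thus ?thesis
    proof cases
      case 1
      show ?thesis using isolating_box_1[OF 2(1) 1] by (intro exI conjI) auto
    next
      case 2
      show ?thesis using isolating_box_2[OF 2] by (intro exI conjI) auto
    next
      case 3
      show ?thesis using isolating_box_3[OF 3] by (intro exI conjI) auto
    next
      case 4
      show ?thesis using isolating_box_4[OF 4] by (intro exI conjI) auto
    next
      case 5
      show ?thesis using isolating_box_5[OF 5] by (intro exI conjI) auto
    next
      case 6
      show ?thesis using isolating_box_6[OF 6] by (intro exI conjI) auto
    next
      case 7
      \<comment> \<open>The ranges of boxes 6 and 7 overlap; the cut \<open>27/50\<close> lies in
        the overlap, to the right of \<open>8/15\<close>.\<close>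
      hence lower: "8 / 15 < P" by simp
      show ?thesis using isolating_box_7[OF lower 7(2)] by (intro exI conjI) auto
    next
      case 8
      show ?thesis using isolating_box_8[OF 8] by (intro exI conjI) auto
    next
      case 9
      show ?thesis using isolating_box_9[OF 9] by (intro exI conjI) auto
    next
      case 10
      show ?thesis using isolating_box_10[OF 10 2(2)] by (intro exI conjI) auto
    qed
  next
    case 3
    define R where "R = 1 - P"
    have R: "0 < R" "R < 1 / 3" using P 3 by (simp_all add: R_def)
    \<comment> \<open>This places the central column \<open>m + 3/2\<close> within
      \<open>1/2\<close> of \<open>1 / (2 * R)\<close>, which bounds \<open>e\<close> by
      \<open>R / 2\<close>.\<close>
    define m where "m = \<lfloor>1 / (2 * R)\<rfloor> - 1"
    define e where "e = R * of_int m + 3 * R / 2 - 1 / 2"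
    have f: "of_int m + 1 \<le> 1 / (2 * R)" "1 / (2 * R) < of_int m + 2" unfolding m_def by linarith+
    hence m1: "2 * (R * of_int m) + 2 * R \<le> 1" "1 < 2 * (R * of_int m) + 4 * R"
      using R by (simp_all add: field_simps)
    have "1 < 1 / (2 * R)" using R by (simp add: field_simps)
    hence m0: "0 \<le> m" unfolding m_def by linarith
    \<comment> \<open>For \<open>m \<ge> 1\<close> the choice of \<open>m\<close> gives
      \<open>4 * R \<le> 1\<close>, strictly by irrationality, and
      \<open>R * m + 3 * R \<le> 1/2 + 2 * R\<close>. For \<open>m = 0\<close> the bound
      \<open>R < 1/3\<close> suffices.\<close>
    have m3: "R * (of_int m + 3) < 1"
    proof (cases "m = 0")
      case False
      hence "1 \<le> real_of_int m" using m0 by linarith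
      hence "R * 1 \<le> R * of_int m" using R by (intro mult_left_mono) auto
      moreover have "R * 4 \<noteq> 1" using not_rat[of 4 P 3] irr by (auto simp: R_def)
      ultimately have "R * 4 < 1" using m1 by linarith
      moreover have "R * (of_int m + 3) = R * of_int m + 3 * R" by (simp add: algebra_simps)
      ultimately show ?thesis using m1 by linarith
    qed (use R in simp)
    have "\<exists>u. isolating_box P m 3 3 (m + 1) 0 u"
      by (rule isolating_box_steep[of P R e]) (use R m0 m3 m1 in \<open>simp_all add: R_def[symmetric] e_def, simp_all add: R_def\<close>)
    then obtain u where "isolating_box P m 3 3 (m + 1) 0 u" by blast
    thus ?thesis using m0 by (intro exI[of _ m] exI[of _ 3] exI[of _ "m + 1"] exI[of _ 0] exI[of _ u]) simp
  qed
qed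

section \<open>Polygons in a block\<close>

context plaid
begin

lemma dist_centers: "dist (center m n) (center m' n) = \<bar>of_int m - of_int m'\<bar>"
  by (simp add: center_def dist_prod_def dist_real_def)

lemma block_eq_rect: "block p q A B = box_rect (W * (W * A)) (W * (W * A) + W) (W * B) (W * B + W)"
  unfolding block_def box_rect_def om_W by (auto simp: power2_eq_square mult_ac)

lemma center_in_rect_iff: "center m n \<in> box_rect x0 x1 y0 y1 \<longleftrightarrow> x0 \<le> m \<and> m < x1 \<and> y0 \<le> n \<and> n < y1"
proof -
  have "real_of_int a \<le> of_int b + 1 / 2 \<longleftrightarrow> a \<le> b" "real_of_int b + 1 / 2 \<le> of_int a \<longleftrightarrow> b < a" for a b
    by linarith+
  thus ?thesis by (auto simp: center_def box_rect_def)
qed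

text \<open>The sides of a block lie on lines whose number is divisible by \<open>W\<close>; these
  have capacity 0 and carry no good edges.\<close>

lemma polygon_in_block:
  assumes "center m n \<in> plaid_union p q" "center m n \<in> block p q A B"
  shows "polygon_at p q m n \<subseteq> block p q A B"
  unfolding block_eq_rect
proof (rule polygon_in_rect[OF _ _ assms(1) assms(2)[unfolded block_eq_rect]])
  have d: "W dvd W * (W * A)" "W dvd W * (W * A) + W" "W dvd W * B" "W dvd W * B + W" by simp_all
  show "\<not> good_v p q (W * (W * A)) l \<and> \<not> good_v p q (W * (W * A) + W) l" for l
    using good_v_multiple[OF d(1)] good_v_multiple[OF d(2)] by blast
  show "\<not> good_h p q l (W * B) \<and> \<not> good_h p q l (W * B + W)" for l
    using good_h_multiple[OF d(3)] good_h_multiple[OF d(4)] by blast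
qed

lemma bounded_block: "bounded (block p q A B)"
  unfolding block_eq_rect box_rect_def by (intro bounded_Times) auto

text \<open>\<open>card\<close> is 0 on infinite sets, so finiteness is what turns an injection into
  a lower bound.\<close>

lemma finite_polygons_in_block: "finite {C \<in> plaid_polygons p q. C \<subseteq> block p q A B}"
proof (rule finite_subset)
  show "{C \<in> plaid_polygons p q. C \<subseteq> block p q A B} \<subseteq>
    (\<lambda>(m, n). polygon_at p q m n) ` ({W * (W * A)..<W * (W * A) + W} \<times> {W * B..<W * B + W})"
  proof
    fix C assume "C \<in> {C \<in> plaid_polygons p q. C \<subseteq> block p q A B}"
    moreover from this obtain m n where "center m n \<in> C" "C = polygon_at p q m n"
      using polygon_contains_center by blast
    ultimately have "center m n \<in> block p q A B" by blast
    hence "(m, n) \<in> {W * (W * A)..<W * (W * A) + W} \<times> {W * B..<W * B + W}"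
      unfolding block_eq_rect center_in_rect_iff by simp
    thus "C \<in> (\<lambda>(m, n). polygon_at p q m n) ` ({W * (W * A)..<W * (W * A) + W} \<times> {W * B..<W * B + W})"
      using \<open>C = polygon_at p q m n\<close> by force
  qed
qed auto

lemma obtain_inverse:
  assumes "coprime c W"
  obtains n where "0 \<le> n" "n < W" "c * n mod W = s mod W"
proof -
  obtain x y where "x * c + y * W = 1"
    using bezout_int[of c W] assms by auto
  hence x: "(x * c + y * W) * s = s" by simp
  have "c * (x * s) = s + W * (- y * s)" by (subst (2) x[symmetric]) (simp add: algebra_simps)
  hence cx: "c * (x * s) mod W = s mod W" by (simp only: mod_mult_self2)
  show thesis
  proof (rule that[of "x * s mod W"])
    show "c * (x * s mod W) mod W = s mod W" using cx by (simp only: mod_mult_right_eq)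
  qed (use W_pos in auto)
qed

lemma large_polygon:
  shows "\<exists>C \<in> plaid_polygons p q. C \<subseteq> block p q A B \<and> (of_int W - 1) / 2 \<le> diameter C"
proof -
  have "coprime (2 * int p) W" using odd_W coprime_p_W by simp
  then obtain n where n: "0 \<le> n" "n < W" "2 * int p * n mod W = 1 mod W" by (rule obtain_inverse)
  have "1 < W" using pq by (simp add: W_def)
  define t where "t = 2 * int p * n div W"
  have nt: "2 * int p * n = 1 + t * W"
    using n(3) \<open>1 < W\<close> div_mult_mod_eq[of "2 * int p * n" W] unfolding t_def by simp
  define X where "X = W * (W * A)"
  define Y where "Y = W * B"
  define C where "C = polygon_at p q X (Y + n)"
  have good0: "good_h p q X (Y + n)"
    using capacity_two_row(1)[OF nt, of 0] good_h_shift[of 0 A n B] \<open>1 < W\<close> by (simp add: X_def Y_def add.commute)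
  have c0: "center X (Y + n) \<in> plaid_union p q" by (rule center_in_union_h[OF good0])
  have cb: "center X (Y + n) \<in> block p q A B"
    unfolding block_eq_rect center_in_rect_iff using n W_pos by (simp add: X_def Y_def)
  have sub: "C \<subseteq> block p q A B" unfolding C_def by (rule polygon_in_block[OF c0 cb])
  define V where "V = (\<lambda>m k. good_v p q (X + int m) (Y + n + int k))"
  define H where "H = (\<lambda>m k. good_h p q (X + int m) (Y + n + int k))"
  define S where "S = (\<lambda>m k. polygon_at p q (X + int m) (Y + n + int k) = C)"
  \<comment> \<open>The squares counted lie between row \<open>n\<close> and the top of the block:
    the left, right and top sides of this strip carry no good edges, so every polygon meets the
    bottom row an even number of times. \<open>S\<close> selects the squares whose polygon is
    \<open>C\<close>.\<close>
  have "\<not> par (\<lambda>m. H m 0 \<and> S m 0) (nat W)"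
  proof (rule even_crossings[where V = V and K = "nat (W - n)"])
    show "(V m k \<noteq> V (Suc m) k) = (H m k \<noteq> H m (Suc k))" for m k
      using good_square[of "X + int m" "Y + n + int k"] by (simp add: V_def H_def add_ac)
    show "\<not> V 0 k" for k using good_v_multiple[of X] by (simp add: V_def X_def)
    show "\<not> V (nat W) k" for k using good_v_multiple[of "X + W"] W_pos by (simp add: V_def X_def)
    show "\<not> H m (nat (W - n))" for m
      using good_h_multiple[of "Y + W"] n by (simp add: H_def Y_def)
    show "S m k = S (Suc m) k" if "V (Suc m) k" for m k
      using that polygon_at_eq_v[of p q "X + int m" "Y + n + int k"] by (simp add: V_def S_def add_ac)
    show "S m k = S m (Suc k)" if "H m (Suc k)" for m k
      using that polygon_at_eq_h[of p q "X + int m" "Y + n + int k"] by (simp add: H_def S_def add_ac)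
  qed
  moreover have "0 < nat W" using W_pos by simp
  moreover have "H 0 0 \<and> S 0 0" using good0 by (simp add: H_def S_def C_def)
  ultimately obtain m where m: "0 < m" "m < nat W" "H m 0" "S m 0"
    using not_par_other[of "\<lambda>m. H m 0 \<and> S m 0" "nat W"] by blast
  have "good_h p q (int m) n"
    using m(3) good_h_shift[of "int m" A n B] by (simp add: H_def X_def Y_def add.commute)
  hence big: "W \<le> 2 * int m + 1" using capacity_two_row(2)[OF nt, of "int m"] m by auto
  have "center (X + int m) (Y + n) \<in> plaid_union p q"
    using m(3) by (intro center_in_union_h) (simp add: H_def)
  hence "center (X + int m) (Y + n) \<in> C"
    using m(4) connected_component_refl_eq[of "plaid_union p q" "center (X + int m) (Y + n)"] by (auto simp: S_def)
  moreover have "center X (Y + n) \<in> C" unfolding C_def using c0 by simp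
  moreover have "bounded C" using bounded_block sub by (rule bounded_subset)
  ultimately have "dist (center (X + int m) (Y + n)) (center X (Y + n)) \<le> diameter C"
    by (intro diameter_bounded_bound)
  hence "of_nat m \<le> diameter C" unfolding dist_centers by simp
  moreover have "(of_int W - 1) / 2 \<le> real m"
  proof -
    have "real_of_int W \<le> of_int (2 * int m + 1)" using big by (simp only: of_int_le_iff)
    thus ?thesis by simp
  qed
  moreover have "C \<in> plaid_polygons p q" unfolding C_def by (rule polygon_at_in_polygons[OF c0])
  ultimately show ?thesis using sub by (intro bexI[of _ C]) auto
qed

text \<open>Multiplication by \<open>p\<close> permutes the residues modulo \<open>W\<close>, so
  \<open>P * n\<close> takes every value \<open>2 * s / W\<close> modulo 2. The \<open>K\<close>
  consecutive integers \<open>s\<close> just above \<open>u * W / 2\<close> give phases between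
  \<open>u\<close> and \<open>u + 2 * \<epsilon>\<close>, and they are distinct modulo
  \<open>W\<close> because \<open>K \<le> W\<close>.\<close>

lemma heights_in_interval:
  fixes u \<epsilon> :: real
  assumes "of_nat K < \<epsilon> * of_int W" "K \<le> nat W"
  shows "\<exists>f :: nat \<Rightarrow> int. inj_on f {..<K} \<and>
    (\<forall>i<K. 0 \<le> f i \<and> f i < W \<and> (\<exists>k. \<bar>P * of_int (f i) - u - 2 * of_int k\<bar> < 2 * \<epsilon>))"
proof -
  define s where "s = (\<lambda>i::nat. \<lfloor>u * of_int W / 2\<rfloor> + 1 + int i)"
  have "\<exists>n. 0 \<le> n \<and> n < W \<and> int p * n mod W = s i mod W" for i
    using obtain_inverse[OF coprime_p_W, of "s i"] by metis
  then obtain f where f: "\<And>i. 0 \<le> f i \<and> f i < W \<and> int p * f i mod W = s i mod W" by metis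
  show ?thesis
  proof (intro exI[of _ f] conjI allI impI)
    show "inj_on f {..<K}"
    proof (rule inj_onI)
      fix i j assume ij: "i \<in> {..<K}" "j \<in> {..<K}" "f i = f j"
      hence "s i mod W = s j mod W" using f by metis
      hence "W dvd s i - s j" by (simp add: mod_eq_dvd_iff)
      hence "W dvd int i - int j" by (simp add: s_def)
      moreover have "\<bar>int i - int j\<bar> < W" using ij assms(2) by auto
      ultimately show "i = j" using dvd_imp_le_int[of "int i - int j" W] W_pos by (cases "i = j") auto
    qed
    fix i assume i: "i < K"
    define z where "z = (int p * f i - s i) div W"
    have "W dvd int p * f i - s i" using f[of i] by (simp add: mod_eq_dvd_iff)
    hence z: "int p * f i = s i + z * W" by (simp add: z_def)
    have "real p * of_int (f i) = of_int (s i) + of_int z * of_int W"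
      using arg_cong[OF z, of real_of_int] by simp
    moreover have Wr: "0 < real_of_int W" using W_pos by simp
    moreover have "P = 2 * real p / of_int W" using P_W Wr by (simp add: field_simps)
    hence "P * of_int (f i) = 2 * (real p * of_int (f i)) / of_int W" by simp
    ultimately have "P * of_int (f i) = 2 * of_int (s i) / of_int W + 2 * of_int z"
      by (simp add: add_divide_distrib)
    moreover have s: "u * of_int W / 2 < of_int (s i)" "of_int (s i) \<le> u * of_int W / 2 + 1 + of_nat i"
      unfolding s_def by linarith+
    moreover have "1 + real i \<le> of_nat K" using i by linarith
    moreover have "u < 2 * of_int (s i) / of_int W" using s Wr by (simp add: field_simps)
    moreover have "2 * of_int (s i) / of_int W < u + 2 * \<epsilon>"
      using s \<open>1 + real i \<le> of_nat K\<close> assms(1) Wr by (simp add: field_simps)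
    ultimately have "\<bar>P * of_int (f i) - u - 2 * of_int z\<bar> < 2 * \<epsilon>"
      by linarith
    thus "\<exists>k. \<bar>P * of_int (f i) - u - 2 * of_int k\<bar> < 2 * \<epsilon>" by blast
    show "0 \<le> f i" "f i < W" using f by blast+
  qed
qed

text \<open>Two admissible heights have phases less than \<open>4 * \<epsilon>\<close> apart modulo
  2, so \<open>sep\<close> forces them to differ by more than \<open>h\<close>; the rectangles are
  then disjoint and trap different polygons. The summand \<open>nat h\<close> pays for rectangles
  reaching beyond the top of the block.\<close>

lemma many_polygons:
  fixes u \<epsilon> :: real
  assumes x: "0 \<le> x" "x \<le> i" "i < x + w" "0 \<le> j" "j < h" and xW: "x + w \<le> W"
    and box: "\<And>u'. \<bar>u' - u\<bar> < 2 * \<epsilon> \<Longrightarrow> isolating_box P x w h i j u'"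
    and sep: "\<And>k. 1 \<le> k \<Longrightarrow> k \<le> h \<Longrightarrow> 4 * \<epsilon> \<le> nrm (P * of_int k)"
    and K: "of_nat K < \<epsilon> * of_int W" "K \<le> nat W"
  shows "K \<le> card {C \<in> plaid_polygons p q. C \<subseteq> block p q A B} + nat h"
proof -
  obtain f where inj: "inj_on f {..<K}" and f: "\<And>i. i < K \<Longrightarrow> 0 \<le> f i \<and> f i < W \<and>
      (\<exists>k. \<bar>P * of_int (f i) - u - 2 * of_int k\<bar> < 2 * \<epsilon>)"
    using heights_in_interval[OF K, of u] by blast
  define X where "X = W * (W * A)"
  define Y where "Y = W * B"
  define T where "T = {n \<in> f ` {..<K}. n + h \<le> W}"
  define g where "g = (\<lambda>n. polygon_at p q (X + i) (Y + (n + j)))"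
  have T: "0 \<le> n \<and> n + h \<le> W \<and> (\<exists>k. \<bar>P * of_int n - u - 2 * of_int k\<bar> < 2 * \<epsilon>)" if "n \<in> T" for n
    using that f by (auto simp: T_def)
  have g: "center (X + i) (Y + (n + j)) \<in> plaid_union p q"
    "g n \<subseteq> box_rect (X + x) (X + (x + w)) (Y + n) (Y + (n + h))" if n: "n \<in> T" for n
  proof -
    obtain k where k: "\<bar>P * of_int n - u - 2 * of_int k\<bar> < 2 * \<epsilon>" using T[OF n] by blast
    have "isolating_box P x w h i j (P * of_int n - 2 * of_int k)"
      by (rule box) (use k in \<open>simp add: algebra_simps\<close>)
    hence b: "isolating_box P x w h i j (P * of_int n)"
      using isolating_box_shift[of P x w h i j "P * of_int n" "- k"] by simp
    have hs: "good_h p q (X + m) (Y + l) = good_h p q m l" and vs: "good_v p q (X + m) (Y + l) = good_v p q m l" for m l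
      using good_h_shift[of m A l B] good_v_shift[of m A l B] by (simp_all add: X_def Y_def add.commute)
    have h0: "\<not> good_h p q m n \<and> \<not> good_h p q m (n + h)" if "x \<le> m" "m < x + w" for m
    proof -
      have "0 < hcross P m (P * of_int n)" "0 < hcross P m (P * of_int (n + h))"
        using b that unfolding isolating_box_def by (simp_all add: distrib_left)
      thus ?thesis using hcross_good[of m n] hcross_good[of m "n + h"] by simp
    qed
    have v0: "\<not> good_v p q x l \<and> \<not> good_v p q (x + w) l" if "n \<le> l" "l < n + h" for l
    proof -
      have "P * of_int n + P * (of_int (l - n) + 1 / 2) = P * (of_int l + 1 / 2)" by (simp add: algebra_simps)
      moreover have "l - n \<in> {0..<h}" using that by simp
      ultimately have "0 < vcross P x (P * (of_int l + 1 / 2))" "0 < vcross P (x + w) (P * (of_int l + 1 / 2))"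
        using b unfolding isolating_box_def by metis+
      thus ?thesis using vcross_good[of x l] vcross_good[of "x + w" l] by simp
    qed
    have "vcross P i (P * (of_int (n + j) + 1 / 2)) < 0"
      using b unfolding isolating_box_def by (simp add: algebra_simps)
    hence "good_v p q i (n + j)" using vcross_good[of i "n + j"] by simp
    hence "good_v p q (X + i) (Y + (n + j))" by (simp only: vs)
    thus c: "center (X + i) (Y + (n + j)) \<in> plaid_union p q" by (rule center_in_union_v)
    show "g n \<subseteq> box_rect (X + x) (X + (x + w)) (Y + n) (Y + (n + h))"
      unfolding g_def
    proof (rule polygon_in_rect[OF _ _ c])
      show "\<not> good_v p q (X + x) l \<and> \<not> good_v p q (X + (x + w)) l" if "Y + n \<le> l" "l < Y + (n + h)" for l
        using v0[of "l - Y"] vs[of x "l - Y"] vs[of "x + w" "l - Y"] that by simp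
      show "\<not> good_h p q m (Y + n) \<and> \<not> good_h p q m (Y + (n + h))" if "X + x \<le> m" "m < X + (x + w)" for m
        using h0[of "m - X"] hs[of "m - X" n] hs[of "m - X" "n + h"] that by simp
      show "center (X + i) (Y + (n + j)) \<in> box_rect (X + x) (X + (x + w)) (Y + n) (Y + (n + h))"
        unfolding center_in_rect_iff using x by simp
    qed
  qed
  have "inj_on g T"
  proof (rule inj_onI)
    fix n l assume nl: "n \<in> T" "l \<in> T" "g n = g l"
    have lt: "\<not> (n < l)" if nl: "n \<in> T" "l \<in> T" "g n = g l" for n l
    proof
      assume "n < l"
      have "center (X + i) (Y + (l + j)) \<in> g l" unfolding g_def using g(1)[OF nl(2)] by simp
      hence "center (X + i) (Y + (l + j)) \<in> box_rect (X + x) (X + (x + w)) (Y + n) (Y + (n + h))"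
        using g(2)[OF nl(1)] nl(3) by blast
      hence "l - n \<le> h" unfolding center_in_rect_iff using x by simp
      hence "4 * \<epsilon> \<le> nrm (P * of_int (l - n))" using sep[of "l - n"] \<open>n < l\<close> by simp
      moreover obtain a where a: "\<bar>P * of_int n - u - 2 * of_int a\<bar> < 2 * \<epsilon>" using T[OF nl(1)] by blast
      moreover obtain b where b: "\<bar>P * of_int l - u - 2 * of_int b\<bar> < 2 * \<epsilon>" using T[OF nl(2)] by blast
      moreover have "nrm (P * of_int (l - n)) \<le> \<bar>P * of_int (l - n) - 2 * of_int (b - a)\<bar>" by (rule nrm_le)
      moreover have "P * of_int (l - n) - 2 * of_int (b - a) =
          (P * of_int l - u - 2 * of_int b) - (P * of_int n - u - 2 * of_int a)" by (simp add: algebra_simps)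
      ultimately show False by linarith
    qed
    show "n = l" using lt[OF nl] lt[OF nl(2,1) nl(3)[symmetric]] by simp
  qed
  moreover have "g ` T \<subseteq> {C \<in> plaid_polygons p q. C \<subseteq> block p q A B}"
  proof
    fix C assume "C \<in> g ` T"
    then obtain n where n: "n \<in> T" "C = g n" by blast
    have "center (X + i) (Y + (n + j)) \<in> block p q A B"
      unfolding block_eq_rect center_in_rect_iff using x xW T[OF n(1)] by (simp add: X_def Y_def)
    thus "C \<in> {C \<in> plaid_polygons p q. C \<subseteq> block p q A B}"
      using polygon_in_block[OF g(1)[OF n(1)]] polygon_at_in_polygons[OF g(1)[OF n(1)]] n(2) by (simp add: g_def)
  qed
  ultimately have "card T \<le> card {C \<in> plaid_polygons p q. C \<subseteq> block p q A B}"
    using finite_polygons_in_block by (metis card_image card_mono)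
  moreover have "K \<le> card T + nat h"
  proof -
    \<comment> \<open>A height is dropped only if \<open>n + h > W\<close>, which leaves fewer than
      \<open>h\<close> candidates below \<open>W\<close>.\<close>
    have "f ` {..<K} \<subseteq> T \<union> {W - h<..<W}"
      using f by (auto simp: T_def)
    hence "card (f ` {..<K}) \<le> card (T \<union> {W - h<..<W})" by (intro card_mono) (auto simp: T_def)
    also have "\<dots> \<le> card T + card {W - h<..<W}" by (rule card_Un_le)
    also have "card {W - h<..<W} \<le> nat h" by simp
    finally show ?thesis using inj by (simp add: card_image)
  qed
  ultimately show ?thesis by linarith
qed

end

section \<open>Passage to the limit along the sequence\<close>

text \<open>The fractions with numerator and denominator at most \<open>M\<close> form a finite,
  hence closed, set that misses the irrational limit.\<close>

lemma fraction_denominators_unbounded: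
  fixes p q :: "nat \<Rightarrow> nat" and \<alpha> :: real
  assumes lim: "(\<lambda>k. real (p k) / real (q k)) \<longlonglongrightarrow> \<alpha>" and irr: "\<alpha> \<notin> \<rat>" and le: "\<And>k. p k \<le> q k"
  shows "filterlim q at_top sequentially"
  unfolding filterlim_at_top
proof
  fix M
  let ?S = "(\<lambda>(a, b). real a / real b) ` ({..M} \<times> {..M})"
  have "finite ?S" by simp
  moreover have "\<alpha> \<notin> ?S" using irr by auto
  ultimately have "open (- ?S)" "\<alpha> \<in> - ?S" by (simp_all add: finite_imp_closed open_Compl)
  from topological_tendstoD[OF lim this]
  show "\<forall>\<^sub>F k in sequentially. M \<le> q k"
  proof eventually_elim
    case (elim k)
    show ?case
    proof (rule ccontr)
      assume "\<not> M \<le> q k"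
      hence "(p k, q k) \<in> {..M} \<times> {..M}" using le[of k] by auto
      hence "real (p k) / real (q k) \<in> ?S" by force
      thus False using elim by simp
    qed
  qed
qed

theorem theorem4p1:
  fixes p q :: "nat \<Rightarrow> nat" and \<alpha> :: real and a b :: "nat \<Rightarrow> int" and N :: int
  assumes "\<And>k. even_rational_param (p k) (q k)"
    and "(\<lambda>k. real (p k) / real (q k)) \<longlonglongrightarrow> \<alpha>"
    and "\<alpha> \<notin> \<rat>"
  shows "\<forall>\<^sub>F k in sequentially.
           int (card {C \<in> plaid_polygons (p k) (q k). C \<subseteq> block (p k) (q k) (a k) (b k)}) > N
         \<and> (\<exists>C \<in> plaid_polygons (p k) (q k). C \<subseteq> block (p k) (q k) (a k) (b k)
              \<and> diameter C > real_of_int N)"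
proof -
  have pl: "plaid (p k) (q k)" for k by (rule plaid.intro) (rule assms(1))
  have pq: "0 < p k" "p k < q k" for k using assms(1)[of k] by (auto simp: even_rational_param_def)
  have q_lim: "filterlim q at_top sequentially"
    by (rule fraction_denominators_unbounded[OF assms(2,3)]) (use pq less_imp_le in blast)
  \<comment> \<open>The limit of \<open>2 * p / (p + q)\<close>; it is irrational because \<alpha>
    is a rational function of it.\<close>
  define P where "P = 2 * \<alpha> / (1 + \<alpha>)"
  have "0 \<le> \<alpha>" by (rule LIMSEQ_le_const[OF assms(2)]) simp
  moreover have "\<alpha> \<le> 1"
  proof (rule LIMSEQ_le_const2[OF assms(2)])
    have "real (p k) / real (q k) \<le> 1" for k using pq[of k] by simp
    thus "\<exists>N. \<forall>n\<ge>N. real (p n) / real (q n) \<le> 1" by blast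
  qed
  moreover have "\<alpha> \<noteq> 0" "\<alpha> \<noteq> 1" using assms(3) by auto
  ultimately have \<alpha>: "0 < \<alpha>" "\<alpha> < 1" by auto
  have P01: "0 < P" "P < 1" using \<alpha> by (simp_all add: P_def field_simps)
  have "\<alpha> = P / (2 - P)" using \<alpha> by (simp add: P_def field_simps)
  hence irr: "P \<notin> \<rat>" using assms(3) by (metis Rats_diff Rats_divide Rats_number_of)
  have P_lim: "(\<lambda>k. PP (p k) (q k)) \<longlonglongrightarrow> P"
  proof -
    have "PP (p k) (q k) = 2 * (real (p k) / real (q k)) / (1 + real (p k) / real (q k))" for k
      using pq[of k] by (simp add: PP_def om_def field_simps)
    moreover have "(\<lambda>k. 2 * (real (p k) / real (q k)) / (1 + real (p k) / real (q k))) \<longlonglongrightarrow> P"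
      unfolding P_def using \<alpha> by (intro tendsto_intros assms(2)) simp
    ultimately show ?thesis by (simp only:)
  qed
  obtain x w h i j u where x: "0 \<le> x" "x \<le> i" "i < x + w" "0 \<le> j" "j < h" and box: "isolating_box P x w h i j u"
    using isolating_box_exists[OF irr P01] by blast
  obtain Pf Pg where Pf: "eventually Pf (nhds P)" and Pg: "eventually Pg (nhds u)"
    and PfPg: "\<And>P' u'. Pf P' \<Longrightarrow> Pg u' \<Longrightarrow> isolating_box P' x w h i j u'"
    using eventually_isolating_box[OF irr x(1) box] unfolding eventually_prod_filter by auto
  obtain \<delta> where \<delta>: "0 < \<delta>" "\<And>u'. dist u' u < \<delta> \<Longrightarrow> Pg u'"
    using Pg unfolding eventually_nhds_metric by blast
  define \<nu> where "\<nu> = Min ((\<lambda>k. nrm (P * of_int k)) ` {1..h})"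
  have "0 < \<nu>"
  proof -
    have "0 < nrm (P * of_int k)" if "1 \<le> k" for k
    proof (rule nrm_pos, rule notI)
      assume "P * of_int k \<in> \<int>"
      then obtain l where "P * of_int k = of_int l" by (auto elim: Ints_cases)
      hence "P = of_int l / of_int k" using that by (simp add: field_simps)
      thus False using irr by simp
    qed
    thus ?thesis unfolding \<nu>_def using x(4,5) by (subst Min_gr_iff) auto
  qed
  \<comment> \<open>\<open>2 * \<epsilon> \<le> \<delta>\<close> keeps all phases where the box
    persists. The factor 8 makes the separation by \<open>4 * \<epsilon>\<close> strict at the limit
    \<open>P\<close>, so that it passes to nearby parameters.\<close>
  define \<epsilon> where "\<epsilon> = min (\<delta> / 2) (\<nu> / 8)"
  have \<epsilon>: "0 < \<epsilon>" "2 * \<epsilon> \<le> \<delta>" "8 * \<epsilon> \<le> \<nu>" using \<delta>(1) \<open>0 < \<nu>\<close> by (auto simp: \<epsilon>_def)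
  have ev_sep: "\<forall>\<^sub>F k in sequentially. \<forall>l\<in>{1..h}. 4 * \<epsilon> < nrm (PP (p k) (q k) * of_int l)"
  proof (intro eventually_ball_finite ballI)
    fix l assume l: "l \<in> {1..h}"
    have "\<nu> \<le> nrm (P * of_int l)" unfolding \<nu>_def using l by (intro Min_le) auto
    hence "4 * \<epsilon> < nrm (P * of_int l)" using \<epsilon> \<open>0 < \<nu>\<close> by linarith
    thus "\<forall>\<^sub>F k in sequentially. 4 * \<epsilon> < nrm (PP (p k) (q k) * of_int l)"
      by (intro order_tendstoD(1)[of _ "nrm (P * of_int l)"] tendsto_intros P_lim)
  qed simp
  have ev_box: "\<forall>\<^sub>F k in sequentially. Pf (PP (p k) (q k))"
    using Pf P_lim by (rule eventually_compose_filterlim)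
  \<comment> \<open>\<open>nat h\<close> of the heights may be lost at the top of the block. The
    summands of \<open>M\<close> below make \<open>W\<close> large enough for \<open>K\<close>
    heights, for the columns of the box, and for a diameter of at least
    \<open>(W - 1) / 2 > N\<close>.\<close>
  define K where "K = nat \<bar>N\<bar> + 1 + nat h"
  define M where "M = nat \<lceil>of_nat K / \<epsilon>\<rceil> + K + nat (x + w) + 2 * nat \<bar>N\<bar> + 2"
  have M: "\<lceil>of_nat K / \<epsilon>\<rceil> < int M" "K \<le> M" "x + w \<le> int M" "2 * \<bar>N\<bar> + 2 \<le> int M"
    unfolding M_def by linarith+
  have ev_q: "\<forall>\<^sub>F k in sequentially. M \<le> q k"
    using q_lim by (simp add: filterlim_at_top)
  from ev_sep ev_box ev_q show ?thesis
  proof eventually_elim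
    case (elim k)
    interpret plaid "p k" "q k" by (rule pl)
    have WM: "int M \<le> W" using elim(3) by (simp add: W_def)
    have "of_nat K / \<epsilon> < of_int W"
    proof -
      have "of_nat K / \<epsilon> \<le> of_int \<lceil>of_nat K / \<epsilon>\<rceil>" by simp
      also have "\<lceil>of_nat K / \<epsilon>\<rceil> < W" using WM M(1) by linarith
      finally show ?thesis by simp
    qed
    hence K1: "of_nat K < \<epsilon> * of_int W" using \<epsilon>(1) by (simp add: field_simps)
    have K2: "K \<le> nat W" using WM M(2) by linarith
    have xW: "x + w \<le> W" using WM M(3) by linarith
    have "K \<le> card {C \<in> plaid_polygons (p k) (q k). C \<subseteq> block (p k) (q k) (a k) (b k)} + nat h"
    proof (rule many_polygons[OF x xW _ _ K1 K2])
      show "isolating_box (PP (p k) (q k)) x w h i j u'" if "\<bar>u' - u\<bar> < 2 * \<epsilon>" for u'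
        using that \<epsilon>(2) by (intro PfPg elim(2) \<delta>(2)) (simp add: dist_real_def)
      show "4 * \<epsilon> \<le> nrm (PP (p k) (q k) * of_int l)" if "1 \<le> l" "l \<le> h" for l
        using elim(1) that by (simp add: less_imp_le)
    qed
    hence "N < int (card {C \<in> plaid_polygons (p k) (q k). C \<subseteq> block (p k) (q k) (a k) (b k)})"
      unfolding K_def by linarith
    moreover obtain C where "C \<in> plaid_polygons (p k) (q k)" "C \<subseteq> block (p k) (q k) (a k) (b k)"
      "(of_int W - 1) / 2 \<le> diameter C"
      using large_polygon by blast
    moreover have "real_of_int N < (of_int W - 1) / 2"
    proof -
      have "2 * N + 1 < W" using WM M(4) by linarith
      hence "real_of_int (2 * N + 1) < of_int W" by (simp only: of_int_less_iff)
      thus ?thesis by simp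
    qed
    ultimately show ?case by (meson less_le_trans)
  qed
qed

end
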